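(* Let $d,k,N\ge 1$ and $1\le m\le N$ be integers, let $\varphi_1,\dots,\varphi_k:\mathbb R^d\to\mathbb C$ be continuous functions such that for any $a_1,\dots,a_k>0$ there exists $\widehat\xi\in\mathbb R^d$ with $|\varphi_j(\widehat\xi)|=a_j$, $j=1,\dots,k$. Let $\alpha^1,\dots,\alpha^N\in\mathbb R_+^k$, $\mathcal A=\{\alpha^1,\dots,\alpha^N\}$, $\alpha^0\in\operatorname{co}\mathcal A$, and $\delta_1,\dots,\delta_N>0$. Let the operators $\Lambda_jx=F^{-1}(\varphi^{\alpha^j}Fx)$, the space $\mathcal W_F^{\mathcal A}(\mathbb R^d)$, the class $W_F^{\mathcal A}(\mathbb R^d)$, the errors $e$ and $E$, the function $S$, the indices $j_1,\dots,j_l$, the numbers $\theta_{j_1},\dots,\theta_{j_l}$ and the set $M$ (determined by $\delta_1,\dots,\delta_N$) be as defined in the context. Then $$E(\Lambda_0,W_F^{\mathcal A}(\mathbb R^d),\delta)=e^{-S(\alpha^0)}.$$ If $M\ne\emptyset$, then all methods of the form $$\Phi(y)=F^{-1}\Bigl(\sum_{j\in M}a_j\,Fy_j\Bigr),$$ where $a_{j_1},\dots,a_{j_l}:\mathbb R^d\to\mathbb C$ are measurable functions satisfying for almost all $\xi\in\mathbb R^d$ the conditions $$\sum_{s=1}^l\varphi^{\alpha^{j_s}}(\xi)a_{j_s}(\xi)=\varphi^{\alpha^0}(\xi),\qquad \sum_{s=1}^l\frac{\delta_{j_s}^2|a_{j_s}(\xi)|^2}{\theta_{j_s}}\le e^{-2S(\alpha^0)},$$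 are optimal. If $M=\emptyset$, then the method $\Phi(y)=0$ is optimal. Moreover, the inequality $$\|\Lambda_0x\|_{L_2(\mathbb R^d)}\le\prod_{s=1}^l\|\Lambda_{j_s}x\|_{L_2(\mathbb R^d)}^{\theta_{j_s}}$$ is exact. That is, it holds for all $x\in\mathcal W_F^{\mathcal A}(\mathbb R^d)$, and there is no $x_0\in\mathcal W_F^{\mathcal A}(\mathbb R^d)$ for which $$\sup\bigl\{\|\Lambda_0x\|_{L_2(\mathbb R^d)}:x\in\mathcal W_F^{\mathcal A}(\mathbb R^d),\ \|\Lambda_jx\|_{L_2(\mathbb R^d)}\le\|\Lambda_jx_0\|_{L_2(\mathbb R^d)},\ j=1,\dots,N\bigr\}<\prod_{s=1}^l\|\Lambda_{j_s}x_0\|_{L_2(\mathbb R^d)}^{\theta_{j_s}}.$$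
   Context: Notation. $\mathbb R_+=[0,\infty)$. For $\alpha=(\alpha_1,\dots,\alpha_k)\in\mathbb R_+^k$, $\varphi^\alpha(\xi)=\varphi_1(\xi)^{\alpha_1}\cdots\varphi_k(\xi)^{\alpha_k}$, where for complex-valued $\varphi_i$ the powers are taken with a fixed measurable branch, so that $|\varphi^\alpha(\xi)|=|\varphi_1(\xi)|^{\alpha_1}\cdots|\varphi_k(\xi)|^{\alpha_k}$ (with $0^0=1$). $\operatorname{co}$ denotes the convex hull. $F$ is the Fourier transform on $L_2(\mathbb R^d)$. Spaces and operators. $\mathcal W_F^{\mathcal A}(\mathbb R^d)=\{x\in L_2(\mathbb R^d):\varphi^{\alpha^j}Fx\in L_2(\mathbb R^d),\ j=1,\dots,N\}$. For $j=0,1,\dots,N$, $\Lambda_j:\mathcal W_F^{\mathcal A}(\mathbb R^d)\to L_2(\mathbb R^d)$ is $\Lambda_jx=F^{-1}(\varphi^{\alpha^j}Fx)$. Further, $$W_F^{\mathcal A}(\mathbb R^d)=\{x\in\mathcal W_F^{\mathcal A}(\mathbb R^d):\|\Lambda_jx\|_{L_2(\mathbb R^d)}\le\delta_j,\ j=m+1,\dots,N\}$$ (no constraint if $m=N$), and $\delta=(\delta_1,\dots,\delta_m)$. Recovery problem. A recovery method is an arbitrary map $\Phi:(L_2(\mathbb R^d))^m\to L_2(\mathbb R^d)$. With $W=W_F^{\mathcal A}(\mathbb R^d)$, its error is $$e(\Lambda_0,W,\delta,\Phi)=\sup\{\|\Lambda_0x-\Phi(y)\|_{L_2(\mathbb R^d)}:\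 x\in W,\ y=(y_1,\dots,y_m)\in(L_2(\mathbb R^d))^m,\ \|\Lambda_jx-y_j\|_{L_2(\mathbb R^d)}\le\delta_j,\ j=1,\dots,m\}.$$ The error of optimal recovery is $E(\Lambda_0,W,\delta)=\inf_\Phi e(\Lambda_0,W,\delta,\Phi)$ over all methods; a method attaining the infimum is called optimal. The function $S$ and the data $j_s,\theta_{j_s},M$. Let $Q=\operatorname{co}\{(\alpha^1,\ln(1/\delta_1)),\dots,(\alpha^N,\ln(1/\delta_N))\}\subset\mathbb R^{k+1}$ and $S(\alpha)=\max\{z\in\mathbb R:(\alpha,z)\in Q\}$ for $\alpha\in\mathbb R^k$ ($S(\alpha)=-\infty$ if no such $z$ exists). Let $z=\langle\alpha,\widehat\eta\rangle+\widehat a$ (with $\widehat\eta\in\mathbb R^k$, $\widehat a\in\mathbb R$) be a support hyperplane to the graph of $S$ at $\alpha^0$, i.e. $S(\alpha)\le\langle\alpha,\widehat\eta\rangle+\widehat a$ for all $\alpha$, with equality at $\alpha=\alpha^0$. By Carathéodory's theorem there are indices $j_1,\dots,j_l\in\{1,\dots,N\}$, $l\le k+1$, such that the points $(\alpha^{j_s},\ln(1/\delta_{j_s}))$ lie on this hyperplane and $$\alpha^0=\sum_{s=1}^l\theta_{j_s}\alpha^{j_s},\qquad\theta_{j_s}>0,\qquad\sum_{s=1}^l\theta_{j_s}=1.$$ These indices and weights are fixed, and $M=\{j_1,\dots,j_l\}\cap\{1,\dots,m\}$. General definition of exactness used here: for linear operators $\Lambda_j:X\to Y_j$, $j=0,\dots,N$,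 from a linear space $X$ to normed linear spaces $Y_j$, and $\kappa:\mathbb R_+^N\to\mathbb R_+$, the inequality $\|\Lambda_0x\|_{Y_0}\le\kappa(\|\Lambda_1x\|_{Y_1},\dots,\|\Lambda_Nx\|_{Y_N})$ is exact if it holds for all $x\in X$ and there is no $x_0\in X$ for which $\sup\{\|\Lambda_0x\|_{Y_0}:x\in X,\ \|\Lambda_jx\|_{Y_j}\le\|\Lambda_jx_0\|_{Y_j},\ j=1,\dots,N\}<\kappa(\|\Lambda_1x_0\|_{Y_1},\dots,\|\Lambda_Nx_0\|_{Y_N})$.
   Formalization: The final "no x_0" claim is false as stated; it is proved for x_0 with all norms nonzero when the indices and weights are admissible for δ_j=‖Λ_j x_0‖, and, for any x_0, with only the constraints j_1,…,j_l when their exponents are affinely independent. *)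

theory Defs
  imports "HOL-Analysis.Analysis"
begin

section \<open>The space of square-integrable functions modulo equality almost everywhere\<close>

definition square_integrable :: "('a::euclidean_space \<Rightarrow> complex) \<Rightarrow> bool" where
  "square_integrable f \<longleftrightarrow>
     f \<in> borel_measurable lebesgue \<and> integrable lebesgue (\<lambda>t. (cmod (f t))\<^sup>2)"

definition L2_eq :: "('a::euclidean_space \<Rightarrow> complex) \<Rightarrow> ('a \<Rightarrow> complex) \<Rightarrow> bool" where
  "L2_eq f g \<longleftrightarrow>
     square_integrable f \<and> square_integrable g \<and> (AE t in lebesgue. f t = g t)"

lemma square_integrable_zero [simp]: "square_integrable (\<lambda>_. 0)"
  by (simp add: square_integrable_def)

lemma square_integrable_add:
  assumes "square_integrable f" "square_integrable g"
  shows "square_integrable (\<lambda>t. f t + g t)"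
proof -
  have [measurable]: "f \<in> borel_measurable lebesgue" "g \<in> borel_measurable lebesgue"
    using assms by (auto simp: square_integrable_def)
  have bound: "(cmod (f t + g t))\<^sup>2 \<le> 2 * (cmod (f t))\<^sup>2 + 2 * (cmod (g t))\<^sup>2" for t
  proof -
    have "(cmod (f t + g t))\<^sup>2 \<le> (cmod (f t) + cmod (g t))\<^sup>2"
      by (intro power_mono norm_triangle_ineq) auto
    also have "\<dots> \<le> 2 * (cmod (f t))\<^sup>2 + 2 * (cmod (g t))\<^sup>2"
      using sum_squares_bound[of "cmod (f t)" "cmod (g t)"]
      by (simp add: power2_sum)
    finally show ?thesis .
  qed
  have "integrable lebesgue (\<lambda>t. 2 * (cmod (f t))\<^sup>2 + 2 * (cmod (g t))\<^sup>2)"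
    using assms by (auto simp: square_integrable_def)
  then have "integrable lebesgue (\<lambda>t. (cmod (f t + g t))\<^sup>2)"
    by (rule Bochner_Integration.integrable_bound) (use bound in auto)
  then show ?thesis by (simp add: square_integrable_def)
qed

lemma square_integrable_cmult:
  assumes "square_integrable f"
  shows "square_integrable (\<lambda>t. c * f t)"
  using assms by (auto simp: square_integrable_def norm_mult power_mult_distrib)

lemma square_integrable_scaleR:
  assumes "square_integrable f"
  shows "square_integrable (\<lambda>t. c *\<^sub>R f t)"
  using square_integrable_cmult[OF assms, of "of_real c"] by (simp add: scaleR_conv_of_real)

lemma square_integrable_uminus:
  assumes "square_integrable f"
  shows "square_integrable (\<lambda>t. - f t)"
  using square_integrable_cmult[OF assms, of "-1"] by simp

lemma square_integrable_diff:
  assumes "square_integrable f" "square_integrable g"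
  shows "square_integrable (\<lambda>t. f t - g t)"
  using square_integrable_add[OF assms(1) square_integrable_uminus[OF assms(2)]] by simp

lemma integrable_inner_square_integrable:
  assumes "square_integrable f" "square_integrable g"
  shows "integrable lebesgue (\<lambda>t. f t \<bullet> g t)"
proof -
  have [measurable]: "f \<in> borel_measurable lebesgue" "g \<in> borel_measurable lebesgue"
    using assms by (auto simp: square_integrable_def)
  have bound: "\<bar>f t \<bullet> g t\<bar> \<le> (cmod (f t))\<^sup>2 + (cmod (g t))\<^sup>2" for t
  proof -
    have "\<bar>f t \<bullet> g t\<bar> \<le> cmod (f t) * cmod (g t)"
      by (rule Cauchy_Schwarz_ineq2)
    also have "\<dots> \<le> (cmod (f t))\<^sup>2 + (cmod (g t))\<^sup>2"
      using sum_squares_bound[of "cmod (f t)" "cmod (g t)"]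
        mult_nonneg_nonneg[OF norm_ge_zero norm_ge_zero, of "f t" "g t"] by linarith
    finally show ?thesis .
  qed
  have "integrable lebesgue (\<lambda>t. (cmod (f t))\<^sup>2 + (cmod (g t))\<^sup>2)"
    using assms by (auto simp: square_integrable_def)
  then show ?thesis
    by (rule Bochner_Integration.integrable_bound) (use bound in auto)
qed

quotient_type (overloaded) 'a L2 =
  "'a::euclidean_space \<Rightarrow> complex" / partial: L2_eq
proof (rule part_equivpI)
  show "\<exists>f. L2_eq f f"
    by (rule exI[of _ "\<lambda>_. 0"]) (simp add: L2_eq_def)
  show "symp L2_eq"
    by (auto simp: symp_def L2_eq_def)
  show "transp L2_eq"
    unfolding transp_def L2_eq_def by (auto elim: eventually_elim2)
qed

instantiation L2 :: (euclidean_space) real_inner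
begin

lift_definition zero_L2 :: "'a L2" is "\<lambda>_. 0"
  by (simp add: L2_eq_def)

lift_definition plus_L2 :: "'a L2 \<Rightarrow> 'a L2 \<Rightarrow> 'a L2" is "\<lambda>f g t. f t + g t"
  by (auto simp: L2_eq_def square_integrable_add elim: eventually_elim2)

lift_definition minus_L2 :: "'a L2 \<Rightarrow> 'a L2 \<Rightarrow> 'a L2" is "\<lambda>f g t. f t - g t"
  by (auto simp: L2_eq_def square_integrable_diff elim: eventually_elim2)

lift_definition uminus_L2 :: "'a L2 \<Rightarrow> 'a L2" is "\<lambda>f t. - f t"
  by (auto simp: L2_eq_def square_integrable_uminus)

lift_definition scaleR_L2 :: "real \<Rightarrow> 'a L2 \<Rightarrow> 'a L2" is "\<lambda>c f t. c *\<^sub>R f t"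
  by (auto simp: L2_eq_def intro: square_integrable_scaleR)

lift_definition norm_L2 :: "'a L2 \<Rightarrow> real" is
  "\<lambda>f. sqrt (\<integral>t. (cmod (f t))\<^sup>2 \<partial>lebesgue)"
proof -
  fix f g :: "'a \<Rightarrow> complex"
  assume "L2_eq f g"
  then have "(\<integral>t. (cmod (f t))\<^sup>2 \<partial>lebesgue) = (\<integral>t. (cmod (g t))\<^sup>2 \<partial>lebesgue)"
    unfolding L2_eq_def square_integrable_def
    by (intro integral_cong_AE borel_measurable_integrable) (auto elim: eventually_mono)
  then show "sqrt (\<integral>t. (cmod (f t))\<^sup>2 \<partial>lebesgue) = sqrt (\<integral>t. (cmod (g t))\<^sup>2 \<partial>lebesgue)"
    by simp
qed

text \<open>The real inner product, that is, the real part of the integral of \<open>f\<close> times the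
  conjugate of \<open>g\<close>.\<close>

lift_definition inner_L2 :: "'a L2 \<Rightarrow> 'a L2 \<Rightarrow> real" is
  "\<lambda>f g. \<integral>t. f t \<bullet> g t \<partial>lebesgue"
proof -
  fix f f' g g' :: "'a \<Rightarrow> complex"
  assume *: "L2_eq f f'" "L2_eq g g'"
  then have "AE t in lebesgue. f t \<bullet> g t = f' t \<bullet> g' t"
    unfolding L2_eq_def by (auto elim: eventually_elim2)
  with * show "(\<integral>t. f t \<bullet> g t \<partial>lebesgue) = (\<integral>t. f' t \<bullet> g' t \<partial>lebesgue)"
    unfolding L2_eq_def
    by (intro integral_cong_AE borel_measurable_integrable integrable_inner_square_integrable) auto
qed

definition dist_L2 :: "'a L2 \<Rightarrow> 'a L2 \<Rightarrow> real" where
  "dist_L2 x y = norm (x - y)"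

definition sgn_L2 :: "'a L2 \<Rightarrow> 'a L2" where
  "sgn_L2 x = inverse (norm x) *\<^sub>R x"

definition uniformity_L2 :: "('a L2 \<times> 'a L2) filter" where
  "uniformity_L2 = (INF e\<in>{0 <..}. principal {(x, y). dist x y < e})"

definition open_L2 :: "'a L2 set \<Rightarrow> bool" where
  "open_L2 U \<longleftrightarrow> (\<forall>x\<in>U. eventually (\<lambda>(x', y). x' = x \<longrightarrow> y \<in> U) uniformity)"

instance
proof
  fix x y z :: "'a L2" and r s :: real and U :: "'a L2 set"
  show "dist x y = norm (x - y)" by (rule dist_L2_def)
  show "sgn x = inverse (norm x) *\<^sub>R x" by (rule sgn_L2_def)
  show "(uniformity :: ('a L2 \<times> 'a L2) filter) =
      (INF e\<in>{0 <..}. principal {(x, y). dist x y < e})" by (rule uniformity_L2_def)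
  show "open U \<longleftrightarrow> (\<forall>x\<in>U. eventually (\<lambda>(x', y). x' = x \<longrightarrow> y \<in> U) uniformity)"
    by (rule open_L2_def)
  show "x + y + z = x + (y + z)"
    by transfer (simp add: L2_eq_def square_integrable_add add.assoc)
  show "x + y = y + x"
    by transfer (simp add: L2_eq_def square_integrable_add add.commute)
  show "0 + x = x"
    by transfer (simp add: L2_eq_def)
  show "- x + x = 0"
    by transfer (simp add: L2_eq_def)
  show "x - y = x + - y"
    by transfer (simp add: L2_eq_def square_integrable_diff)
  show "r *\<^sub>R (x + y) = r *\<^sub>R x + r *\<^sub>R y"
    by transfer (simp add: L2_eq_def square_integrable_add square_integrable_scaleR
        scaleR_add_right del: scaleR_conv_of_real)
  show "(r + s) *\<^sub>R x = r *\<^sub>R x + s *\<^sub>R x"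
    by transfer (simp add: L2_eq_def square_integrable_add square_integrable_scaleR
        scaleR_add_left)
  show "r *\<^sub>R s *\<^sub>R x = (r * s) *\<^sub>R x"
    by transfer (simp add: L2_eq_def square_integrable_scaleR)
  show "1 *\<^sub>R x = x"
    by transfer (simp add: L2_eq_def)
  show "inner x y = inner y x"
    by transfer (simp add: inner_commute)
  show "inner (x + y) z = inner x z + inner y z"
    by transfer (simp add: L2_eq_def inner_add_left integrable_inner_square_integrable)
  show "inner (r *\<^sub>R x) y = r * inner x y"
    by transfer (simp add: L2_eq_def)
  show "0 \<le> inner x x"
    by transfer simp
  show "inner x x = 0 \<longleftrightarrow> x = 0"
  proof transfer
    fix f :: "'a \<Rightarrow> complex"
    assume f: "L2_eq f f"
    have "(\<integral>t. f t \<bullet> f t \<partial>lebesgue) = 0 \<longleftrightarrow> (AE t in lebesgue. f t \<bullet> f t = 0)"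
      using f by (intro integral_nonneg_eq_0_iff_AE integrable_inner_square_integrable)
        (auto simp: L2_eq_def)
    then show "(\<integral>t. f t \<bullet> f t \<partial>lebesgue) = 0 \<longleftrightarrow> L2_eq f (\<lambda>_. 0)"
      using f by (simp add: L2_eq_def)
  qed
  show "norm x = sqrt (inner x x)"
    by transfer (simp add: power2_norm_eq_inner)
qed

end

text \<open>\<open>rep_L2 x\<close> is some representative of the class \<open>x\<close>, and \<open>abs_L2 f\<close> is the class
  of \<open>f\<close>; the latter is meaningful only for square-integrable \<open>f\<close>.\<close>


section \<open>The Fourier transform\<close>

definition fourier_integral :: "('a::euclidean_space \<Rightarrow> complex) \<Rightarrow> 'a \<Rightarrow> complex" where
  "fourier_integral f \<xi> =
     of_real ((2 * pi) powr (- real DIM('a) / 2)) * (\<integral>t. cis (- (\<xi> \<bullet> t)) * f t \<partial>lebesgue)"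

text \<open>Plancherel's extension to the square-integrable functions: the limit in norm of the
  Fourier integrals over balls of growing radius.\<close>

definition fourier :: "'a::euclidean_space L2 \<Rightarrow> 'a L2" where
  "fourier x =
     lim (\<lambda>n::nat. abs_L2 (fourier_integral (\<lambda>t. indicator (cball 0 (real n)) t * rep_L2 x t)))"

abbreviation inverse_fourier :: "'a::euclidean_space L2 \<Rightarrow> 'a L2" where
  "inverse_fourier \<equiv> inv fourier"


section \<open>The operators and function classes\<close>

text \<open>\<open>is_branch \<phi> arg\<close>: the functions \<open>arg i\<close> are measurable choices of the argument of
  \<open>\<phi> i\<close>. They fix the branch of all the powers of \<open>\<phi> i\<close>.\<close>

definition is_branch ::
  "('k \<Rightarrow> 'a::euclidean_space \<Rightarrow> complex) \<Rightarrow> ('k \<Rightarrow> 'a \<Rightarrow> real) \<Rightarrow> bool" where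
  "is_branch \<phi> arg \<longleftrightarrow>
     (\<forall>i. arg i \<in> borel_measurable lebesgue \<and> (\<forall>\<xi>. \<phi> i \<xi> = rcis (cmod (\<phi> i \<xi>)) (arg i \<xi>)))"

text \<open>The case distinction is needed because \<open>0 powr 0 = 0\<close>, whereas here the power with
  exponent \<open>0\<close> is always \<open>1\<close>.\<close>

definition multi_power ::
  "('k::finite \<Rightarrow> 'a \<Rightarrow> complex) \<Rightarrow> ('k \<Rightarrow> 'a \<Rightarrow> real) \<Rightarrow> real ^ 'k \<Rightarrow> 'a \<Rightarrow> complex" where
  "multi_power \<phi> arg \<beta> \<xi> =
     (\<Prod>i\<in>UNIV. if \<beta> $ i = 0 then 1
                else rcis (cmod (\<phi> i \<xi>) powr (\<beta> $ i)) (\<beta> $ i * arg i \<xi>))"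

text \<open>The exponent vectors are \<open>\<alpha> 0, \<alpha> 1, \<dots>, \<alpha> N\<close>; the space depends only on
  \<open>\<alpha> 1, \<dots>, \<alpha> N\<close>.\<close>

definition multiplier_space ::
  "('k::finite \<Rightarrow> 'a::euclidean_space \<Rightarrow> complex) \<Rightarrow> ('k \<Rightarrow> 'a \<Rightarrow> real) \<Rightarrow>
    (nat \<Rightarrow> real ^ 'k) \<Rightarrow> nat \<Rightarrow> 'a L2 set" where
  "multiplier_space \<phi> arg \<alpha> N =
     {x. \<forall>j\<in>{1..N}.
        square_integrable (\<lambda>\<xi>. multi_power \<phi> arg (\<alpha> j) \<xi> * rep_L2 (fourier x) \<xi>)}"

definition multiplier_op ::
  "('k::finite \<Rightarrow> 'a::euclidean_space \<Rightarrow> complex) \<Rightarrow> ('k \<Rightarrow> 'a \<Rightarrow> real) \<Rightarrow>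
    (nat \<Rightarrow> real ^ 'k) \<Rightarrow> nat \<Rightarrow> 'a L2 \<Rightarrow> 'a L2" where
  "multiplier_op \<phi> arg \<alpha> j x =
     inverse_fourier (abs_L2 (\<lambda>\<xi>. multi_power \<phi> arg (\<alpha> j) \<xi> * rep_L2 (fourier x) \<xi>))"

definition multiplier_class ::
  "('k::finite \<Rightarrow> 'a::euclidean_space \<Rightarrow> complex) \<Rightarrow> ('k \<Rightarrow> 'a \<Rightarrow> real) \<Rightarrow>
    (nat \<Rightarrow> real ^ 'k) \<Rightarrow> (nat \<Rightarrow> real) \<Rightarrow> nat \<Rightarrow> nat \<Rightarrow> 'a L2 set" where
  "multiplier_class \<phi> arg \<alpha> \<delta> m N =
     {x \<in> multiplier_space \<phi> arg \<alpha> N.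
        \<forall>j\<in>{m+1..N}. norm (multiplier_op \<phi> arg \<alpha> j x) \<le> \<delta> j}"


section \<open>Optimal recovery\<close>

text \<open>The \<open>m\<close>-tuples of data are the extensional functions on \<open>{1..m}\<close>, so that only the
  values of a method at such functions matter. The errors may be infinite.\<close>

definition recovery_error ::
  "(nat \<Rightarrow> 'x \<Rightarrow> 'y::real_normed_vector) \<Rightarrow> 'x set \<Rightarrow> nat \<Rightarrow> (nat \<Rightarrow> real) \<Rightarrow>
    ((nat \<Rightarrow> 'y) \<Rightarrow> 'y) \<Rightarrow> ereal" where
  "recovery_error \<Lambda> W m \<delta> \<Phi> =
     (SUP (x, y) \<in> {(x, y). x \<in> W \<and> y \<in> {1..m} \<rightarrow>\<^sub>E UNIV \<and>
                          (\<forall>j\<in>{1..m}. norm (\<Lambda> j x - y j) \<le> \<delta> j)}.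
        ereal (norm (\<Lambda> 0 x - \<Phi> y)))"

definition optimal_error ::
  "(nat \<Rightarrow> 'x \<Rightarrow> 'y::real_normed_vector) \<Rightarrow> 'x set \<Rightarrow> nat \<Rightarrow> (nat \<Rightarrow> real) \<Rightarrow> ereal" where
  "optimal_error \<Lambda> W m \<delta> = (INF \<Phi>. recovery_error \<Lambda> W m \<delta> \<Phi>)"

definition optimal_method ::
  "(nat \<Rightarrow> 'x \<Rightarrow> 'y::real_normed_vector) \<Rightarrow> 'x set \<Rightarrow> nat \<Rightarrow> (nat \<Rightarrow> real) \<Rightarrow>
    ((nat \<Rightarrow> 'y) \<Rightarrow> 'y) \<Rightarrow> bool" where
  "optimal_method \<Lambda> W m \<delta> \<Phi> \<longleftrightarrow>
     recovery_error \<Lambda> W m \<delta> \<Phi> = optimal_error \<Lambda> W m \<delta>"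


section \<open>The upper boundary of the convex hull and its support hyperplanes\<close>

definition exponent_hull ::
  "(nat \<Rightarrow> real ^ 'k) \<Rightarrow> (nat \<Rightarrow> real) \<Rightarrow> nat \<Rightarrow> ((real ^ 'k) \<times> real) set" where
  "exponent_hull \<alpha> \<delta> N = convex hull ((\<lambda>j. (\<alpha> j, ln (1 / \<delta> j))) ` {1..N})"

definition S_fun ::
  "(nat \<Rightarrow> real ^ 'k) \<Rightarrow> (nat \<Rightarrow> real) \<Rightarrow> nat \<Rightarrow> real ^ 'k \<Rightarrow> ereal" where
  "S_fun \<alpha> \<delta> N \<beta> =
     (if \<exists>z. (\<beta>, z) \<in> exponent_hull \<alpha> \<delta> N
      then ereal (GREATEST z. (\<beta>, z) \<in> exponent_hull \<alpha> \<delta> N) else - \<infinity>)"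

definition support_hyperplane ::
  "(nat \<Rightarrow> real ^ 'k::finite) \<Rightarrow> (nat \<Rightarrow> real) \<Rightarrow> nat \<Rightarrow> real ^ 'k \<Rightarrow> real \<Rightarrow> bool" where
  "support_hyperplane \<alpha> \<delta> N \<eta> a \<longleftrightarrow>
     (\<forall>\<beta>. S_fun \<alpha> \<delta> N \<beta> \<le> ereal (\<beta> \<bullet> \<eta> + a)) \<and>
     S_fun \<alpha> \<delta> N (\<alpha> 0) = ereal (\<alpha> 0 \<bullet> \<eta> + a)"

text \<open>The indices are \<open>j 1, \<dots>, j l\<close>; the weight belonging to the index \<open>j s\<close> is \<open>\<theta> (j s)\<close>.\<close>

definition support_data ::
  "(nat \<Rightarrow> real ^ 'k::finite) \<Rightarrow> (nat \<Rightarrow> real) \<Rightarrow> nat \<Rightarrow> real ^ 'k \<Rightarrow> real \<Rightarrow>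
    nat \<Rightarrow> (nat \<Rightarrow> nat) \<Rightarrow> (nat \<Rightarrow> real) \<Rightarrow> bool" where
  "support_data \<alpha> \<delta> N \<eta> a l j \<theta> \<longleftrightarrow>
     support_hyperplane \<alpha> \<delta> N \<eta> a \<and>
     l \<le> CARD('k) + 1 \<and> inj_on j {1..l} \<and> j ` {1..l} \<subseteq> {1..N} \<and>
     (\<forall>s\<in>{1..l}. ln (1 / \<delta> (j s)) = \<alpha> (j s) \<bullet> \<eta> + a) \<and>
     (\<forall>s\<in>{1..l}. 0 < \<theta> (j s)) \<and> (\<Sum>s=1..l. \<theta> (j s)) = 1 \<and>
     \<alpha> 0 = (\<Sum>s=1..l. \<theta> (j s) *\<^sub>R \<alpha> (j s))"


section \<open>Exact inequalities\<close>

text \<open>Exactness of the inequality that bounds the norm of \<open>\<Lambda> 0 x\<close> by \<open>\<kappa>\<close> of the norms of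
  \<open>\<Lambda> i x\<close>, where \<open>i\<close> ranges over the index set \<open>I\<close> of the operators that occur on the
  right-hand side. The choice of \<open>I\<close> matters: if, say, \<open>I\<close> also contains an operator equal
  to \<open>\<Lambda> 0\<close> on which \<open>\<kappa>\<close> does not depend, then the supremum is just the norm of \<open>\<Lambda> 0 x0\<close>, and
  the inequality is exact only if it is an equality for every \<open>x0\<close>.\<close>

definition exact_inequality ::
  "'x set \<Rightarrow> (nat \<Rightarrow> 'x \<Rightarrow> 'y::real_normed_vector) \<Rightarrow> nat set \<Rightarrow>
    ((nat \<Rightarrow> real) \<Rightarrow> real) \<Rightarrow> bool" where
  "exact_inequality X \<Lambda> I \<kappa> \<longleftrightarrow>
     (\<forall>x\<in>X. norm (\<Lambda> 0 x) \<le> \<kappa> (\<lambda>i. norm (\<Lambda> i x))) \<and>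
     \<not> (\<exists>x0\<in>X. (SUP x\<in>{x\<in>X. \<forall>i\<in>I. norm (\<Lambda> i x) \<le> norm (\<Lambda> i x0)}. ereal (norm (\<Lambda> 0 x)))
                  < ereal (\<kappa> (\<lambda>i. norm (\<Lambda> i x0))))"

end

theory Submission
  imports Defs "HOL-Probability.Probability"
begin

text \<open>By Plancherel everything happens on the Fourier side, where \<open>\<Lambda> j\<close> is multiplication by
  \<open>\<phi>\<close> to the power \<open>\<alpha> j\<close>. The upper bound is the pointwise Cauchy-Schwarz inequality applied to
  the admissible coefficients, which exist by the weighted inequality of arithmetic and geometric
  means. For the lower bound, take a hyperplane with normal \<open>\<eta>\<close> above the points
  \<open>(\<alpha> j, ln (1 / \<delta> j))\<close> and a point where the modulus of each \<open>\<phi> i\<close> is \<open>exp (- \<eta> $ i)\<close>: a function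
  whose Fourier transform is concentrated near that point satisfies all the constraints and is
  almost extremal.\<close>

section \<open>The Gaussian and the Fourier integral\<close>

text \<open>\<open>inverse_fourier\<close> is the bare \<open>inv\<close> of a map that is itself a
  \<open>lim\<close>, so no property of the operators is accessible before \<open>fourier\<close> is
  known to be a bijective isometry; this is why Plancherel's theorem and the completeness of
  \<open>L2\<close> precede the recovery problem. Surjectivity needs no inversion formula: the
  multiplication formula identifies the adjoint as conjugation, transform, conjugation, which is
  again an isometry. One point has measure zero, so functions concentrated near it only approach the
  extremal value, and a loss factor \<open>\<tau> < 1\<close> is carried along. The bounds are
  proved for arbitrary positive levels in place of \<open>\<delta>\<close>, because exactness asks
  the same extremal question with the norms of an element \<open>x0\<close> as levels.\<close>

lemma
  fixes f :: "'a::euclidean_space \<Rightarrow> real \<Rightarrow> complex"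
  assumes int: "\<And>b. b \<in> Basis \<Longrightarrow> integrable lborel (f b)"
  shows integrable_lborel_prod: "integrable lborel (\<lambda>x. \<Prod>b\<in>Basis. f b (x \<bullet> b))"
    and integral_lborel_prod:
      "(\<integral>x. (\<Prod>b\<in>Basis. f b (x \<bullet> b)) \<partial>lborel) = (\<Prod>b\<in>Basis. \<integral>x. f b x \<partial>lborel)"
proof -
  interpret product_sigma_finite "\<lambda>_::'a. lborel :: real measure"
    by standard
  have [measurable]: "f b \<in> borel_measurable borel" if "b \<in> Basis" for b
    using int[OF that] by auto
  have eq: "(\<Prod>b\<in>Basis. f b ((\<Sum>b'\<in>Basis. x b' *\<^sub>R b') \<bullet> b)) = (\<Prod>b\<in>Basis. f b (x b))" for x
    by (intro prod.cong) (auto simp: inner_sum_left_Basis)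
  show "integrable lborel (\<lambda>x. \<Prod>b\<in>Basis. f b (x \<bullet> b))"
    unfolding lborel_eq[where 'a='a]
    by (subst integrable_distr_eq) (auto simp: eq intro!: product_integrable_prod int)
  show "(\<integral>x. (\<Prod>b\<in>Basis. f b (x \<bullet> b)) \<partial>lborel) = (\<Prod>b\<in>Basis. \<integral>x. f b x \<partial>lborel)"
    unfolding lborel_eq[where 'a='a]
    by (subst integral_distr) (auto simp: eq intro!: product_integral_prod int)
qed

lemma integral_lborel_affine:
  fixes f :: "'a::euclidean_space \<Rightarrow> complex"
  assumes [measurable]: "f \<in> borel_measurable borel" and c: "c > 0"
  shows "(\<integral>x. f x \<partial>lborel) = of_real (c ^ DIM('a)) * (\<integral>x. f (t + c *\<^sub>R x) \<partial>lborel)"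
proof -
  have "(\<integral>x. f x \<partial>lborel) =
      (\<integral>x. f x \<partial>density (distr lborel borel (\<lambda>x. t + c *\<^sub>R x)) (\<lambda>_. \<bar>c\<bar>^DIM('a)))"
    using lborel_affine[of c t] c by simp
  also have "\<dots> = (\<integral>x. (c ^ DIM('a)) *\<^sub>R f (t + c *\<^sub>R x) \<partial>lborel)"
    using c by (subst integral_density) (auto simp: integral_distr)
  also have "\<dots> = of_real (c ^ DIM('a)) * (\<integral>x. f (t + c *\<^sub>R x) \<partial>lborel)"
    by (subst integral_scaleR_right) (simp add: scaleR_conv_of_real)
  finally show ?thesis .
qed

text \<open>Up to normalisation this is the characteristic function of the standard normal law. The
  kernel of \<open>char\<close> is \<open>iexp (t * x)\<close>, hence its argument
  \<open>-u\<close>.\<close>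

lemma
  shows integrable_gaussian_real: "integrable lborel (\<lambda>x::real. cis (- (u * x)) * of_real (exp (- (x\<^sup>2 / 2))))"
    and integral_gaussian_real: "(\<integral>x. cis (- (u * (x::real))) * of_real (exp (- (x\<^sup>2 / 2))) \<partial>lborel)
       = of_real (sqrt (2 * pi) * exp (- (u\<^sup>2 / 2)))"
proof -
  have eq: "cis (- (u * x)) * of_real (exp (- (x\<^sup>2 / 2))) =
      sqrt (2 * pi) * (std_normal_density x *\<^sub>R iexp ((-u) * x))" for x :: real
    by (simp add: std_normal_density_def cis_conv_exp scaleR_conv_of_real)
  have "integrable lborel (\<lambda>x. of_real (sqrt (2 * pi)) * (std_normal_density x *\<^sub>R iexp ((-u) * x)))"
    by (rule integrable_mult_right,
        rule Bochner_Integration.integrable_bound[OF integrable_normal_density[of 1 0]]) auto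
  then show "integrable lborel (\<lambda>x::real. cis (- (u * x)) * of_real (exp (- (x\<^sup>2 / 2))))"
    unfolding eq by simp
  have "char std_normal_distribution (-u) = (\<integral>x. std_normal_density x *\<^sub>R iexp ((-u) * x) \<partial>lborel)"
    unfolding char_def by (subst integral_density) auto
  then have *: "(\<integral>x. std_normal_density x *\<^sub>R iexp ((-u) * x) \<partial>lborel) = of_real (exp (- (u^2) / 2))"
    by (simp add: char_std_normal_distribution)
  show "(\<integral>x. cis (- (u * (x::real))) * of_real (exp (- (x\<^sup>2 / 2))) \<partial>lborel)
       = of_real (sqrt (2 * pi) * exp (- (u\<^sup>2 / 2)))"
    unfolding eq using * by (subst integral_mult_right_zero) simp
qed

lemma
  assumes e: "e > (0::real)"
  shows integrable_gaussian_real_scaled: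
      "integrable lborel (\<lambda>x::real. cis (- (u * x)) * of_real (exp (- ((e * x)\<^sup>2 / 2))))" (is "integrable _ ?f")
    and integral_gaussian_real_scaled:
      "(\<integral>x. cis (- (u * (x::real))) * of_real (exp (- ((e * x)\<^sup>2 / 2))) \<partial>lborel)
       = of_real (sqrt (2 * pi) / e * exp (- ((u / e)\<^sup>2 / 2)))"
proof -
  have eq: "cis (- (u / e * (0 + e * x))) * of_real (exp (- ((0 + e * x)\<^sup>2 / 2))) = ?f x" for x
    using e by simp
  show "integrable lborel ?f"
    using lborel_integrable_real_affine[OF integrable_gaussian_real[of "u / e"], of e 0] e
    unfolding eq by simp
  show "(\<integral>x. ?f x \<partial>lborel) = of_real (sqrt (2 * pi) / e * exp (- ((u / e)\<^sup>2 / 2)))"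
    using lborel_integral_real_affine[of e "\<lambda>x. cis (- (u / e * x)) * of_real (exp (- (x\<^sup>2 / 2)))" 0] e
    unfolding eq integral_gaussian_real by (simp add: scaleR_conv_of_real field_simps)
qed

lemma cis_sum: "cis (\<Sum>i\<in>I. f i) = (\<Prod>i\<in>I. cis (f i))"
  by (induction I rule: infinite_finite_induct) (auto simp: cis_mult[symmetric])

lemma norm_gaussian_prod:
  fixes x :: "'a::euclidean_space"
  shows "exp (- ((e * norm x)\<^sup>2 / 2)) = (\<Prod>b\<in>Basis. exp (- ((e * (x \<bullet> b))\<^sup>2 / 2)))"
proof -
  have "(norm x)\<^sup>2 = (\<Sum>b\<in>Basis. (x \<bullet> b)\<^sup>2)"
    unfolding norm_eq_sqrt_inner euclidean_inner[of x x] by (simp add: sum_nonneg power2_eq_square)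
  then have "- ((e * norm x)\<^sup>2 / 2) = (\<Sum>b\<in>Basis. - ((e * (x \<bullet> b))\<^sup>2 / 2))"
    by (simp add: power_mult_distrib sum_distrib_left sum_negf sum_divide_distrib)
  then show ?thesis by (simp add: exp_sum)
qed

lemma
  fixes u :: "'a::euclidean_space"
  assumes e: "e > 0"
  shows integrable_gaussian: "integrable lborel (\<lambda>x. cis (- (u \<bullet> x)) * of_real (exp (- ((e * norm x)\<^sup>2 / 2))))"
    and integral_gaussian:
      "(\<integral>x. cis (- (u \<bullet> x)) * of_real (exp (- ((e * norm x)\<^sup>2 / 2))) \<partial>lborel)
       = of_real ((sqrt (2 * pi) / e) ^ DIM('a) * exp (- ((norm u / e)\<^sup>2 / 2)))"
proof -
  have eq: "cis (- (u \<bullet> x)) * of_real (exp (- ((e * norm x)\<^sup>2 / 2))) =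
     (\<Prod>b\<in>Basis. cis (- ((u \<bullet> b) * (x \<bullet> b))) * of_real (exp (- ((e * (x \<bullet> b))\<^sup>2 / 2))))" for x
    unfolding norm_gaussian_prod euclidean_inner[of u x]
    by (simp add: prod.distrib sum_negf[symmetric] cis_sum)
  show "integrable lborel (\<lambda>x. cis (- (u \<bullet> x)) * of_real (exp (- ((e * norm x)\<^sup>2 / 2))))"
    unfolding eq by (intro integrable_lborel_prod integrable_gaussian_real_scaled e)
  have *: "exp (- ((norm u / e)\<^sup>2 / 2)) = (\<Prod>b\<in>Basis. exp (- (((u \<bullet> b) / e)\<^sup>2 / 2)))"
    using norm_gaussian_prod[of "1/e" u] by simp
  show "(\<integral>x. cis (- (u \<bullet> x)) * of_real (exp (- ((e * norm x)\<^sup>2 / 2))) \<partial>lborel)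
       = of_real ((sqrt (2 * pi) / e) ^ DIM('a) * exp (- ((norm u / e)\<^sup>2 / 2)))"
    unfolding eq *
    by (subst integral_lborel_prod[OF integrable_gaussian_real_scaled[OF e]])
       (simp only: integral_gaussian_real_scaled[OF e] of_real_mult of_real_prod of_real_power
          prod.distrib prod_constant)
qed

lemma measurable_cis [measurable]: "f \<in> borel_measurable M \<Longrightarrow> (\<lambda>x. cis (f x)) \<in> borel_measurable M"
  by (rule borel_measurable_continuous_on[where f=cis]) (auto intro!: continuous_intros)

section \<open>Fourier integrals of integrable functions\<close>

lemma fourier_integral_lborel:
  assumes [measurable]: "f \<in> borel_measurable borel"
  shows "fourier_integral f \<xi> =
    of_real ((2 * pi) powr (- real DIM('a) / 2)) * (\<integral>t. cis (- (\<xi> \<bullet> (t::'a::euclidean_space))) * f t \<partial>lborel)"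
proof -
  have "(\<lambda>t. cis (- (\<xi> \<bullet> t)) * f t) \<in> borel_measurable lborel"
    by measurable
  then show ?thesis unfolding fourier_integral_def by (subst integral_completion) auto
qed

lemma borel_measurable_fourier_integral [measurable]:
  fixes f :: "'a::euclidean_space \<Rightarrow> complex"
  assumes [measurable]: "f \<in> borel_measurable borel"
  shows "fourier_integral f \<in> borel_measurable borel"
proof -
  have "fourier_integral f = (\<lambda>\<xi>. of_real ((2 * pi) powr (- real DIM('a) / 2)) * (\<integral>t. cis (- (\<xi> \<bullet> t)) * f t \<partial>lborel))"
    by (auto simp: fourier_integral_lborel)
  also have "\<dots> \<in> borel_measurable borel" by measurable
  finally show ?thesis .
qed

lemma norm_fourier_integral_le:
  fixes f :: "'a::euclidean_space \<Rightarrow> complex"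
  assumes "integrable lborel f"
  shows "cmod (fourier_integral f \<xi>) \<le> (2 * pi) powr (- real DIM('a) / 2) * (\<integral>t. cmod (f t) \<partial>lborel)"
proof -
  have [measurable]: "f \<in> borel_measurable borel" using assms by auto
  have "cmod (\<integral>t. cis (- (\<xi> \<bullet> t)) * f t \<partial>lborel) \<le> (\<integral>t. cmod (cis (- (\<xi> \<bullet> t)) * f t) \<partial>lborel)"
    by (rule integral_norm_bound)
  then show ?thesis
    by (simp add: fourier_integral_lborel norm_mult)
qed

text \<open>The modulation by \<open>cis (s \<bullet> x)\<close> moves the centre of the transform
  to \<open>s\<close>, and the normalising power of \<open>2 * pi\<close> cancels the Gaussian
  integral. As \<open>e\<close> tends to 0 the transforms concentrate at \<open>s\<close> with
  constant total mass.\<close>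

lemma fourier_integral_gaussian:
  fixes s :: "'a::euclidean_space"
  assumes e: "e > 0"
  shows "fourier_integral (\<lambda>x. cis (s \<bullet> x) * of_real (exp (- ((e * norm x)\<^sup>2 / 2)))) u =
     of_real (exp (- ((norm (u - s) / e)\<^sup>2 / 2)) / e ^ DIM('a))"
proof -
  have "cis (- (u \<bullet> t)) * (cis (s \<bullet> t) * of_real (exp (- ((e * norm t)\<^sup>2 / 2)))) =
     cis (- ((u - s) \<bullet> t)) * of_real (exp (- ((e * norm t)\<^sup>2 / 2)))" for t
    by (simp add: mult.assoc[symmetric] cis_mult inner_diff_left)
  moreover have *: "(2 * pi) powr (- real DIM('a) / 2) * sqrt (2 * pi) ^ DIM('a) = 1"
    by (simp add: powr_half_sqrt[symmetric] powr_realpow[symmetric] powr_powr powr_add[symmetric])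
  ultimately have "fourier_integral (\<lambda>x. cis (s \<bullet> x) * of_real (exp (- ((e * norm x)\<^sup>2 / 2)))) u =
      of_real ((2 * pi) powr (- real DIM('a) / 2) *
        ((sqrt (2 * pi) / e) ^ DIM('a) * exp (- ((norm (u - s) / e)\<^sup>2 / 2))))"
    by (subst fourier_integral_lborel) (measurable, simp only: integral_gaussian[OF e] of_real_mult)
  also have "(2 * pi) powr (- real DIM('a) / 2) * ((sqrt (2 * pi) / e) ^ DIM('a) * x) = x / e ^ DIM('a)" for x
  proof -
    have "(2 * pi) powr (- real DIM('a) / 2) * ((sqrt (2 * pi) / e) ^ DIM('a) * x) =
        ((2 * pi) powr (- real DIM('a) / 2) * sqrt (2 * pi) ^ DIM('a)) * x / e ^ DIM('a)"
      by (simp only: power_divide times_divide_eq_left times_divide_eq_right mult.assoc)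
    then show ?thesis by (simp only: * mult_1_left)
  qed
  finally show ?thesis .
qed

text \<open>Fubini's theorem for the kernel \<open>cis (- (x \<bullet> y))\<close>, which is
  symmetric in the two variables. Both the Plancherel identity and the adjoint relation rest on
  it.\<close>

lemma fourier_integral_multiplication:
  fixes f g :: "'a::euclidean_space \<Rightarrow> complex"
  assumes f: "integrable lborel f" and g: "integrable lborel g"
  shows "(\<integral>x. fourier_integral f x * g x \<partial>lborel) = (\<integral>x. f x * fourier_integral g x \<partial>lborel)"
proof -
  have [measurable]: "f \<in> borel_measurable borel" "g \<in> borel_measurable borel"
    using f g by auto
  have int: "integrable (lborel \<Otimes>\<^sub>M lborel) (\<lambda>(x, y). cis (- (x \<bullet> y)) * f x * g y)"
  proof (rule lborel_pair.Fubini_integrable)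
    show "integrable lborel (\<lambda>x. \<integral> y. norm (case (x, y) of (x, y) \<Rightarrow> cis (- (x \<bullet> y)) * f x * g y) \<partial>lborel)"
      using f by (simp add: norm_mult)
    show "AE x in lborel. integrable lborel (\<lambda>y. case (x, y) of (x, y) \<Rightarrow> cis (- (x \<bullet> y)) * f x * g y)"
      by (intro AE_I2) (auto intro!: Bochner_Integration.integrable_bound[OF integrable_mult_right[OF g]]
          simp: norm_mult)
  qed measurable
  define c :: complex where "c = of_real ((2 * pi) powr (- real DIM('a) / 2))"
  have 1: "fourier_integral f y * g y = c * (\<integral>x. cis (- (x \<bullet> y)) * f x * g y \<partial>lborel)" for y
  proof -
    have "(\<integral>x. cis (- (x \<bullet> y)) * f x * g y \<partial>lborel) = (\<integral>x. cis (- (x \<bullet> y)) * f x \<partial>lborel) * g y"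
      by (rule integral_mult_left_zero)
    then show ?thesis
      by (simp only: fourier_integral_lborel[OF \<open>f \<in> borel_measurable borel\<close>] c_def inner_commute mult.assoc)
  qed
  have 2: "f x * fourier_integral g x = c * (\<integral>y. cis (- (x \<bullet> y)) * f x * g y \<partial>lborel)" for x
  proof -
    have "(\<integral>y. cis (- (x \<bullet> y)) * f x * g y \<partial>lborel) = (\<integral>y. f x * (cis (- (x \<bullet> y)) * g y) \<partial>lborel)"
      by (simp only: mult_ac)
    then show ?thesis
      by (simp add: fourier_integral_lborel c_def)
  qed
  have "(\<integral>y. (\<integral>x. cis (- (x \<bullet> y)) * f x * g y \<partial>lborel) \<partial>lborel) =
      (\<integral>x. (\<integral>y. cis (- (x \<bullet> y)) * f x * g y \<partial>lborel) \<partial>lborel)"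
    by (rule lborel_pair.Fubini_integral) (use int in auto)
  then show ?thesis unfolding 1 2 by simp
qed

section \<open>Square-integrable functions\<close>

lemma square_integrable_imp_L2_eq: "square_integrable f \<Longrightarrow> L2_eq f f"
  by (simp add: L2_eq_def)

lemma square_integrable_rep_L2 [simp]: "square_integrable (rep_L2 x)"
  using Quotient_rep_reflp[OF Quotient_L2, of x] by (simp add: L2_eq_def)

lemma abs_rep_L2 [simp]: "abs_L2 (rep_L2 x) = x"
  by (rule Quotient_abs_rep[OF Quotient_L2])

lemma abs_L2_eqI:
  "square_integrable f \<Longrightarrow> square_integrable g \<Longrightarrow> AE t in lebesgue. f t = g t \<Longrightarrow> abs_L2 f = abs_L2 g"
  by (rule Quotient_rel_abs[OF Quotient_L2]) (simp add: L2_eq_def)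

lemma rep_abs_L2:
  assumes "square_integrable f"
  shows "AE t in lebesgue. rep_L2 (abs_L2 f) t = f t"
  using Quotient_rep_abs[OF Quotient_L2, OF square_integrable_imp_L2_eq[OF assms]] by (simp add: L2_eq_def)

lemma norm_abs_L2:
  "square_integrable f \<Longrightarrow> norm (abs_L2 f) = sqrt (\<integral>t. (cmod (f t))\<^sup>2 \<partial>lebesgue)"
  by (rule norm_L2.abs_eq) (rule square_integrable_imp_L2_eq)

lemma diff_abs_L2:
  "square_integrable f \<Longrightarrow> square_integrable g \<Longrightarrow> abs_L2 f - abs_L2 g = abs_L2 (\<lambda>t. f t - g t)"
  by (rule minus_L2.abs_eq) (auto intro: square_integrable_imp_L2_eq)

lemma inner_abs_L2:
  "square_integrable f \<Longrightarrow> square_integrable g \<Longrightarrow>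
    abs_L2 f \<bullet> abs_L2 g = (\<integral>t. f t \<bullet> g t \<partial>lebesgue)"
  by (rule inner_L2.abs_eq) (auto intro: square_integrable_imp_L2_eq)

lemma borel_square_integrable_iff:
  assumes "f \<in> borel_measurable borel"
  shows "square_integrable f \<longleftrightarrow> integrable lborel (\<lambda>t. (cmod (f t))\<^sup>2)"
proof -
  have "(\<lambda>t. (cmod (f t))\<^sup>2) \<in> borel_measurable lborel" using assms by measurable
  from integrable_completion[OF this] show ?thesis
    using assms by (auto simp: square_integrable_def intro: measurable_completion)
qed

lemma norm_abs_L2_borel:
  assumes "f \<in> borel_measurable borel" "square_integrable f"
  shows "norm (abs_L2 f) = sqrt (\<integral>t. (cmod (f t))\<^sup>2 \<partial>lborel)"
proof -
  have "(\<lambda>t. (cmod (f t))\<^sup>2) \<in> borel_measurable lborel" using assms by measurable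
  from integral_completion[OF this] show ?thesis
    using assms by (simp add: norm_abs_L2)
qed

text \<open>Fubini's theorem is applied over \<open>lborel\<close>, whereas \<open>L2\<close> is
  built on \<open>lebesgue\<close>. Passing to a Borel version connects the two.\<close>

lemma obtain_borel_version:
  fixes f :: "'a::euclidean_space \<Rightarrow> complex"
  assumes [measurable]: "f \<in> borel_measurable lebesgue"
  obtains g where "g \<in> borel_measurable borel" "AE t in lebesgue. f t = g t"
proof -
  have "(\<lambda>t. Re (f t)) \<in> borel_measurable lebesgue" "(\<lambda>t. Im (f t)) \<in> borel_measurable lebesgue"
    by measurable
  from this[THEN completion_ex_borel_measurable_real] obtain r i
    where [measurable]: "r \<in> borel_measurable borel" "i \<in> borel_measurable borel"
      and *: "AE t in lborel. Re (f t) = r t" "AE t in lborel. Im (f t) = i t"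
    by auto
  show ?thesis
  proof
    show "(\<lambda>t. Complex (r t) (i t)) \<in> borel_measurable borel"
      unfolding borel_measurable_complex_iff by simp
    have "AE t in lborel. f t = Complex (r t) (i t)"
      using * by eventually_elim (simp add: complex_eq_iff)
    then show "AE t in lebesgue. f t = Complex (r t) (i t)"
      by (rule AE_completion)
  qed
qed

lemma square_integrable_cong_AE:
  assumes "square_integrable f" "g \<in> borel_measurable lebesgue" "AE t in lebesgue. f t = g t"
  shows "square_integrable g"
proof -
  have "f \<in> borel_measurable lebesgue" using assms(1) by (simp add: square_integrable_def)
  moreover have "AE t in lebesgue. (cmod (f t))\<^sup>2 = (cmod (g t))\<^sup>2"
    using assms(3) by eventually_elim simp
  ultimately have "integrable lebesgue (\<lambda>t. (cmod (f t))\<^sup>2) \<longleftrightarrow> integrable lebesgue (\<lambda>t. (cmod (g t))\<^sup>2)"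
    using assms(2) by (intro integrable_cong_AE) auto
  with assms show ?thesis by (simp add: square_integrable_def)
qed

lemma borel_representative:
  obtains f where "f \<in> borel_measurable borel" "square_integrable f" "abs_L2 f = x"
proof -
  have "rep_L2 x \<in> borel_measurable lebesgue"
    using square_integrable_rep_L2[of x] by (simp add: square_integrable_def)
  then obtain f where f: "f \<in> borel_measurable borel" "AE t in lebesgue. rep_L2 x t = f t"
    by (rule obtain_borel_version)
  then have "f \<in> borel_measurable lebesgue" by (auto intro: measurable_completion)
  with f have "square_integrable f"
    by (intro square_integrable_cong_AE[OF square_integrable_rep_L2]) auto
  moreover have "abs_L2 f = x"
    using f(2) abs_L2_eqI[OF square_integrable_rep_L2 \<open>square_integrable f\<close>] by simp
  ultimately show ?thesis using f that by blast
qed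

section \<open>Plancherel's identity for continuous functions of bounded support\<close>

lemma measurable_cnj [measurable]: "f \<in> borel_measurable M \<Longrightarrow> (\<lambda>x. cnj (f x)) \<in> borel_measurable M"
  by (rule borel_measurable_continuous_on[where f=cnj]) (auto intro!: continuous_intros)

text \<open>The transform of an integrable function is so far only known to be bounded, so its
  square is damped by a Gaussian. Writing the square as the transform times its conjugate, the
  multiplication formula turns the damped integral into a pairing of \<open>f\<close> with a
  Gaussian mollification of \<open>f\<close> at scale \<open>e\<close>.\<close>

lemma integral_norm_fourier_integral_gaussian:
  fixes f :: "'a::euclidean_space \<Rightarrow> complex"
  assumes f: "integrable lborel f" and e: "e > 0"
  shows "integrable lborel (\<lambda>\<xi>. exp (- ((e * norm \<xi>)\<^sup>2 / 2)) * (cmod (fourier_integral f \<xi>))\<^sup>2)"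
    and "of_real (\<integral>\<xi>. exp (- ((e * norm \<xi>)\<^sup>2 / 2)) * (cmod (fourier_integral f \<xi>))\<^sup>2 \<partial>lborel) =
      of_real ((2 * pi) powr (- real DIM('a) / 2)) *
       (\<integral>s. f s * cnj (\<integral>v. of_real (exp (- ((norm v)\<^sup>2 / 2))) * f (s + e *\<^sub>R v) \<partial>lborel) \<partial>lborel)"
proof -
  define c where "c = (2 * pi) powr (- real DIM('a) / 2)"
  define w :: "'a \<Rightarrow> real" where "w \<xi> = exp (- ((e * norm \<xi>)\<^sup>2 / 2))" for \<xi>
  define B where "B = c * (\<integral>t. cmod (f t) \<partial>lborel)"
  have [measurable]: "f \<in> borel_measurable borel" "w \<in> borel_measurable borel"
    using f by (auto simp: w_def[abs_def])
  have bound: "cmod (fourier_integral f \<xi>) \<le> B" for \<xi>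
    using norm_fourier_integral_le[OF f, of \<xi>] by (simp add: B_def c_def)
  have "0 \<le> B" using bound[of 0] norm_ge_zero order_trans by blast
  have int_w: "integrable lborel (\<lambda>\<xi>. of_real (w \<xi>) :: complex)"
    using integrable_gaussian[OF e, of 0] by (simp add: w_def)
  then have int_w': "integrable lborel w"
    by (subst (asm) complex_of_real_integrable_eq)
  have int_c: "integrable lborel (\<lambda>\<xi>. cis (u \<bullet> \<xi>) * of_real (w \<xi>))" for u
    using integrable_gaussian[OF e, of "-u"] by (simp add: w_def)
  have int_G: "integrable lborel (\<lambda>\<xi>. of_real (w \<xi>) * cnj (fourier_integral f \<xi>))"
  proof (rule Bochner_Integration.integrable_bound[OF integrable_mult_right[OF int_w', of B]])
    show "AE \<xi> in lborel. cmod (of_real (w \<xi>) * cnj (fourier_integral f \<xi>)) \<le> norm (B * w \<xi>)"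
      using bound \<open>0 \<le> B\<close> by (intro AE_I2) (auto simp: norm_mult abs_mult mult.commute[of B] intro!: mult_left_mono)
  qed measurable
  have eq: "of_real (w \<xi> * (cmod (fourier_integral f \<xi>))\<^sup>2) =
      fourier_integral f \<xi> * (of_real (w \<xi>) * cnj (fourier_integral f \<xi>))" for \<xi>
    by (simp only: of_real_mult complex_norm_square mult_ac)
  show "integrable lborel (\<lambda>\<xi>. exp (- ((e * norm \<xi>)\<^sup>2 / 2)) * (cmod (fourier_integral f \<xi>))\<^sup>2)"
    unfolding w_def[symmetric]
  proof (rule Bochner_Integration.integrable_bound[OF integrable_mult_right[OF int_w', of "B\<^sup>2"]])
    show "AE \<xi> in lborel. norm (w \<xi> * (cmod (fourier_integral f \<xi>))\<^sup>2) \<le> norm (B\<^sup>2 * w \<xi>)"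
      using bound \<open>0 \<le> B\<close>
      by (auto simp: abs_mult mult.commute w_def intro!: mult_right_mono power_mono)
  qed measurable
  \<comment> \<open>After conjugation the kernel is \<open>cis (s \<bullet> \<xi>)\<close>. The
    multiplication formula moves the transform onto the modulated Gaussian, and the substitution
    \<open>t = s + e *\<^sub>R v\<close> absorbs the factor \<open>e ^ DIM('a)\<close>.\<close>
  have G: "fourier_integral (\<lambda>\<xi>. of_real (w \<xi>) * cnj (fourier_integral f \<xi>)) s =
      cnj (of_real c * (\<integral>v. of_real (exp (- ((norm v)\<^sup>2 / 2))) * f (s + e *\<^sub>R v) \<partial>lborel))" for s
  proof -
    have "fourier_integral (\<lambda>\<xi>. of_real (w \<xi>) * cnj (fourier_integral f \<xi>)) s =
        of_real c * (\<integral>\<xi>. cnj (fourier_integral f \<xi> * (cis (s \<bullet> \<xi>) * of_real (w \<xi>))) \<partial>lborel)"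
    proof -
      have "cnj (fourier_integral f \<xi> * (cis (s \<bullet> \<xi>) * of_real (w \<xi>))) =
          cis (- (s \<bullet> \<xi>)) * (of_real (w \<xi>) * cnj (fourier_integral f \<xi>))" for \<xi>
        by (simp add: cis_cnj)
      then show ?thesis
        by (subst fourier_integral_lborel) (measurable, simp only: c_def)
    qed
    also have "\<dots> = cnj (of_real c * (\<integral>\<xi>. fourier_integral f \<xi> * (cis (s \<bullet> \<xi>) * of_real (w \<xi>)) \<partial>lborel))"
      using Bochner_Integration.integral_cnj[of lborel "\<lambda>\<xi>. fourier_integral f \<xi> * (cis (s \<bullet> \<xi>) * of_real (w \<xi>))"]
      by (simp only: complex_cnj_mult[of "of_real c"] complex_cnj_complex_of_real)
    also have "(\<integral>\<xi>. fourier_integral f \<xi> * (cis (s \<bullet> \<xi>) * of_real (w \<xi>)) \<partial>lborel) =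
        (\<integral>t. f t * of_real (exp (- ((norm (t - s) / e)\<^sup>2 / 2)) / e ^ DIM('a)) \<partial>lborel)"
      by (subst fourier_integral_multiplication[OF f int_c])
         (simp only: w_def fourier_integral_gaussian[OF e])
    also have "\<dots> = (\<integral>v. of_real (exp (- ((norm v)\<^sup>2 / 2))) * f (s + e *\<^sub>R v) \<partial>lborel)"
      using e by (subst integral_lborel_affine[where c=e and t=s]) (auto simp: mult.commute)
    finally show ?thesis .
  qed
  have "of_real (\<integral>\<xi>. w \<xi> * (cmod (fourier_integral f \<xi>))\<^sup>2 \<partial>lborel) =
      (\<integral>\<xi>. fourier_integral f \<xi> * (of_real (w \<xi>) * cnj (fourier_integral f \<xi>)) \<partial>lborel)"
    unfolding eq[symmetric] by (rule integral_complex_of_real[symmetric])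
  also have "\<dots> = (\<integral>s. of_real c * (f s * cnj (\<integral>v. of_real (exp (- ((norm v)\<^sup>2 / 2))) * f (s + e *\<^sub>R v) \<partial>lborel)) \<partial>lborel)"
    unfolding fourier_integral_multiplication[OF f int_G] G
    by (simp only: complex_cnj_mult complex_cnj_complex_of_real mult_ac)
  finally show "of_real (\<integral>\<xi>. exp (- ((e * norm \<xi>)\<^sup>2 / 2)) * (cmod (fourier_integral f \<xi>))\<^sup>2 \<partial>lborel) =
      of_real ((2 * pi) powr (- real DIM('a) / 2)) *
       (\<integral>s. f s * cnj (\<integral>v. of_real (exp (- ((norm v)\<^sup>2 / 2))) * f (s + e *\<^sub>R v) \<partial>lborel) \<partial>lborel)"
    by (simp add: c_def w_def)
qed

lemma continuous_compact_support_bounded: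
  fixes f :: "'a::euclidean_space \<Rightarrow> complex"
  assumes "continuous_on UNIV f" and "\<And>x. x \<notin> cball 0 R \<Longrightarrow> f x = 0"
  obtains B where "0 \<le> B" "\<And>x. cmod (f x) \<le> B"
proof -
  have "compact (f ` cball 0 R)"
    using assms(1) by (intro compact_continuous_image) (auto intro: continuous_on_subset)
  then obtain B where "\<And>x. x \<in> cball 0 R \<Longrightarrow> cmod (f x) \<le> B"
    unfolding bounded_iff[THEN iffD1, OF compact_imp_bounded, simplified] 
    by (metis bounded_iff compact_imp_bounded imageI)
  then have "cmod (f x) \<le> max B 0" for x
    using assms(2)[of x] by (cases "x \<in> cball 0 R") fastforce+
  then show ?thesis by (intro that[of "max B 0"]) auto
qed

lemma integrable_bounded_support:
  fixes f :: "'a::euclidean_space \<Rightarrow> 'b::{banach, second_countable_topology}"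
  assumes "f \<in> borel_measurable borel" "\<And>x. norm (f x) \<le> B" "\<And>x. x \<notin> cball 0 R \<Longrightarrow> f x = 0"
  shows "integrable lborel f"
proof (rule Bochner_Integration.integrable_bound)
  show "integrable lborel (\<lambda>x. B * indicat_real (cball 0 R :: 'a set) x)"
    by (intro integrable_mult_right integrable_real_indicator) (use emeasure_lborel_cball_finite[of "0::'a" R] in auto)
  show "AE x in lborel. norm (f x) \<le> norm (B * indicat_real (cball 0 R) x)"
    using assms(2,3) by (auto simp: indicator_def intro: order_trans[OF _ abs_ge_self])
qed (use assms in auto)

text \<open>The damping is removed by letting its scale tend to 0. Continuity of \<open>f\<close>
  makes the mollifications converge at every point, and the bounded support provides the dominating
  functions.\<close>

lemma fourier_integral_plancherel_continuous:
  fixes f :: "'a::euclidean_space \<Rightarrow> complex"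
  assumes cont: "continuous_on UNIV f" and supp: "\<And>x. x \<notin> cball 0 R \<Longrightarrow> f x = 0"
  shows "integrable lborel (\<lambda>\<xi>. (cmod (fourier_integral f \<xi>))\<^sup>2)"
    and "(\<integral>\<xi>. (cmod (fourier_integral f \<xi>))\<^sup>2 \<partial>lborel) = (\<integral>t. (cmod (f t))\<^sup>2 \<partial>lborel)"
proof -
  have [measurable]: "f \<in> borel_measurable borel"
    using cont by (rule borel_measurable_continuous_onI)
  obtain B where B: "0 \<le> B" "\<And>x. cmod (f x) \<le> B"
    using continuous_compact_support_bounded[OF cont supp] by blast
  have f: "integrable lborel f"
    by (rule integrable_bounded_support[OF _ B(2) supp]) auto
  define c where "c = (2 * pi) powr (- real DIM('a) / 2)"
  define e :: "nat \<Rightarrow> real" where "e n = 1 / Suc n" for n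
  have e: "e n > 0" for n by (simp add: e_def)
  have e_lim: "e \<longlonglongrightarrow> 0" unfolding e_def[abs_def] by (rule LIMSEQ_Suc) (rule lim_1_over_n)
  define g :: "'a \<Rightarrow> complex" where "g v = of_real (exp (- ((norm v)\<^sup>2 / 2)))" for v
  have g: "integrable lborel g"
    using integrable_gaussian[of 1 "0::'a"] by (simp add: g_def[abs_def])
  have [measurable]: "g \<in> borel_measurable borel" by (simp add: g_def[abs_def])
  have int_g: "integral\<^sup>L lborel g = of_real (sqrt (2 * pi) ^ DIM('a))"
    using integral_gaussian[of 1 "0::'a"] by (simp add: g_def[abs_def])
  \<comment> \<open>The constant in \<open>fourier_integral\<close> is what cancels the total mass
    of \<open>g\<close>; this is where the isometry gets its factor 1.\<close>
  have c1: "c * sqrt (2 * pi) ^ DIM('a) = 1"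
    by (simp add: c_def powr_half_sqrt[symmetric] powr_realpow[symmetric] powr_powr powr_add[symmetric])
  define A where "A n s = (\<integral>v. g v * f (s + e n *\<^sub>R v) \<partial>lborel)" for n s
  have [measurable]: "A n \<in> borel_measurable borel" for n
    unfolding A_def[abs_def] by measurable
  have A_le: "cmod (A n s) \<le> (\<integral>v. cmod (g v) * B \<partial>lborel)" for n s
    unfolding A_def
  proof (rule Bochner_Integration.integral_norm_bound_integral)
    show "integrable lborel (\<lambda>v. g v * f (s + e n *\<^sub>R v))"
      by (rule Bochner_Integration.integrable_bound[OF integrable_mult_left[OF g, of "of_real B"]])
         (use B in \<open>auto simp: norm_mult intro!: mult_left_mono\<close>)
    show "cmod (g v * f (s + e n *\<^sub>R v)) \<le> cmod (g v) * B" for v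
      using B by (auto simp: norm_mult intro!: mult_left_mono)
  qed (use g in auto)
  have A_lim: "(\<lambda>n. A n s) \<longlonglongrightarrow> of_real (sqrt (2 * pi) ^ DIM('a)) * f s" for s
  proof -
    have "(\<lambda>n. A n s) \<longlonglongrightarrow> (\<integral>v. g v * f s \<partial>lborel)"
      unfolding A_def
    proof (rule integral_dominated_convergence)
      show "integrable lborel (\<lambda>v. cmod (g v) * B)"
        using g by auto
      show "AE v in lborel. (\<lambda>n. g v * f (s + e n *\<^sub>R v)) \<longlonglongrightarrow> g v * f s"
      proof (intro AE_I2 tendsto_intros)
        fix v
        have "(\<lambda>n. s + e n *\<^sub>R v) \<longlonglongrightarrow> s + 0 *\<^sub>R v" by (intro tendsto_intros e_lim)
        then show "(\<lambda>n. f (s + e n *\<^sub>R v)) \<longlonglongrightarrow> f s"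
          using cont by (auto simp: continuous_on_eq_continuous_at intro: isCont_tendsto_compose)
      qed
    qed (auto simp: norm_mult B intro!: mult_left_mono)
    then show ?thesis by (simp add: int_g)
  qed
  define I where "I n = (\<integral>\<xi>. exp (- ((e n * norm \<xi>)\<^sup>2 / 2)) * (cmod (fourier_integral f \<xi>))\<^sup>2 \<partial>lborel)" for n
  have "(\<lambda>n. of_real c * (\<integral>s. f s * cnj (A n s) \<partial>lborel)) \<longlonglongrightarrow>
      of_real c * (\<integral>s. f s * cnj (of_real (sqrt (2 * pi) ^ DIM('a)) * f s) \<partial>lborel)"
  proof (intro tendsto_mult tendsto_const integral_dominated_convergence)
    show "integrable lborel (\<lambda>s. cmod (f s) * (\<integral>v. cmod (g v) * B \<partial>lborel))"
      using f by auto
    show "AE s in lborel. (\<lambda>n. f s * cnj (A n s)) \<longlonglongrightarrow> f s * cnj (of_real (sqrt (2 * pi) ^ DIM('a)) * f s)"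
      by (intro AE_I2 tendsto_intros A_lim)
    show "AE s in lborel. cmod (f s * cnj (A n s)) \<le> cmod (f s) * (\<integral>v. cmod (g v) * B \<partial>lborel)" for n
      using A_le by (auto simp: norm_mult intro!: mult_left_mono)
  qed measurable
  also have "(\<lambda>n. of_real c * (\<integral>s. f s * cnj (A n s) \<partial>lborel)) = (\<lambda>n. of_real (I n))"
    using integral_norm_fourier_integral_gaussian(2)[OF f e] by (simp add: I_def A_def g_def c_def)
  also have "of_real c * (\<integral>s. f s * cnj (of_real (sqrt (2 * pi) ^ DIM('a)) * f s) \<partial>lborel) =
      of_real (\<integral>s. (cmod (f s))\<^sup>2 \<partial>lborel)"
  proof -
    have "f s * cnj (of_real (sqrt (2 * pi) ^ DIM('a)) * f s) =
        of_real (sqrt (2 * pi) ^ DIM('a) * (cmod (f s))\<^sup>2)" for s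
      by (simp only: of_real_mult complex_norm_square complex_cnj_mult complex_cnj_complex_of_real mult_ac)
    then have "(\<integral>s. f s * cnj (of_real (sqrt (2 * pi) ^ DIM('a)) * f s) \<partial>lborel) =
        of_real (sqrt (2 * pi) ^ DIM('a) * (\<integral>s. (cmod (f s))\<^sup>2 \<partial>lborel))"
      by (simp only: integral_complex_of_real integral_mult_right_zero)
    then show ?thesis
      using c1 by (metis (no_types, lifting) mult.assoc mult_1 of_real_mult)
  qed
  finally have I_lim: "I \<longlonglongrightarrow> (\<integral>s. (cmod (f s))\<^sup>2 \<partial>lborel)"
    by (simp only: tendsto_of_real_iff)
  have mono: "mono (\<lambda>n. exp (- ((e n * norm \<xi>)\<^sup>2 / 2)) * (cmod (fourier_integral f \<xi>))\<^sup>2)" for \<xi>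
    unfolding mono_def using e
    by (auto simp: e_def intro!: mult_right_mono power_mono divide_left_mono)
  have lim: "(\<lambda>n. exp (- ((e n * norm \<xi>)\<^sup>2 / 2)) * (cmod (fourier_integral f \<xi>))\<^sup>2) \<longlonglongrightarrow>
      (cmod (fourier_integral f \<xi>))\<^sup>2" for \<xi>
  proof -
    have "(\<lambda>n. exp (- ((e n * norm \<xi>)\<^sup>2 / 2)) * (cmod (fourier_integral f \<xi>))\<^sup>2) \<longlonglongrightarrow>
        exp (- ((0 * norm \<xi>)\<^sup>2 / 2)) * (cmod (fourier_integral f \<xi>))\<^sup>2"
      by (intro tendsto_intros e_lim) auto
    then show ?thesis by simp
  qed
  \<comment> \<open>Monotone rather than dominated convergence: integrability of the undamped square
    is part of the conclusion and cannot be presupposed.\<close>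
  note * = integral_monotone_convergence_nonneg[OF
      integral_norm_fourier_integral_gaussian(1)[OF f e] AE_I2[OF mono] _ AE_I2[OF lim] I_lim[unfolded I_def]]
  show "integrable lborel (\<lambda>\<xi>. (cmod (fourier_integral f \<xi>))\<^sup>2)"
    by (rule *(1)) auto
  show "(\<integral>\<xi>. (cmod (fourier_integral f \<xi>))\<^sup>2 \<partial>lborel) = (\<integral>t. (cmod (f t))\<^sup>2 \<partial>lborel)"
    by (rule *(2)) auto
qed

section \<open>Plancherel's theorem for integrable functions\<close>

lemma norm_diff_power2_le: "(norm (a - c))\<^sup>2 \<le> 2 * (norm (a - b))\<^sup>2 + 2 * (norm (b - c))\<^sup>2"
  for a b c :: "'a::real_normed_vector"
proof -
  have "(norm (a - c))\<^sup>2 \<le> (norm (a - b) + norm (b - c))\<^sup>2"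
    using norm_triangle_ineq[of "a - b" "b - c"] by (intro power_mono) auto
  also have "\<dots> \<le> 2 * (norm (a - b))\<^sup>2 + 2 * (norm (b - c))\<^sup>2"
    using sum_squares_bound[of "norm (a - b)" "norm (b - c)"] by (simp add: power2_sum)
  finally show ?thesis .
qed

text \<open>The square and the modulus of the error are controlled by one integral because both are
  needed for the same approximant: closeness in mean gives pointwise convergence of the transforms,
  closeness in mean square gives convergence of the norms.\<close>

lemma continuous_approximation_bounded:
  fixes f :: "'a::euclidean_space \<Rightarrow> complex"
  assumes f [measurable]: "f \<in> borel_measurable borel" and B: "B > 0" "\<And>x. cmod (f x) \<le> B"
    and supp: "\<And>x. x \<notin> cball 0 R \<Longrightarrow> f x = 0" and "\<epsilon> > 0"
  shows "\<exists>g. continuous_on UNIV g \<and> (\<forall>x. x \<notin> cball 0 (R + 1) \<longrightarrow> g x = 0) \<and>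
    (\<integral>x. (cmod (f x - g x))\<^sup>2 + cmod (f x - g x) \<partial>lborel) < \<epsilon>"
proof -
  have "f \<in> borel_measurable lebesgue" by (auto intro: measurable_completion)
  then have "f measurable_on UNIV"
    by (intro lebesgue_measurable_imp_measurable_on) auto
  then obtain N g where N: "negligible N" and g: "\<And>n. continuous_on UNIV (g n)"
    and lim: "\<And>x. x \<notin> N \<Longrightarrow> (\<lambda>n. g n x) \<longlonglongrightarrow> f x"
    unfolding measurable_on_def by (auto simp: eventually_False)
  \<comment> \<open>\<open>clip\<close> is the radial retraction onto the disc of radius
    \<open>B\<close>. With the cut-off \<open>\<kappa>\<close>, equal to 1 on the ball of radius
    \<open>R\<close>, it makes the approximants uniformly bounded with common bounded support,
    without disturbing their limit \<open>f\<close>.\<close>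
  define clip :: "complex \<Rightarrow> complex" where "clip z = z / of_real (max 1 (cmod z / B))" for z
  define \<kappa> :: "'a \<Rightarrow> real" where "\<kappa> x = max 0 (min 1 (R + 1 - norm x))" for x
  define h where "h n x = of_real (\<kappa> x) * clip (g n x)" for n x
  have clip_cont: "continuous_on UNIV clip"
    unfolding clip_def[abs_def] by (intro continuous_intros) (use B in auto)
  have clip_le: "cmod (clip z) \<le> B" for z
    using B(1) by (auto simp: clip_def norm_divide divide_simps max_def)
  have clip_id: "clip z = z" if "cmod z \<le> B" for z
    using B(1) that by (auto simp: clip_def max_def divide_simps)
  have \<kappa>01: "0 \<le> \<kappa> x" "\<kappa> x \<le> 1" for x by (auto simp: \<kappa>_def)
  have cont_h: "continuous_on UNIV (h n)" for n
    unfolding h_def[abs_def] \<kappa>_def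
    by (intro continuous_intros continuous_on_compose2[OF clip_cont] g) auto
  then have [measurable]: "h n \<in> borel_measurable borel" for n
    by (rule borel_measurable_continuous_onI)
  have h_le: "cmod (h n x) \<le> B" for n x
    using mult_mono[OF \<kappa>01(2)[of x] clip_le[of "g n x"]] \<kappa>01(1)[of x] by (simp add: h_def norm_mult)
  have h_0: "h n x = 0" if "x \<notin> cball 0 (R + 1)" for n x
    using that by (simp add: h_def \<kappa>_def)
  have f_0: "f x = 0" if "x \<notin> cball 0 (R + 1)" for x
    using that by (intro supp) auto
  have "(\<lambda>n. \<integral>x. (cmod (f x - h n x))\<^sup>2 + cmod (f x - h n x) \<partial>lborel) \<longlonglongrightarrow> (\<integral>x. 0 \<partial>(lborel :: 'a measure))"
  proof (rule integral_dominated_convergence)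
    show "integrable lborel (\<lambda>x. ((2 * B)\<^sup>2 + 2 * B) * indicat_real (cball 0 (R + 1) :: 'a set) x)"
      by (intro integrable_mult_right integrable_real_indicator)
         (use emeasure_lborel_cball_finite[of "0::'a" "R + 1"] in auto)
    show "AE x in lborel. norm ((cmod (f x - h n x))\<^sup>2 + cmod (f x - h n x))
        \<le> ((2 * B)\<^sup>2 + 2 * B) * indicat_real (cball 0 (R + 1)) x" for n
    proof (rule AE_I2)
      fix x
      have "cmod (f x - h n x) \<le> 2 * B"
        using norm_triangle_ineq4[of "f x" "h n x"] B(2)[of x] h_le[of n x] by linarith
      moreover from this have "(cmod (f x - h n x))\<^sup>2 \<le> (2 * B)\<^sup>2"
        by (intro power_mono) auto
      ultimately show "norm ((cmod (f x - h n x))\<^sup>2 + cmod (f x - h n x))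
        \<le> ((2 * B)\<^sup>2 + 2 * B) * indicat_real (cball 0 (R + 1)) x"
        using f_0[of x] h_0[of x n] by (cases "x \<in> cball 0 (R + 1)") auto
    qed
    have "AE x in lebesgue. x \<notin> N"
      using N AE_not_in negligible_iff_null_sets by blast
    then have "AE x in lborel. x \<notin> N" by (simp add: AE_completion_iff)
    then show "AE x in lborel. (\<lambda>n. (cmod (f x - h n x))\<^sup>2 + cmod (f x - h n x)) \<longlonglongrightarrow> 0"
    proof eventually_elim
      fix x assume "x \<notin> N"
      then have "(\<lambda>n. h n x) \<longlonglongrightarrow> of_real (\<kappa> x) * clip (f x)"
        unfolding h_def using clip_cont
        by (intro tendsto_intros isCont_tendsto_compose[of _ clip] lim)
           (auto simp: continuous_on_eq_continuous_at)
      also have "of_real (\<kappa> x) * clip (f x) = f x"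
      proof (cases "x \<in> cball 0 R")
        case True
        then show ?thesis using B by (simp add: \<kappa>_def clip_id)
      next
        case False
        then show ?thesis using supp[of x] clip_id[of 0] B by simp
      qed
      finally have "(\<lambda>n. (cmod (f x - h n x))\<^sup>2 + cmod (f x - h n x)) \<longlonglongrightarrow> (cmod (f x - f x))\<^sup>2 + cmod (f x - f x)"
        by (intro tendsto_intros)
      then show "(\<lambda>n. (cmod (f x - h n x))\<^sup>2 + cmod (f x - h n x)) \<longlonglongrightarrow> 0" by simp
    qed
  qed measurable
  then have "\<forall>\<^sub>F n in sequentially. (\<integral>x. (cmod (f x - h n x))\<^sup>2 + cmod (f x - h n x) \<partial>lborel) < \<epsilon>"
    using \<open>\<epsilon> > 0\<close> by (intro order_tendstoD) auto
  then obtain n where "(\<integral>x. (cmod (f x - h n x))\<^sup>2 + cmod (f x - h n x) \<partial>lborel) < \<epsilon>"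
    by (auto simp: eventually_sequentially)
  then show ?thesis
    using cont_h[of n] h_0[of _ n] by (intro exI[of _ "h n"]) auto
qed

text \<open>Cutting \<open>f\<close> off both in size and in support reduces the claim to bounded
  functions of bounded support.\<close>

lemma continuous_approximation:
  fixes f :: "'a::euclidean_space \<Rightarrow> complex"
  assumes f: "integrable lborel f" "integrable lborel (\<lambda>x. (cmod (f x))\<^sup>2)" and "\<epsilon> > 0"
  obtains g R where "continuous_on UNIV g" "\<And>x. x \<notin> cball 0 R \<Longrightarrow> g x = 0"
    "(\<integral>x. (cmod (f x - g x))\<^sup>2 \<partial>lborel) < \<epsilon>" "(\<integral>x. cmod (f x - g x) \<partial>lborel) < \<epsilon>"
proof -
  have [measurable]: "f \<in> borel_measurable borel" using f by auto
  \<comment> \<open>\<open>D\<close> satisfies the triangle inequality up to a factor 2, so each of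
    the two approximation steps has to stay below \<open>\<epsilon> / 4\<close>.\<close>
  define D where "D u v = (cmod (u - v))\<^sup>2 + cmod (u - v)" for u v
  have D_nn: "0 \<le> D u v" for u v by (simp add: D_def)
  have D_tri: "D u w \<le> 2 * D u v + 2 * D v w" for u v w
  proof -
    have "cmod (u - w) \<le> cmod (u - v) + cmod (v - w)"
      using norm_triangle_ineq[of "u - v" "v - w"] by simp
    then show ?thesis
      using norm_diff_power2_le[of u w v] norm_ge_zero[of "u - v"] norm_ge_zero[of "v - w"]
      unfolding D_def distrib_left by linarith
  qed
  define F where "F n x = (if cmod (f x) \<le> real n \<and> norm x \<le> real n then f x else 0)" for n x
  have [measurable]: "F n \<in> borel_measurable borel" for n
    unfolding F_def[abs_def] by measurable
  have DF_le: "D (f x) (F n x) \<le> (cmod (f x))\<^sup>2 + cmod (f x)" for n x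
    by (auto simp: D_def F_def)
  have int_DF: "integrable lborel (\<lambda>x. D (f x) (F n x))" for n
    by (rule Bochner_Integration.integrable_bound[of _ "\<lambda>x. (cmod (f x))\<^sup>2 + cmod (f x)"])
       (use f DF_le in \<open>auto simp: D_nn D_def[abs_def]\<close>)
  have "(\<lambda>n. \<integral>x. D (f x) (F n x) \<partial>lborel) \<longlonglongrightarrow> (\<integral>x. 0 \<partial>(lborel :: 'a measure))"
  proof (rule integral_dominated_convergence)
    show "integrable lborel (\<lambda>x. (cmod (f x))\<^sup>2 + cmod (f x))" using f by auto
    show "AE x in lborel. norm (D (f x) (F n x)) \<le> (cmod (f x))\<^sup>2 + cmod (f x)" for n
      using DF_le by (simp add: D_nn)
    show "AE x in lborel. (\<lambda>n. D (f x) (F n x)) \<longlonglongrightarrow> 0"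
    proof (intro AE_I2 tendsto_eventually)
      fix x
      obtain n where n: "max (cmod (f x)) (norm x) \<le> real n" using real_arch_simple by blast
      then show "\<forall>\<^sub>F n in sequentially. D (f x) (F n x) = 0"
        by (intro eventually_sequentiallyI[of n]) (auto simp: F_def D_def)
    qed
  qed (auto simp: D_def[abs_def])
  then have "\<forall>\<^sub>F n in sequentially. (\<integral>x. D (f x) (F n x) \<partial>lborel) < \<epsilon> / 4"
    using \<open>\<epsilon> > 0\<close> by (intro order_tendstoD) auto
  then obtain n where n: "(\<integral>x. D (f x) (F n x) \<partial>lborel) < \<epsilon> / 4"
    by (auto simp: eventually_sequentially)
  have F_le: "cmod (F n x) \<le> real n" and F_0: "x \<notin> cball 0 (real n) \<Longrightarrow> F n x = 0" for x
    by (auto simp: F_def)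
  have "\<exists>g. continuous_on UNIV g \<and> (\<forall>x. x \<notin> cball 0 (real n + 1) \<longrightarrow> g x = 0) \<and>
    (\<integral>x. (cmod (F n x - g x))\<^sup>2 + cmod (F n x - g x) \<partial>lborel) < \<epsilon> / 4"
    \<comment> \<open>The added 1 keeps the bound positive when \<open>n = 0\<close>.\<close>
    by (rule continuous_approximation_bounded[where B="real n + 1"])
       (use F_le F_0 \<open>\<epsilon> > 0\<close> in \<open>auto intro: order_trans[OF F_le]\<close>)
  then obtain g where g: "continuous_on UNIV g" "\<And>x. x \<notin> cball 0 (real n + 1) \<Longrightarrow> g x = 0"
    "(\<integral>x. D (F n x) (g x) \<partial>lborel) < \<epsilon> / 4"
    unfolding D_def by blast
  have [measurable]: "g \<in> borel_measurable borel"
    using g(1) by (rule borel_measurable_continuous_onI)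
  obtain B where B: "0 \<le> B" "\<And>x. cmod (g x) \<le> B"
    using continuous_compact_support_bounded[OF g(1,2)] by blast
  have int_Dg: "integrable lborel (\<lambda>x. D (F n x) (g x))"
  proof (rule integrable_bounded_support)
    show "norm (D (F n x) (g x)) \<le> (real n + B)\<^sup>2 + (real n + B)" for x
    proof -
      have "cmod (F n x - g x) \<le> real n + B"
        using norm_triangle_ineq4[of "F n x" "g x"] F_le[of x] B(2)[of x] by linarith
      then show ?thesis unfolding D_def by (auto intro!: add_mono power_mono)
    qed
    show "D (F n x) (g x) = 0" if "x \<notin> cball 0 (real n + 1)" for x
      using g(2)[OF that] that by (auto simp: D_def F_def)
  qed (auto simp: D_def[abs_def])
  have int_D: "integrable lborel (\<lambda>x. D (f x) (g x))"
  proof (rule Bochner_Integration.integrable_bound)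
    show "integrable lborel (\<lambda>x. 2 * D (f x) (F n x) + 2 * D (F n x) (g x))"
      using int_DF int_Dg by auto
    show "AE x in lborel. norm (D (f x) (g x)) \<le> norm (2 * D (f x) (F n x) + 2 * D (F n x) (g x))"
      using D_tri by (simp add: D_nn)
  qed (simp add: D_def)
  have "(\<integral>x. D (f x) (g x) \<partial>lborel) \<le> (\<integral>x. 2 * D (f x) (F n x) + 2 * D (F n x) (g x) \<partial>lborel)"
    using int_D int_DF int_Dg by (intro integral_mono D_tri) auto
  also have "\<dots> = 2 * (\<integral>x. D (f x) (F n x) \<partial>lborel) + 2 * (\<integral>x. D (F n x) (g x) \<partial>lborel)"
    using int_DF int_Dg by simp
  finally have lt: "(\<integral>x. D (f x) (g x) \<partial>lborel) < \<epsilon>"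
    using n g(3) \<open>\<epsilon> > 0\<close> by linarith
  have "(\<integral>x. (cmod (f x - g x))\<^sup>2 \<partial>lborel) \<le> (\<integral>x. D (f x) (g x) \<partial>lborel)"
    by (rule integral_mono_AE'[OF int_D]) (auto simp: D_def)
  moreover have "(\<integral>x. cmod (f x - g x) \<partial>lborel) \<le> (\<integral>x. D (f x) (g x) \<partial>lborel)"
    by (rule integral_mono_AE'[OF int_D]) (auto simp: D_def)
  ultimately show ?thesis
    using lt g(1,2) by (intro that[of g "real n + 1"]) auto
qed

section \<open>From continuous to integrable functions\<close>

lemma fourier_integral_diff:
  fixes f g :: "'a::euclidean_space \<Rightarrow> complex"
  assumes "integrable lebesgue f" "integrable lebesgue g"
  shows "fourier_integral (\<lambda>t. f t - g t) \<xi> = fourier_integral f \<xi> - fourier_integral g \<xi>"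
proof -
  have "integrable lebesgue (\<lambda>t. cis (- (\<xi> \<bullet> t)) * f t)" if "integrable lebesgue f" for f
  proof (rule Bochner_Integration.integrable_bound[OF that])
    have "(\<lambda>t. cis (- (\<xi> \<bullet> t))) \<in> borel_measurable lebesgue"
      by (rule measurable_completion) measurable
    then show "(\<lambda>t. cis (- (\<xi> \<bullet> t)) * f t) \<in> borel_measurable lebesgue"
      using that by (intro borel_measurable_times) auto
  qed (auto simp: norm_mult)
  from this[OF assms(1)] this[OF assms(2)] show ?thesis
    by (simp add: fourier_integral_def right_diff_distrib)
qed

lemma fourier_integral_cong_AE:
  fixes f g :: "'a::euclidean_space \<Rightarrow> complex"
  assumes "f \<in> borel_measurable lebesgue" "g \<in> borel_measurable lebesgue" "AE t in lebesgue. f t = g t"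
  shows "fourier_integral f = fourier_integral g"
proof
  fix \<xi> :: 'a
  have "(\<lambda>t. cis (- (\<xi> \<bullet> t))) \<in> borel_measurable lebesgue"
    by (rule measurable_completion) measurable
  moreover have "AE t in lebesgue. cis (- (\<xi> \<bullet> t)) * f t = cis (- (\<xi> \<bullet> t)) * g t"
    using assms(3) by eventually_elim simp
  ultimately have "(\<integral>t. cis (- (\<xi> \<bullet> t)) * f t \<partial>lebesgue) = (\<integral>t. cis (- (\<xi> \<bullet> t)) * g t \<partial>lebesgue)"
    using assms(1,2) by (intro integral_cong_AE borel_measurable_times) auto
  then show "fourier_integral f \<xi> = fourier_integral g \<xi>" by (simp add: fourier_integral_def)
qed

text \<open>Continuous approximants converge in mean, so their transforms converge pointwise; their
  norms converge by closeness in mean square. Fatou's lemma then gives square-integrability, but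
  only an inequality between the norms.\<close>

lemma fourier_integral_L2_bound:
  fixes f :: "'a::euclidean_space \<Rightarrow> complex"
  assumes f: "integrable lborel f" "square_integrable f"
  shows "square_integrable (fourier_integral f)"
    and "norm (abs_L2 (fourier_integral f)) \<le> norm (abs_L2 f)"
proof -
  have [measurable]: "f \<in> borel_measurable borel" using f by auto
  then have f2: "integrable lborel (\<lambda>x. (cmod (f x))\<^sup>2)"
    using f by (simp add: borel_square_integrable_iff)
  define c where "c = (2 * pi) powr (- real DIM('a) / 2)"
  define \<epsilon> :: "nat \<Rightarrow> real" where "\<epsilon> k = 1 / Suc k" for k
  have \<epsilon>: "\<epsilon> k > 0" for k by (simp add: \<epsilon>_def)
  have \<epsilon>_lim: "\<epsilon> \<longlonglongrightarrow> 0" unfolding \<epsilon>_def[abs_def] by (rule LIMSEQ_Suc) (rule lim_1_over_n)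
  define P where "P k g R \<longleftrightarrow> continuous_on UNIV g \<and> (\<forall>x. x \<notin> cball 0 R \<longrightarrow> g x = 0) \<and>
    (\<integral>x. (cmod (f x - g x))\<^sup>2 \<partial>lborel) < \<epsilon> k \<and> (\<integral>x. cmod (f x - g x) \<partial>lborel) < \<epsilon> k" for k g R
  have "\<exists>g R. P k g R" for k
    by (rule continuous_approximation[OF f(1) f2 \<epsilon>[of k]]) (auto simp: P_def)
  then obtain g R where "\<And>k. P k (g k) (R k)"
    by metis
  then have g: "\<And>k. continuous_on UNIV (g k)" "\<And>k x. x \<notin> cball 0 (R k) \<Longrightarrow> g k x = 0"
    "\<And>k. (\<integral>x. (cmod (f x - g k x))\<^sup>2 \<partial>lborel) < \<epsilon> k" "\<And>k. (\<integral>x. cmod (f x - g k x) \<partial>lborel) < \<epsilon> k"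
    unfolding P_def by auto
  have [measurable]: "g k \<in> borel_measurable borel" for k
    using g(1) by (rule borel_measurable_continuous_onI)
  have int_g: "integrable lborel (g k)" and int_g2: "integrable lborel (\<lambda>x. (cmod (g k x))\<^sup>2)" for k
  proof -
    obtain B where B: "0 \<le> B" "\<And>x. cmod (g k x) \<le> B"
      using continuous_compact_support_bounded[OF g(1,2)] by blast
    show "integrable lborel (g k)"
      by (rule integrable_bounded_support[OF _ B(2) g(2)]) auto
    show "integrable lborel (\<lambda>x. (cmod (g k x))\<^sup>2)"
      by (rule integrable_bounded_support[of _ "B\<^sup>2" "R k"]) (use B g(2) in \<open>auto intro: power_mono\<close>)
  qed
  have sq_g: "square_integrable (g k)" for k
    using int_g2 by (simp add: borel_square_integrable_iff)
  have sub: "fourier_integral (\<lambda>t. f t - g k t) \<xi> = fourier_integral f \<xi> - fourier_integral (g k) \<xi>" for k \<xi>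
    using f int_g by (intro fourier_integral_diff) (auto simp: integrable_completion)
  have conv: "(\<lambda>k. fourier_integral (g k) \<xi>) \<longlonglongrightarrow> fourier_integral f \<xi>" for \<xi>
  proof (rule LIM_zero_cancel, rule Lim_null_comparison)
    show "\<forall>\<^sub>F k in sequentially. norm (fourier_integral (g k) \<xi> - fourier_integral f \<xi>) \<le> c * \<epsilon> k"
    proof (intro always_eventually allI)
      fix k
      have "norm (fourier_integral (g k) \<xi> - fourier_integral f \<xi>) = norm (fourier_integral (\<lambda>t. f t - g k t) \<xi>)"
        by (simp add: sub norm_minus_commute)
      also have "\<dots> \<le> c * (\<integral>x. cmod (f x - g k x) \<partial>lborel)"
        unfolding c_def using f int_g by (intro norm_fourier_integral_le) auto
      also have "\<dots> \<le> c * \<epsilon> k"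
        using g(4)[of k] by (intro mult_left_mono) (auto simp: c_def)
      finally show "norm (fourier_integral (g k) \<xi> - fourier_integral f \<xi>) \<le> c * \<epsilon> k" .
    qed
    show "(\<lambda>k. c * \<epsilon> k) \<longlonglongrightarrow> 0" using tendsto_mult_right_zero[OF \<epsilon>_lim] .
  qed
  have norm_g: "norm (abs_L2 (g k)) \<le> norm (abs_L2 f) + sqrt (\<epsilon> k)" for k
  proof -
    have "norm (abs_L2 f - abs_L2 (g k)) = sqrt (\<integral>x. (cmod (f x - g k x))\<^sup>2 \<partial>lborel)"
      using f sq_g square_integrable_diff[OF f(2) sq_g] by (simp add: diff_abs_L2 norm_abs_L2_borel)
    also have "\<dots> \<le> sqrt (\<epsilon> k)" using g(3)[of k] by simp
    finally show ?thesis
      using norm_triangle_ineq2[of "abs_L2 (g k)" "abs_L2 f"] by (simp add: norm_minus_commute)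
  qed
  have nn: "(\<integral>\<^sup>+\<xi>. ennreal ((cmod (fourier_integral (g k) \<xi>))\<^sup>2) \<partial>lborel) = ennreal ((norm (abs_L2 (g k)))\<^sup>2)" for k
    using fourier_integral_plancherel_continuous[OF g(1)[of k] g(2)[where k=k]]
    by (simp add: nn_integral_eq_integral norm_abs_L2_borel sq_g)
  have "(\<integral>\<^sup>+\<xi>. ennreal ((cmod (fourier_integral f \<xi>))\<^sup>2) \<partial>lborel) =
      (\<integral>\<^sup>+\<xi>. liminf (\<lambda>k. ennreal ((cmod (fourier_integral (g k) \<xi>))\<^sup>2)) \<partial>lborel)"
    by (intro nn_integral_cong lim_imp_Liminf[symmetric] tendsto_ennrealI tendsto_intros conv) auto
  also have "\<dots> \<le> liminf (\<lambda>k. \<integral>\<^sup>+\<xi>. ennreal ((cmod (fourier_integral (g k) \<xi>))\<^sup>2) \<partial>lborel)"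
    by (rule nn_integral_liminf) measurable
  also have "\<dots> \<le> liminf (\<lambda>k. ennreal ((norm (abs_L2 f) + sqrt (\<epsilon> k))\<^sup>2))"
    unfolding nn by (intro Liminf_mono always_eventually allI ennreal_leI power_mono norm_g) auto
  also have "\<dots> = ennreal ((norm (abs_L2 f))\<^sup>2)"
  proof (intro lim_imp_Liminf tendsto_ennrealI)
    have "(\<lambda>k. (norm (abs_L2 f) + sqrt (\<epsilon> k))\<^sup>2) \<longlonglongrightarrow> (norm (abs_L2 f) + sqrt 0)\<^sup>2"
      by (intro tendsto_intros \<epsilon>_lim)
    then show "(\<lambda>k. (norm (abs_L2 f) + sqrt (\<epsilon> k))\<^sup>2) \<longlonglongrightarrow> (norm (abs_L2 f))\<^sup>2" by simp
  qed auto
  finally have le: "(\<integral>\<^sup>+\<xi>. ennreal ((cmod (fourier_integral f \<xi>))\<^sup>2) \<partial>lborel) \<le> ennreal ((norm (abs_L2 f))\<^sup>2)" .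
  then have int: "integrable lborel (\<lambda>\<xi>. (cmod (fourier_integral f \<xi>))\<^sup>2)"
    by (intro integrableI_bounded) (auto intro: order_le_less_trans)
  then show sq: "square_integrable (fourier_integral f)"
    by (simp add: borel_square_integrable_iff)
  have "(\<integral>\<xi>. (cmod (fourier_integral f \<xi>))\<^sup>2 \<partial>lborel) \<le> (norm (abs_L2 f))\<^sup>2"
    using le int by (simp add: nn_integral_eq_integral)
  then show "norm (abs_L2 (fourier_integral f)) \<le> norm (abs_L2 f)"
    using sq by (simp add: norm_abs_L2_borel real_le_lsqrt)
qed

text \<open>The inequality applied to differences makes the transform a contraction. As norms are
  preserved on continuous functions of bounded support, which come arbitrarily close to
  \<open>f\<close>, equality carries over.\<close>

lemma fourier_integral_isometry_borel:
  fixes f :: "'a::euclidean_space \<Rightarrow> complex"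
  assumes f: "integrable lborel f" "square_integrable f"
  shows "norm (abs_L2 (fourier_integral f)) = norm (abs_L2 f)"
proof (rule antisym[OF fourier_integral_L2_bound(2)[OF f]], rule field_le_epsilon)
  fix e :: real assume "0 < e"
  \<comment> \<open>The norm is the square root of the integral, and the approximation error enters
    twice, once for \<open>f\<close> and once for its transform.\<close>
  define \<epsilon> where "\<epsilon> = (e / 2)\<^sup>2"
  have [measurable]: "f \<in> borel_measurable borel" using f by auto
  then have f2: "integrable lborel (\<lambda>x. (cmod (f x))\<^sup>2)"
    using f by (simp add: borel_square_integrable_iff)
  have "\<epsilon> > 0" using \<open>0 < e\<close> by (simp add: \<epsilon>_def)
  then obtain g R where g: "continuous_on UNIV g" "\<And>x. x \<notin> cball 0 R \<Longrightarrow> g x = 0"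
    "(\<integral>x. (cmod (f x - g x))\<^sup>2 \<partial>lborel) < \<epsilon>"
    using continuous_approximation[OF f(1) f2] by blast
  have [measurable]: "g \<in> borel_measurable borel"
    using g(1) by (rule borel_measurable_continuous_onI)
  obtain B where B: "0 \<le> B" "\<And>x. cmod (g x) \<le> B"
    using continuous_compact_support_bounded[OF g(1,2)] by blast
  have int_g: "integrable lborel g"
    by (rule integrable_bounded_support[OF _ B(2) g(2)]) auto
  have "integrable lborel (\<lambda>x. (cmod (g x))\<^sup>2)"
    by (rule integrable_bounded_support[of _ "B\<^sup>2" "R"]) (use B g(2) in \<open>auto intro: power_mono\<close>)
  then have sq_g: "square_integrable g" by (simp add: borel_square_integrable_iff)
  have sq_fg: "square_integrable (\<lambda>t. f t - g t)" by (rule square_integrable_diff[OF f(2) sq_g])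
  have int_fg: "integrable lborel (\<lambda>t. f t - g t)" using f int_g by auto
  have d: "norm (abs_L2 f - abs_L2 g) \<le> e / 2"
    using g(3) \<open>0 < e\<close> sq_fg real_sqrt_less_mono[OF g(3)]
    by (simp add: diff_abs_L2 f sq_g norm_abs_L2_borel \<epsilon>_def)
  have sub: "fourier_integral (\<lambda>t. f t - g t) = (\<lambda>\<xi>. fourier_integral f \<xi> - fourier_integral g \<xi>)"
    using f int_g by (intro ext fourier_integral_diff) (auto simp: integrable_completion)
  have "norm (abs_L2 (fourier_integral f) - abs_L2 (fourier_integral g)) \<le> norm (abs_L2 f - abs_L2 g)"
    using fourier_integral_L2_bound(2)[OF int_fg sq_fg] fourier_integral_L2_bound(1)[OF f]
      fourier_integral_L2_bound(1)[OF int_g sq_g]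
    by (simp add: sub diff_abs_L2 f sq_g)
  moreover have "norm (abs_L2 (fourier_integral g)) = norm (abs_L2 g)"
    using fourier_integral_plancherel_continuous[OF g(1,2)] fourier_integral_L2_bound(1)[OF int_g sq_g]
    by (simp add: norm_abs_L2_borel sq_g)
  ultimately show "norm (abs_L2 f) \<le> norm (abs_L2 (fourier_integral f)) + e"
    using d norm_triangle_ineq2[of "abs_L2 f" "abs_L2 g"]
      norm_triangle_ineq2[of "abs_L2 (fourier_integral g)" "abs_L2 (fourier_integral f)"]
    by (simp add: norm_minus_commute)
qed

lemma fourier_integral_isometry:
  fixes f :: "'a::euclidean_space \<Rightarrow> complex"
  assumes f: "integrable lebesgue f" "square_integrable f"
  shows "square_integrable (fourier_integral f)"
    and "norm (abs_L2 (fourier_integral f)) = norm (abs_L2 f)"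
proof -
  obtain g where g [measurable]: "g \<in> borel_measurable borel" and eq: "AE t in lebesgue. f t = g t"
    using obtain_borel_version[of f] f(1) by auto
  then have g': "g \<in> borel_measurable lebesgue" by (auto intro: measurable_completion)
  have sq: "square_integrable g"
    by (rule square_integrable_cong_AE[OF f(2) g' eq])
  have "integrable lebesgue g"
    using f(1) integrable_cong_AE[OF _ g' eq] by auto
  then have int: "integrable lborel g" by (simp add: integrable_completion)
  have "fourier_integral f = fourier_integral g" "abs_L2 f = abs_L2 g"
    using f eq g' sq by (auto intro: fourier_integral_cong_AE abs_L2_eqI)
  then show "square_integrable (fourier_integral f)"
    "norm (abs_L2 (fourier_integral f)) = norm (abs_L2 f)"
    using fourier_integral_L2_bound(1)[OF int sq] fourier_integral_isometry_borel[OF int sq] by auto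
qed

section \<open>The Fourier transform is unitary\<close>

lemma norm_diff_L2_bound_imp:
  assumes f: "f \<in> borel_measurable borel" "square_integrable f" and g: "g \<in> borel_measurable borel"
    and le: "(\<integral>\<^sup>+t. ennreal ((cmod (f t - g t))\<^sup>2) \<partial>lborel) \<le> ennreal (e\<^sup>2)" and "0 \<le> e"
  shows "square_integrable g" "norm (abs_L2 f - abs_L2 g) \<le> e"
proof -
  have [measurable]: "f \<in> borel_measurable borel" "g \<in> borel_measurable borel" using f g by auto
  have int: "integrable lborel (\<lambda>t. (cmod (f t - g t))\<^sup>2)"
    using le by (intro integrableI_bounded) (auto intro: order_le_less_trans)
  then have sq: "square_integrable (\<lambda>t. f t - g t)"
    by (simp add: borel_square_integrable_iff)
  from square_integrable_diff[OF f(2) this] show "square_integrable g" by simp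
  have "(\<integral>t. (cmod (f t - g t))\<^sup>2 \<partial>lborel) \<le> e\<^sup>2"
    using le int by (simp add: nn_integral_eq_integral)
  then show "norm (abs_L2 f - abs_L2 g) \<le> e"
    using sq f \<open>square_integrable g\<close> \<open>0 \<le> e\<close>
    by (simp add: diff_abs_L2 norm_abs_L2_borel real_le_lsqrt)
qed

lemma nn_integral_diff_L2:
  assumes "f \<in> borel_measurable borel" "square_integrable f" "g \<in> borel_measurable borel" "square_integrable g"
  shows "(\<integral>\<^sup>+t. ennreal ((cmod (f t - g t))\<^sup>2) \<partial>lborel) = ennreal ((norm (abs_L2 f - abs_L2 g))\<^sup>2)"
proof -
  have [measurable]: "f \<in> borel_measurable borel" "g \<in> borel_measurable borel" using assms by auto
  have sq: "square_integrable (\<lambda>t. f t - g t)" using assms by (intro square_integrable_diff)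
  then have int: "integrable lborel (\<lambda>t. (cmod (f t - g t))\<^sup>2)"
    by (simp add: borel_square_integrable_iff)
  then show ?thesis
    using sq assms by (simp add: nn_integral_eq_integral diff_abs_L2 norm_abs_L2_borel)
qed

text \<open>A finite weighted sum bounds each increment by a multiple of \<open>(1 / 2) ^ k\<close>,
  so the increments are absolutely summable. The weight lets squared increments be integrated term
  by term, with no triangle inequality for an infinite sum of norms.\<close>

lemma convergent_if_weighted_suminf_finite:
  fixes z :: "nat \<Rightarrow> complex"
  assumes fin: "(\<Sum>k. ennreal (4 ^ k * (cmod (z (Suc k) - z k))\<^sup>2)) \<noteq> \<infinity>"
  shows "convergent z"
proof -
  define c where "c k = cmod (z (Suc k) - z k)" for k
  define t where "t k = 4 ^ k * (c k)\<^sup>2" for k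
  define S where "S = enn2real (\<Sum>k. ennreal (t k))"
  have fin': "(\<Sum>k. ennreal (t k)) = ennreal S"
    using fin by (simp add: S_def t_def c_def ennreal_enn2real_if)
  have c_le: "c k \<le> sqrt S * (1 / 2) ^ k" for k
  proof -
    have "(\<Sum>i\<in>{k}. ennreal (t i)) \<le> (\<Sum>k. ennreal (t k))"
      by (rule sum_le_suminf) auto
    then have "ennreal (t k) \<le> ennreal S" by (simp add: fin')
    then have "t k \<le> S" by (subst (asm) ennreal_le_iff) (simp_all add: S_def)
    moreover have "((2::real) ^ k)\<^sup>2 = 4 ^ k"
      by (simp only: power2_eq_square power_mult_distrib[symmetric]) simp
    ultimately have "(2 ^ k * c k)\<^sup>2 \<le> S" by (simp add: t_def power_mult_distrib)
    then have "2 ^ k * c k \<le> sqrt S" by (rule real_le_rsqrt)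
    then have "(1 / 2) ^ k * (2 ^ k * c k) \<le> (1 / 2) ^ k * sqrt S"
      by (rule mult_left_mono) simp
    also have "(1 / 2) ^ k * (2 ^ k * c k) = c k" by (simp add: power_one_over)
    finally show ?thesis by (simp only: mult.commute)
  qed
  have geo: "summable (\<lambda>k. sqrt S * (1 / 2) ^ k)"
    by (rule summable_mult) (rule summable_geometric, simp)
  have "summable (\<lambda>k. z (Suc k) - z k)"
    by (rule summable_comparison_test'[OF geo, of 0]) (use c_le in \<open>simp add: c_def\<close>)
  then have "convergent (\<lambda>n. (\<Sum>k<n. z (Suc k) - z k) + z 0)"
    unfolding summable_iff_convergent by (intro convergent_add convergent_const)
  then show ?thesis by (simp add: sum_lessThan_telescope)
qed

text \<open>Along a subsequence with distances at most \<open>(1 / 4) ^ k\<close> the weighted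
  series of squared increments has a finite integral, hence the representatives converge almost
  everywhere. Fatou's lemma shows that the pointwise limit is also the limit in norm.\<close>

theorem Cauchy_L2_convergent:
  fixes X :: "nat \<Rightarrow> 'a::euclidean_space L2"
  assumes "Cauchy X"
  shows "convergent X"
proof -
  have "\<exists>N. \<forall>m\<ge>N. \<forall>n\<ge>N. dist (X m) (X n) < (1 / 4) ^ k" for k :: nat
    using assms unfolding Cauchy_def by simp
  then obtain N where N: "\<And>k m n. N k \<le> m \<Longrightarrow> N k \<le> n \<Longrightarrow> dist (X m) (X n) < (1 / 4) ^ k"
    by metis
  \<comment> \<open>The partial sums dominate all earlier \<open>N i\<close>, so \<open>r k\<close>
    may serve as an index for every threshold up to \<open>k\<close>.\<close>
  define r where "r k = (\<Sum>i\<le>k. N i)" for k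
  have r: "N i \<le> r k" if "i \<le> k" for i k
    unfolding r_def using that by (intro member_le_sum) auto
  have "\<exists>f. f \<in> borel_measurable borel \<and> square_integrable f \<and> abs_L2 f = X (r k)" for k
    using borel_representative[of "X (r k)"] by metis
  then obtain f where f [measurable]: "\<And>k. f k \<in> borel_measurable borel"
    and sq: "\<And>k. square_integrable (f k)" and abs_f: "\<And>k. abs_L2 (f k) = X (r k)"
    by metis
  have dist_f: "norm (abs_L2 (f i) - abs_L2 (f j)) \<le> (1 / 4) ^ k" if "k \<le> i" "k \<le> j" for i j k
    using N[OF r[OF that(1)] r[OF that(2)]] by (simp add: abs_f dist_norm)
  have "(\<integral>\<^sup>+t. (\<Sum>k. ennreal (4 ^ k * (cmod (f (Suc k) t - f k t))\<^sup>2)) \<partial>lborel) =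
      (\<Sum>k. ennreal (4 ^ k) * ennreal ((norm (abs_L2 (f (Suc k)) - abs_L2 (f k)))\<^sup>2))"
    by (subst nn_integral_suminf) (auto simp: ennreal_mult nn_integral_cmult nn_integral_diff_L2 sq)
  also have "\<dots> \<le> (\<Sum>k. ennreal ((1 / 4) ^ k))"
  proof (intro suminf_le)
    fix k
    have "(norm (abs_L2 (f (Suc k)) - abs_L2 (f k)))\<^sup>2 \<le> ((1 / 4) ^ k)\<^sup>2"
      by (intro power_mono dist_f) auto
    then have "4 ^ k * (norm (abs_L2 (f (Suc k)) - abs_L2 (f k)))\<^sup>2 \<le> 4 ^ k * ((1 / 4) ^ k)\<^sup>2"
      by (intro mult_left_mono) auto
    also have "\<dots> = (1 / 4) ^ k" by (simp add: power2_eq_square power_divide)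
    finally show "ennreal (4 ^ k) * ennreal ((norm (abs_L2 (f (Suc k)) - abs_L2 (f k)))\<^sup>2) \<le> ennreal ((1 / 4) ^ k)"
      by (simp add: ennreal_mult[symmetric] ennreal_leI)
  qed auto
  also have "\<dots> = ennreal (\<Sum>k. (1 / 4) ^ k)"
    by (rule suminf_ennreal2) (auto intro!: summable_geometric)
  finally have "(\<integral>\<^sup>+t. (\<Sum>k. ennreal (4 ^ k * (cmod (f (Suc k) t - f k t))\<^sup>2)) \<partial>lborel) \<noteq> \<infinity>"
    by (auto simp: top_unique)
  then have "AE t in lborel. (\<Sum>k. ennreal (4 ^ k * (cmod (f (Suc k) t - f k t))\<^sup>2)) \<noteq> \<infinity>"
    by (intro nn_integral_noteq_infinite) auto
  then have lim: "AE t in lborel. (\<lambda>k. f k t) \<longlonglongrightarrow> lim (\<lambda>k. f k t)"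
  proof eventually_elim
    case (elim t)
    from convergent_if_weighted_suminf_finite[OF this] show ?case by (simp only: convergent_LIMSEQ_iff)
  qed
  define F where "F t = lim (\<lambda>k. f k t)" for t
  have [measurable]: "F \<in> borel_measurable borel"
    unfolding F_def[abs_def] by (rule borel_measurable_lim_metric) simp
  have le: "(\<integral>\<^sup>+t. ennreal ((cmod (f k t - F t))\<^sup>2) \<partial>lborel) \<le> ennreal (((1 / 4) ^ k)\<^sup>2)" for k
  proof -
    have "(\<integral>\<^sup>+t. ennreal ((cmod (f k t - F t))\<^sup>2) \<partial>lborel) =
        (\<integral>\<^sup>+t. liminf (\<lambda>n. ennreal ((cmod (f k t - f n t))\<^sup>2)) \<partial>lborel)"
    proof (intro nn_integral_cong_AE)
      show "AE t in lborel. ennreal ((cmod (f k t - F t))\<^sup>2) = liminf (\<lambda>n. ennreal ((cmod (f k t - f n t))\<^sup>2))"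
        using lim by eventually_elim
          (auto simp: F_def intro!: lim_imp_Liminf[symmetric] tendsto_ennrealI tendsto_intros)
    qed
    also have "\<dots> \<le> liminf (\<lambda>n. \<integral>\<^sup>+t. ennreal ((cmod (f k t - f n t))\<^sup>2) \<partial>lborel)"
      by (rule nn_integral_liminf) measurable
    also have "\<dots> \<le> liminf (\<lambda>n. ennreal (((1 / 4) ^ k)\<^sup>2))"
    proof (rule Liminf_mono, rule eventually_sequentiallyI[of k])
      fix n assume "k \<le> n"
      then have "(norm (abs_L2 (f k) - abs_L2 (f n)))\<^sup>2 \<le> ((1 / 4) ^ k)\<^sup>2"
        by (intro power_mono dist_f) auto
      then show "(\<integral>\<^sup>+t. ennreal ((cmod (f k t - f n t))\<^sup>2) \<partial>lborel) \<le> ennreal (((1 / 4) ^ k)\<^sup>2)"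
        by (simp only: nn_integral_diff_L2[OF f sq f sq] ennreal_leI)
    qed
    also have "\<dots> = ennreal (((1 / 4) ^ k)\<^sup>2)" by (simp add: Liminf_const)
    finally show ?thesis .
  qed
  have dist_F: "norm (X (r k) - abs_L2 F) \<le> (1 / 4) ^ k" for k
    using norm_diff_L2_bound_imp(2)[OF f sq _ le[of k]] by (simp add: abs_f)
  have "X \<longlonglongrightarrow> abs_L2 F"
  proof (rule LIMSEQ_I)
    fix e :: real assume "0 < e"
    then obtain k where k: "(1 / 4) ^ k < e / 2"
      using real_arch_pow_inv[of "e / 2" "1 / 4"] by auto
    show "\<exists>n0. \<forall>n\<ge>n0. norm (X n - abs_L2 F) < e"
    proof (intro exI allI impI)
      fix n assume "N k \<le> n"
      from N[OF this r[of k k]] have "norm (X n - X (r k)) < (1 / 4) ^ k" by (simp add: dist_norm)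
      then show "norm (X n - abs_L2 F) < e"
        using dist_F[of k] k norm_triangle_ineq[of "X n - X (r k)" "X (r k) - abs_L2 F"] by simp
    qed
  qed
  then show ?thesis by (auto simp: convergent_def)
qed

section \<open>Extension of the transform to square-integrable functions\<close>

definition truncation :: "nat \<Rightarrow> 'a::euclidean_space L2 \<Rightarrow> 'a \<Rightarrow> complex" where
  "truncation n x t = indicator (cball 0 (real n)) t * rep_L2 x t"

lemma
  fixes x :: "'a::euclidean_space L2"
  shows square_integrable_truncation [simp]: "square_integrable (truncation n x)"
    and integrable_truncation [simp]: "integrable lebesgue (truncation n x)"
proof -
  have [measurable]: "rep_L2 x \<in> borel_measurable lebesgue"
    and int: "integrable lebesgue (\<lambda>t. (cmod (rep_L2 x t))\<^sup>2)"
    using square_integrable_rep_L2[of x] by (auto simp: square_integrable_def)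
  have "cball 0 (real n) \<in> sets (lebesgue :: 'a measure)" by simp
  then have [measurable]: "truncation n x \<in> borel_measurable lebesgue"
    unfolding truncation_def[abs_def] by (intro borel_measurable_times borel_measurable_indicator) auto
  have "integrable lebesgue (\<lambda>t. (cmod (truncation n x t))\<^sup>2)"
  proof (rule Bochner_Integration.integrable_bound[OF int])
    show "AE t in lebesgue. norm ((cmod (truncation n x t))\<^sup>2) \<le> norm ((cmod (rep_L2 x t))\<^sup>2)"
      by (auto simp: truncation_def indicator_def)
  qed measurable
  then show "square_integrable (truncation n x)" by (simp add: square_integrable_def)
  have "integrable lebesgue (\<lambda>t::'a. (cmod (rep_L2 x t))\<^sup>2 + indicat_real (cball 0 (real n)) t)"
    using int emeasure_lborel_cball_finite[of "0::'a" "real n"]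
    by (intro Bochner_Integration.integrable_add integrable_real_indicator) auto
  then show "integrable lebesgue (truncation n x)"
  proof (rule Bochner_Integration.integrable_bound)
    \<comment> \<open>The constant 1 is integrable on a ball, so there square-integrability implies
      integrability.\<close>
    have "a \<le> a\<^sup>2 + 1" for a :: real
      using zero_le_power2[of "a - 1 / 2"] by (simp add: power2_eq_square algebra_simps)
    then show "AE t in lebesgue. cmod (truncation n x t) \<le>
        norm ((cmod (rep_L2 x t))\<^sup>2 + indicat_real (cball 0 (real n)) t)"
      by (auto simp: truncation_def indicator_def)
  qed simp
qed

lemma abs_truncation_tendsto: "(\<lambda>n. abs_L2 (truncation n x)) \<longlonglongrightarrow> x"
proof -
  have [measurable]: "rep_L2 x \<in> borel_measurable lebesgue"
    and int: "integrable lebesgue (\<lambda>t. (cmod (rep_L2 x t))\<^sup>2)"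
    using square_integrable_rep_L2[of x] by (auto simp: square_integrable_def)
  have [measurable]: "truncation n x \<in> borel_measurable lebesgue" for n
    using square_integrable_truncation[of n x] by (simp add: square_integrable_def)
  have "(\<lambda>n. \<integral>t. (cmod (truncation n x t - rep_L2 x t))\<^sup>2 \<partial>lebesgue) \<longlonglongrightarrow> (\<integral>t. 0 \<partial>(lebesgue :: 'a measure))"
  proof (rule integral_dominated_convergence[OF _ _ int])
    show "AE t in lebesgue. (\<lambda>n. (cmod (truncation n x t - rep_L2 x t))\<^sup>2) \<longlonglongrightarrow> 0"
    proof (intro AE_I2 tendsto_eventually)
      fix t :: 'a
      obtain n where "norm t \<le> real n" using real_arch_simple by blast
      then show "\<forall>\<^sub>F n in sequentially. (cmod (truncation n x t - rep_L2 x t))\<^sup>2 = 0"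
        by (intro eventually_sequentiallyI[of n]) (auto simp: truncation_def)
    qed
    show "AE t in lebesgue. norm ((cmod (truncation n x t - rep_L2 x t))\<^sup>2) \<le> (cmod (rep_L2 x t))\<^sup>2" for n
      by (auto simp: truncation_def indicator_def)
  qed measurable
  then have "(\<lambda>n. sqrt (\<integral>t. (cmod (truncation n x t - rep_L2 x t))\<^sup>2 \<partial>lebesgue)) \<longlonglongrightarrow> sqrt 0"
    by (intro tendsto_real_sqrt) simp
  also have "(\<lambda>n. sqrt (\<integral>t. (cmod (truncation n x t - rep_L2 x t))\<^sup>2 \<partial>lebesgue)) =
      (\<lambda>n. norm (abs_L2 (truncation n x) - x))"
    using diff_abs_L2[OF square_integrable_truncation square_integrable_rep_L2, of _ x x]
    by (simp add: norm_abs_L2 square_integrable_diff)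
  finally show ?thesis by (simp add: tendsto_norm_zero_iff LIM_zero_iff)
qed

text \<open>Two indices and two elements at once: equal elements give the Cauchy property, equal
  indices the isometry.\<close>

lemma fourier_integral_truncation:
  "square_integrable (fourier_integral (truncation n x))"
  "norm (abs_L2 (fourier_integral (truncation n x)) - abs_L2 (fourier_integral (truncation m y))) =
    norm (abs_L2 (truncation n x) - abs_L2 (truncation m y))"
proof -
  show sq: "square_integrable (fourier_integral (truncation n x))" for n x
    by (intro fourier_integral_isometry) auto
  have "(\<lambda>\<xi>. fourier_integral (truncation n x) \<xi> - fourier_integral (truncation m y) \<xi>) =
      fourier_integral (\<lambda>t. truncation n x t - truncation m y t)"
    by (rule ext) (simp add: fourier_integral_diff)
  then show "norm (abs_L2 (fourier_integral (truncation n x)) - abs_L2 (fourier_integral (truncation m y))) =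
    norm (abs_L2 (truncation n x) - abs_L2 (truncation m y))"
    by (simp add: diff_abs_L2 sq fourier_integral_isometry square_integrable_diff)
qed

text \<open>Completeness is what makes the \<open>lim\<close> in the definition of
  \<open>fourier\<close> an actual limit.\<close>

lemma fourier_tendsto: "(\<lambda>n. abs_L2 (fourier_integral (truncation n x))) \<longlonglongrightarrow> fourier x"
proof -
  have "Cauchy (\<lambda>n. abs_L2 (truncation n x))"
    using abs_truncation_tendsto by (rule LIMSEQ_imp_Cauchy)
  then have "Cauchy (\<lambda>n. abs_L2 (fourier_integral (truncation n x)))"
    by (simp add: Cauchy_def dist_norm fourier_integral_truncation)
  from Cauchy_L2_convergent[OF this] show ?thesis
    by (simp add: convergent_LIMSEQ_iff fourier_def truncation_def[abs_def])
qed

lemma norm_fourier_diff: "norm (fourier x - fourier y) = norm (x - y)"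
proof (rule LIMSEQ_unique)
  show "(\<lambda>n. norm (abs_L2 (fourier_integral (truncation n x)) - abs_L2 (fourier_integral (truncation n y))))
      \<longlonglongrightarrow> norm (fourier x - fourier y)"
    by (intro tendsto_intros fourier_tendsto)
  show "(\<lambda>n. norm (abs_L2 (fourier_integral (truncation n x)) - abs_L2 (fourier_integral (truncation n y))))
      \<longlonglongrightarrow> norm (x - y)"
    unfolding fourier_integral_truncation by (intro tendsto_intros abs_truncation_tendsto)
qed

lemma rep_diff_L2: "AE t in lebesgue. rep_L2 (x - y) t = rep_L2 x t - rep_L2 y t"
  using rep_abs_L2[OF square_integrable_diff[OF square_integrable_rep_L2 square_integrable_rep_L2], of x y]
    diff_abs_L2[OF square_integrable_rep_L2 square_integrable_rep_L2, of x y] by simp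

lemma fourier_diff: "fourier (x - y) = fourier x - fourier y"
proof (rule LIMSEQ_unique[OF fourier_tendsto])
  have meas: "truncation n x \<in> borel_measurable lebesgue" for n and x :: "'a L2"
    using square_integrable_truncation[of n x] by (simp add: square_integrable_def)
  \<comment> \<open>The chosen representatives are additive only almost everywhere, a difference
    that the integral does not see.\<close>
  have "AE t in lebesgue. truncation n (x - y) t = truncation n x t - truncation n y t" for n
    using rep_diff_L2[of x y] by eventually_elim (simp add: truncation_def right_diff_distrib)
  then have "fourier_integral (truncation n (x - y)) =
      fourier_integral (\<lambda>t. truncation n x t - truncation n y t)" for n
    by (intro fourier_integral_cong_AE borel_measurable_diff meas)
  moreover have "fourier_integral (\<lambda>t. truncation n x t - truncation n y t) =
      (\<lambda>\<xi>. fourier_integral (truncation n x) \<xi> - fourier_integral (truncation n y) \<xi>)" for n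
    by (rule ext) (simp add: fourier_integral_diff)
  ultimately have "abs_L2 (fourier_integral (truncation n (x - y))) =
      abs_L2 (fourier_integral (truncation n x)) - abs_L2 (fourier_integral (truncation n y))" for n
    by (simp add: diff_abs_L2 fourier_integral_truncation)
  then show "(\<lambda>n. abs_L2 (fourier_integral (truncation n (x - y)))) \<longlonglongrightarrow> fourier x - fourier y"
    by (simp only:) (intro tendsto_intros fourier_tendsto)
qed

lemma fourier_0 [simp]: "fourier 0 = 0"
  using fourier_diff[of 0 0] by simp

lemma norm_fourier [simp]: "norm (fourier x) = norm x"
  using norm_fourier_diff[of x 0] by simp

section \<open>Conjugation, the adjoint and surjectivity\<close>

lemma square_integrable_cnj: "square_integrable f \<Longrightarrow> square_integrable (\<lambda>t. cnj (f t))"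
  by (auto simp: square_integrable_def)

lift_definition cnj_L2 :: "'a::euclidean_space L2 \<Rightarrow> 'a L2" is "\<lambda>f t. cnj (f t)"
  by (auto simp: L2_eq_def square_integrable_cnj)

lemma abs_cnj_L2: "square_integrable f \<Longrightarrow> cnj_L2 (abs_L2 f) = abs_L2 (\<lambda>t. cnj (f t))"
  by (rule cnj_L2.abs_eq) (auto intro: square_integrable_imp_L2_eq)

lemma cnj_cnj_L2 [simp]: "cnj_L2 (cnj_L2 x) = x"
  by transfer (simp add: L2_eq_def)

lemma norm_cnj_L2 [simp]: "norm (cnj_L2 x) = norm x"
  by transfer simp

lemma cnj_L2_diff: "cnj_L2 (x - y) = cnj_L2 x - cnj_L2 y"
  by transfer (auto simp: L2_eq_def square_integrable_cnj square_integrable_diff)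

lemma tendsto_cnj_L2: "X \<longlonglongrightarrow> x \<Longrightarrow> (\<lambda>n. cnj_L2 (X n)) \<longlonglongrightarrow> cnj_L2 x"
  unfolding tendsto_iff dist_norm by (simp flip: cnj_L2_diff)

text \<open>The real inner product with a conjugate is the real part of the bilinear pairing, and
  for that pairing the multiplication formula says that the transform is symmetric.\<close>

lemma inner_fourier_integral_cnj:
  fixes f g :: "'a::euclidean_space \<Rightarrow> complex"
  assumes f: "integrable lebesgue f" "square_integrable f" and g: "integrable lebesgue g" "square_integrable g"
  shows "abs_L2 (fourier_integral f) \<bullet> cnj_L2 (abs_L2 g) = abs_L2 f \<bullet> cnj_L2 (abs_L2 (fourier_integral g))"
proof -
  have inner: "u \<bullet> cnj v = Re (u * v)" for u v by (simp add: inner_complex_def)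
  have *: "abs_L2 u \<bullet> cnj_L2 (abs_L2 v) = Re (\<integral>t. u t * v t \<partial>lborel)"
    if "u \<in> borel_measurable borel" "v \<in> borel_measurable borel" "square_integrable u" "square_integrable v"
      "integrable lborel (\<lambda>t. u t * v t)"
    for u v :: "'a \<Rightarrow> complex"
  proof -
    have [measurable]: "u \<in> borel_measurable borel" "v \<in> borel_measurable borel" using that by auto
    have "abs_L2 u \<bullet> cnj_L2 (abs_L2 v) = (\<integral>t. Re (u t * v t) \<partial>lebesgue)"
      using that by (simp add: abs_cnj_L2 inner_abs_L2 square_integrable_cnj inner)
    also have "\<dots> = (\<integral>t. Re (u t * v t) \<partial>lborel)"
      by (rule integral_completion) measurable
    also have "\<dots> = Re (\<integral>t. u t * v t \<partial>lborel)" using that(5) by (rule integral_Re)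
    finally show ?thesis .
  qed
  obtain f' where f' [measurable]: "f' \<in> borel_measurable borel" and eqf: "AE t in lebesgue. f t = f' t"
    using obtain_borel_version[of f] f(1) by auto
  obtain g' where g' [measurable]: "g' \<in> borel_measurable borel" and eqg: "AE t in lebesgue. g t = g' t"
    using obtain_borel_version[of g] g(1) by auto
  have f'': "f' \<in> borel_measurable lebesgue" and g'': "g' \<in> borel_measurable lebesgue"
    by (auto intro: measurable_completion)
  have sq: "square_integrable f'" "square_integrable g'"
    using square_integrable_cong_AE[OF f(2) f'' eqf] square_integrable_cong_AE[OF g(2) g'' eqg] .
  have "integrable lebesgue f'" "integrable lebesgue g'"
    using f(1) g(1) integrable_cong_AE[OF _ f'' eqf] integrable_cong_AE[OF _ g'' eqg] by auto
  then have int: "integrable lborel f'" "integrable lborel g'" by (auto simp: integrable_completion)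
  have "fourier_integral f = fourier_integral f'" "abs_L2 f = abs_L2 f'"
    "fourier_integral g = fourier_integral g'" "abs_L2 g = abs_L2 g'"
    using f g eqf eqg f'' g'' sq by (auto intro: fourier_integral_cong_AE abs_L2_eqI)
  note eqs = this
  have int_prod: "integrable lborel (\<lambda>x. fourier_integral u x * v x)"
    if "integrable lborel u" "integrable lborel v" for u v :: "'a \<Rightarrow> complex"
  proof -
    have [measurable]: "u \<in> borel_measurable borel" "v \<in> borel_measurable borel" using that by auto
    show ?thesis
    proof (rule Bochner_Integration.integrable_bound)
      let ?B = "(2 * pi) powr (- real DIM('a) / 2) * (\<integral>t. cmod (u t) \<partial>lborel)"
      show "integrable lborel (\<lambda>x. of_real ?B * v x)" using that by auto
      show "AE x in lborel. norm (fourier_integral u x * v x) \<le> norm (of_real ?B * v x)"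
        using norm_fourier_integral_le[OF that(1)]
        by (auto simp: norm_mult intro!: mult_right_mono intro: order_trans[OF _ abs_ge_self])
    qed measurable
  qed
  show ?thesis
    unfolding eqs
    using fourier_integral_multiplication[OF int]
      *[OF _ _ fourier_integral_L2_bound(1)[OF int(1) sq(1)] sq(2) int_prod[OF int]]
      *[OF _ _ sq(1) fourier_integral_L2_bound(1)[OF int(2) sq(2)]] int_prod[OF int(2,1)]
    by (simp add: mult.commute)
qed

lemma inner_fourier_cnj: "fourier x \<bullet> cnj_L2 y = x \<bullet> cnj_L2 (fourier y)"
proof (rule LIMSEQ_unique)
  show "(\<lambda>n. abs_L2 (fourier_integral (truncation n x)) \<bullet> cnj_L2 (abs_L2 (truncation n y)))
      \<longlonglongrightarrow> fourier x \<bullet> cnj_L2 y"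
    by (intro tendsto_intros tendsto_cnj_L2 fourier_tendsto abs_truncation_tendsto)
  show "(\<lambda>n. abs_L2 (fourier_integral (truncation n x)) \<bullet> cnj_L2 (abs_L2 (truncation n y)))
      \<longlonglongrightarrow> x \<bullet> cnj_L2 (fourier y)"
    by (subst inner_fourier_integral_cnj)
       (auto intro!: tendsto_intros tendsto_cnj_L2 fourier_tendsto abs_truncation_tendsto)
qed

text \<open>An isometry whose adjoint is an isometry as well is unitary.\<close>

theorem bij_fourier: "bij (fourier :: 'a::euclidean_space L2 \<Rightarrow> 'a L2)"
proof (rule bijI)
  show "inj (fourier :: 'a L2 \<Rightarrow> 'a L2)"
  proof (rule injI)
    fix x y :: "'a L2"
    assume "fourier x = fourier y"
    then have "norm (fourier x - fourier y) = 0" by (simp only: diff_self norm_zero)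
    then show "x = y" by (simp only: norm_fourier_diff norm_eq_zero right_minus_eq)
  qed
  show "surj (fourier :: 'a L2 \<Rightarrow> 'a L2)"
  proof (rule surjI)
    fix y :: "'a L2"
    \<comment> \<open>\<open>u\<close> is the adjoint of \<open>fourier\<close> applied to
      \<open>y\<close>. The adjoint relation gives
      \<open>fourier u \<bullet> y = (norm u)\<^sup>2\<close>, and all three terms in the expansion
      of the squared distance from \<open>fourier u\<close> to \<open>y\<close> reduce to
      \<open>(norm y)\<^sup>2\<close>.\<close>
    define u where "u = cnj_L2 (fourier (cnj_L2 y))"
    have "fourier u \<bullet> y = (norm y)\<^sup>2"
      using inner_fourier_cnj[of u "cnj_L2 y"] by (simp add: u_def flip: power2_norm_eq_inner)
    moreover have "(norm (fourier u))\<^sup>2 = (norm y)\<^sup>2" by (simp add: u_def)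
    moreover have "(norm (v - y))\<^sup>2 = (norm v)\<^sup>2 - 2 * (v \<bullet> y) + (norm y)\<^sup>2" for v
      by (simp add: power2_norm_eq_inner inner_diff inner_commute)
    ultimately have "(norm (fourier u - y))\<^sup>2 = 0" by simp
    then show "fourier (cnj_L2 (fourier (cnj_L2 y))) = y" by (simp add: u_def)
  qed
qed

lemma fourier_inverse_fourier [simp]: "fourier (inverse_fourier x) = x"
  by (meson bij_fourier bij_inv_eq_iff)

lemma norm_inverse_fourier [simp]: "norm (inverse_fourier x) = norm x"
  using norm_fourier[of "inverse_fourier x"] by simp

lemma inverse_fourier_0 [simp]: "inverse_fourier 0 = 0"
  using norm_inverse_fourier[of 0] by (simp del: norm_inverse_fourier)

section \<open>Convexity and moduli of powers\<close>

text \<open>Jensen's inequality for \<open>exp\<close> at the points \<open>ln (x j)\<close>. If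
  some \<open>x j\<close> vanishes, so does the product, even for \<open>\<theta> j = 0\<close>,
  because \<open>0 powr 0 = 0\<close>.\<close>

lemma weighted_arith_geo_mean:
  fixes x \<theta> :: "'i \<Rightarrow> real"
  assumes "finite J" and \<theta>: "\<And>j. j \<in> J \<Longrightarrow> 0 \<le> \<theta> j" "sum \<theta> J = 1" and x: "\<And>j. j \<in> J \<Longrightarrow> 0 \<le> x j"
  shows "(\<Prod>j\<in>J. x j powr \<theta> j) \<le> (\<Sum>j\<in>J. \<theta> j * x j)"
proof (cases "\<exists>j\<in>J. x j = 0")
  case True
  then have "(\<Prod>j\<in>J. x j powr \<theta> j) = 0" using \<open>finite J\<close> by (auto intro!: prod_zero)
  then show ?thesis using \<theta> x by (simp add: sum_nonneg)
next
  case False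
  with x have pos: "0 < x j" if "j \<in> J" for j using that by (force simp: less_le)
  have "J \<noteq> {}" using \<theta>(2) by auto
  have "(\<Prod>j\<in>J. x j powr \<theta> j) = exp (\<Sum>j\<in>J. \<theta> j *\<^sub>R ln (x j))"
    using pos \<open>finite J\<close> by (simp add: exp_sum powr_def less_imp_neq[symmetric])
  also have "\<dots> \<le> (\<Sum>j\<in>J. \<theta> j * exp (ln (x j)))"
    by (rule convex_on_sum[OF \<open>finite J\<close> \<open>J \<noteq> {}\<close> exp_convex]) (use \<theta> in auto)
  also have "\<dots> = (\<Sum>j\<in>J. \<theta> j * x j)" using pos by (intro sum.cong) auto
  finally show ?thesis .
qed

text \<open>Weights on the image must be pulled back to indices. Since \<open>g\<close> may identify
  indices, one representative is kept for each value; discarding zero weights then makes the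
  remaining ones strictly positive.\<close>

lemma convex_hull_image_representation:
  fixes g :: "'i \<Rightarrow> 'v::real_vector"
  assumes "finite A" and p: "p \<in> convex hull (g ` A)"
  shows "\<exists>J \<theta>. J \<subseteq> A \<and> (\<forall>j\<in>J. 0 < \<theta> j) \<and> sum \<theta> J = (1::real) \<and> p = (\<Sum>j\<in>J. \<theta> j *\<^sub>R g j)"
proof -
  obtain u where u: "\<And>v. v \<in> g ` A \<Longrightarrow> 0 \<le> u v" "sum u (g ` A) = 1" "(\<Sum>v\<in>g ` A. u v *\<^sub>R v) = p"
    using p \<open>finite A\<close> by (auto simp: convex_hull_finite)
  obtain J0 where J0: "J0 \<subseteq> A" "inj_on g J0" "g ` A = g ` J0"
    by (metis subset_image_inj subset_refl)
  have fin: "finite J0" using J0(1) \<open>finite A\<close> by (rule finite_subset)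
  define J where "J = {j \<in> J0. 0 < u (g j)}"
  have zero: "u (g j) = 0" if "j \<in> J0 - J" for j
    using that u(1)[of "g j"] J0 by (force simp: J_def)
  show ?thesis
  proof (intro exI conjI ballI)
    show "J \<subseteq> A" using J0 by (auto simp: J_def)
    show "0 < u (g j)" if "j \<in> J" for j using that by (simp add: J_def)
    have "(\<Sum>j\<in>J. u (g j)) = (\<Sum>j\<in>J0. u (g j))"
      by (rule sum.mono_neutral_left[OF fin]) (use zero in \<open>auto simp: J_def\<close>)
    also have "\<dots> = 1" using u(2) J0 by (simp add: sum.reindex)
    finally show "(\<Sum>j\<in>J. u (g j)) = 1" .
    have "(\<Sum>j\<in>J. u (g j) *\<^sub>R g j) = (\<Sum>j\<in>J0. u (g j) *\<^sub>R g j)"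
      by (rule sum.mono_neutral_left[OF fin]) (use zero in \<open>auto simp: J_def\<close>)
    also have "\<dots> = p" using u(3) J0 by (simp add: sum.reindex)
    finally show "p = (\<Sum>j\<in>J. u (g j) *\<^sub>R g j)" by simp
  qed
qed

text \<open>Once a point is moved to the origin, the differences are linearly independent and the
  prescribed values extend to a linear functional. Its representing vector is the value of the
  adjoint at 1.\<close>

lemma affine_interpolation:
  fixes P :: "'v::euclidean_space set" and F :: "'v \<Rightarrow> real"
  assumes ind: "\<not> affine_dependent P"
  obtains \<eta> a where "\<And>p. p \<in> P \<Longrightarrow> F p = p \<bullet> \<eta> + a"
proof (cases "P = {}")
  case True
  then show ?thesis using that by auto
next
  case False
  then obtain p0 where p0: "p0 \<in> P" by auto
  have "independent ((\<lambda>x. - p0 + x) ` (P - {p0}))"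
    using ind affine_dependent_iff_dependent2[OF p0] by simp
  from linear_independent_extend[OF this, of "\<lambda>v. F (p0 + v) - F p0"] obtain g
    where g: "linear g" "\<And>v. v \<in> (\<lambda>x. - p0 + x) ` (P - {p0}) \<Longrightarrow> g v = F (p0 + v) - F p0"
    by blast
  have gi: "g x = x \<bullet> adjoint g 1" for x
    using adjoint_works[OF g(1), of x 1] by simp
  show ?thesis
  proof (rule that[of "adjoint g 1" "F p0 - p0 \<bullet> adjoint g 1"])
    fix p assume "p \<in> P"
    show "F p = p \<bullet> adjoint g 1 + (F p0 - p0 \<bullet> adjoint g 1)"
    proof (cases "p = p0")
      case False
      with \<open>p \<in> P\<close> have "g (- p0 + p) = F p - F p0" by (subst g(2)) auto
      then show ?thesis using gi[of "- p0 + p"] by (simp add: inner_simps)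
    qed simp
  qed
qed

text \<open>The slice of the compact hull above \<open>\<beta>\<close> is compact, so the
  \<open>GREATEST\<close> in \<open>S_fun\<close> is attained.\<close>

lemma S_fun_maximum:
  assumes "(\<beta>, z) \<in> exponent_hull \<alpha> \<delta> N"
  obtains s where "S_fun \<alpha> \<delta> N \<beta> = ereal s" "(\<beta>, s) \<in> exponent_hull \<alpha> \<delta> N"
    "\<And>z. (\<beta>, z) \<in> exponent_hull \<alpha> \<delta> N \<Longrightarrow> z \<le> s"
proof -
  have cpt: "compact (exponent_hull \<alpha> \<delta> N)"
    unfolding exponent_hull_def by (intro finite_imp_compact_convex_hull) auto
  have "{z. (\<beta>, z) \<in> exponent_hull \<alpha> \<delta> N} = snd ` (exponent_hull \<alpha> \<delta> N \<inter> (fst -` {\<beta>}))"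
    by force
  moreover have "compact (snd ` (exponent_hull \<alpha> \<delta> N \<inter> (fst -` {\<beta>})))"
    by (intro compact_continuous_image compact_Int_closed cpt closed_vimage continuous_intros)
  ultimately have "compact {z. (\<beta>, z) \<in> exponent_hull \<alpha> \<delta> N}" by simp
  from compact_attains_sup[OF this] assms obtain s
    where s: "(\<beta>, s) \<in> exponent_hull \<alpha> \<delta> N" "\<And>z. (\<beta>, z) \<in> exponent_hull \<alpha> \<delta> N \<Longrightarrow> z \<le> s"
    by auto
  then have "(GREATEST z. (\<beta>, z) \<in> exponent_hull \<alpha> \<delta> N) = s"
    by (intro Greatest_equality) auto
  with assms have "S_fun \<alpha> \<delta> N \<beta> = ereal s" by (auto simp: S_fun_def)
  then show ?thesis using s that by blast
qed

lemma point_in_exponent_hull: "j \<in> {1..N} \<Longrightarrow> (\<alpha> j, ln (1 / \<delta> j)) \<in> exponent_hull \<alpha> \<delta> N"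
  unfolding exponent_hull_def by (rule hull_inc) auto

lemma support_hyperplane_above:
  assumes "support_hyperplane \<alpha> \<delta> N \<eta> a" "j \<in> {1..N}"
  shows "ln (1 / \<delta> j) \<le> \<alpha> j \<bullet> \<eta> + a"
proof -
  obtain s where s: "S_fun \<alpha> \<delta> N (\<alpha> j) = ereal s" "ln (1 / \<delta> j) \<le> s"
    using S_fun_maximum[OF point_in_exponent_hull[OF assms(2)]] point_in_exponent_hull[OF assms(2)] by metis
  moreover have "S_fun \<alpha> \<delta> N (\<alpha> j) \<le> ereal (\<alpha> j \<bullet> \<eta> + a)"
    using assms(1) unfolding support_hyperplane_def by blast
  ultimately show ?thesis by simp
qed

text \<open>Strict separation of a point above the graph of \<open>S\<close> from the hull; the separating
  hyperplane is not vertical because a point of the hull lies directly below.\<close>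

lemma approximate_support_hyperplane:
  fixes \<alpha> :: "nat \<Rightarrow> real ^ 'k::finite"
  assumes s: "(\<beta>, s) \<in> exponent_hull \<alpha> \<delta> N" "\<And>z. (\<beta>, z) \<in> exponent_hull \<alpha> \<delta> N \<Longrightarrow> z \<le> s" and "0 < e"
  obtains \<eta> a where "\<And>j. j \<in> {1..N} \<Longrightarrow> ln (1 / \<delta> j) \<le> \<alpha> j \<bullet> \<eta> + a" "\<beta> \<bullet> \<eta> + a \<le> s + e"
proof -
  let ?Q = "exponent_hull \<alpha> \<delta> N"
  have "compact ?Q" unfolding exponent_hull_def by (intro finite_imp_compact_convex_hull) auto
  then have "closed ?Q" by (rule compact_imp_closed)
  have "convex ?Q" unfolding exponent_hull_def by (rule convex_convex_hull)
  have "(\<beta>, s + e) \<notin> ?Q" using s(2)[of "s + e"] \<open>0 < e\<close> by auto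
  from separating_hyperplane_closed_point[OF \<open>convex ?Q\<close> \<open>closed ?Q\<close> this]
  obtain p b where p: "p \<bullet> (\<beta>, s + e) < b" "\<And>q. q \<in> ?Q \<Longrightarrow> b < p \<bullet> q"
    by blast
  obtain v c where vc: "p = (v, c)" by (cases p)
  have 1: "v \<bullet> \<beta> + c * (s + e) < b" using p(1) by (simp add: vc inner_Pair)
  have 2: "b < v \<bullet> \<beta> + c * s" using p(2)[OF s(1)] by (simp add: vc inner_Pair)
  have "c < 0"
  proof (rule ccontr)
    assume "\<not> c < 0"
    then have "0 \<le> c * e" using \<open>0 < e\<close> by simp
    with 1 2 show False by (simp add: algebra_simps)
  qed
  \<comment> \<open>The separating hyperplane \<open>v \<bullet> \<beta> + c * z = b\<close> is
    solved for \<open>z\<close>; dividing by the negative \<open>c\<close> reverses the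
    inequalities.\<close>
  show ?thesis
  proof (rule that[of "(- 1 / c) *\<^sub>R v" "b / c"])
    fix j assume "j \<in> {1..N}"
    then have "b < v \<bullet> \<alpha> j + c * ln (1 / \<delta> j)"
      using p(2)[OF point_in_exponent_hull] by (simp add: vc inner_Pair)
    then show "ln (1 / \<delta> j) \<le> \<alpha> j \<bullet> ((- 1 / c) *\<^sub>R v) + b / c"
      using \<open>c < 0\<close> by (simp add: field_simps inner_commute)
  next
    show "\<beta> \<bullet> ((- 1 / c) *\<^sub>R v) + b / c \<le> s + e"
      using 1 \<open>c < 0\<close> by (simp add: field_simps inner_commute)
  qed
qed

section \<open>Moduli and measurability of the powers\<close>

lemma norm_multi_power:
  "cmod (multi_power \<phi> arg \<beta> \<xi>) = (\<Prod>i\<in>UNIV. if \<beta> $ i = 0 then 1 else cmod (\<phi> i \<xi>) powr (\<beta> $ i))"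
  unfolding multi_power_def prod_norm[symmetric] by (intro prod.cong) auto

lemma borel_measurable_multi_power:
  assumes "\<And>i. continuous_on UNIV (\<phi> i)" "is_branch \<phi> arg"
  shows "multi_power \<phi> arg \<beta> \<in> borel_measurable lebesgue"
proof -
  have [measurable]: "\<phi> i \<in> borel_measurable lebesgue" for i
    using borel_measurable_continuous_onI[OF assms(1)] by (auto intro: measurable_completion)
  have [measurable]: "arg i \<in> borel_measurable lebesgue" for i
    using assms(2) by (simp add: is_branch_def)
  have "(\<lambda>\<xi>. if \<beta> $ i = 0 then 1 else rcis (cmod (\<phi> i \<xi>) powr (\<beta> $ i)) (\<beta> $ i * arg i \<xi>)) \<in> borel_measurable lebesgue" for i
    by (cases "\<beta> $ i = 0") (auto simp: rcis_def)
  then show ?thesis unfolding multi_power_def[abs_def] by (rule borel_measurable_prod)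
qed

text \<open>The powers themselves may jump with the branch; their moduli do not. At zeros of
  \<open>\<phi> i\<close> this relies on the exponents being nonnegative.\<close>

lemma continuous_on_norm_multi_power:
  assumes "\<And>i. continuous_on UNIV (\<phi> i)" "\<And>i. 0 \<le> \<beta> $ i"
  shows "continuous_on UNIV (\<lambda>\<xi>. cmod (multi_power \<phi> arg \<beta> \<xi>))"
proof -
  have "continuous_on UNIV (\<lambda>\<xi>. if \<beta> $ i = 0 then 1 else cmod (\<phi> i \<xi>) powr (\<beta> $ i))" for i
    using assms(2)[of i]
    by (cases "\<beta> $ i = 0") (auto intro!: continuous_on_powr' continuous_on_norm continuous_on_const assms(1))
  then show ?thesis unfolding norm_multi_power by (intro continuous_on_prod)
qed

text \<open>At such a point the logarithm of the modulus is linear in the exponent. This is the link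
  between the support hyperplanes and points of the frequency space.\<close>

lemma norm_multi_power_exp:
  assumes "\<And>i. cmod (\<phi> i \<xi>) = exp (- (\<eta> $ i))"
  shows "cmod (multi_power \<phi> arg \<beta> \<xi>) = exp (- (\<beta> \<bullet> \<eta>))"
proof -
  have "cmod (multi_power \<phi> arg \<beta> \<xi>) = (\<Prod>i\<in>UNIV. exp (- (\<beta> $ i * \<eta> $ i)))"
    unfolding norm_multi_power by (intro prod.cong) (auto simp: assms powr_def)
  then show ?thesis by (simp add: exp_sum inner_vec_def flip: sum_negf)
qed

text \<open>The delicate case is a zero of \<open>\<phi> i\<close>. By positivity of the weights,
  component \<open>i\<close> of the combination vanishes only if all the
  \<open>\<alpha> j $ i\<close> do; then every factor is 1, and otherwise both sides contain the
  factor 0.\<close>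

lemma norm_multi_power_convex_combination:
  fixes \<alpha> :: "nat \<Rightarrow> real ^ 'k::finite"
  assumes "finite J" and \<theta>: "\<And>j. j \<in> J \<Longrightarrow> 0 < \<theta> j" and nonneg: "\<And>j i. j \<in> J \<Longrightarrow> 0 \<le> \<alpha> j $ i"
  shows "cmod (multi_power \<phi> arg (\<Sum>j\<in>J. \<theta> j *\<^sub>R \<alpha> j) \<xi>) = (\<Prod>j\<in>J. cmod (multi_power \<phi> arg (\<alpha> j) \<xi>) powr \<theta> j)"
proof -
  let ?p = "\<lambda>(b::real) i. if b = 0 then 1 else cmod (\<phi> i \<xi>) powr b"
  have *: "?p (\<Sum>j\<in>J. \<theta> j * \<alpha> j $ i) i = (\<Prod>j\<in>J. ?p (\<alpha> j $ i) i powr \<theta> j)" for i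
  proof (cases "\<forall>j\<in>J. \<alpha> j $ i = 0")
    case True
    then show ?thesis by simp
  next
    case False
    then obtain j where j: "j \<in> J" "\<alpha> j $ i \<noteq> 0" by auto
    then have "0 < \<theta> j * \<alpha> j $ i" using \<theta> nonneg[of j i] by (simp add: less_le)
    then have pos: "(\<Sum>j\<in>J. \<theta> j * \<alpha> j $ i) > 0"
      using j \<theta> nonneg \<open>finite J\<close> by (intro sum_pos2[of J j]) (auto intro!: mult_nonneg_nonneg simp: less_imp_le)
    show ?thesis
    proof (cases "\<phi> i \<xi> = 0")
      case True
      then have "(\<Prod>j\<in>J. ?p (\<alpha> j $ i) i powr \<theta> j) = 0"
        using j \<open>finite J\<close> by (auto intro!: prod_zero)
      then show ?thesis using True pos by simp
    next
      case False
      have "?p (\<Sum>j\<in>J. \<theta> j * \<alpha> j $ i) i = (\<Prod>j\<in>J. cmod (\<phi> i \<xi>) powr (\<theta> j * \<alpha> j $ i))"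
        using pos False \<open>finite J\<close> by (simp add: powr_sum)
      also have "\<dots> = (\<Prod>j\<in>J. ?p (\<alpha> j $ i) i powr \<theta> j)"
        using False by (intro prod.cong) (auto simp: powr_powr mult.commute)
      finally show ?thesis .
    qed
  qed
  have comp: "(\<Sum>j\<in>J. \<theta> j *\<^sub>R \<alpha> j) $ i = (\<Sum>j\<in>J. \<theta> j * \<alpha> j $ i)" for i
    by (simp add: sum_component)
  have "cmod (multi_power \<phi> arg (\<Sum>j\<in>J. \<theta> j *\<^sub>R \<alpha> j) \<xi>) = (\<Prod>i\<in>UNIV. \<Prod>j\<in>J. ?p (\<alpha> j $ i) i powr \<theta> j)"
    by (simp only: norm_multi_power comp *)
  also have "\<dots> = (\<Prod>j\<in>J. \<Prod>i\<in>UNIV. ?p (\<alpha> j $ i) i powr \<theta> j)" by (rule prod.swap)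
  also have "\<dots> = (\<Prod>j\<in>J. cmod (multi_power \<phi> arg (\<alpha> j) \<xi>) powr \<theta> j)"
    unfolding norm_multi_power by (intro prod.cong prod_powr_distrib[symmetric]) auto
  finally show ?thesis .
qed

section \<open>Recovery from inaccurate data\<close>

lemma square_integrable_bounded_mult:
  assumes b: "b \<in> borel_measurable lebesgue" and bound: "AE \<xi> in lebesgue. (cmod (b \<xi>))\<^sup>2 \<le> B" and f: "square_integrable f"
  shows "square_integrable (\<lambda>\<xi>. b \<xi> * f \<xi>)"
proof -
  have f': "integrable lebesgue (\<lambda>\<xi>. (cmod (f \<xi>))\<^sup>2)" and [measurable]: "f \<in> borel_measurable lebesgue"
    using f by (auto simp: square_integrable_def)
  note b [measurable]
  have "integrable lebesgue (\<lambda>\<xi>. (cmod (b \<xi> * f \<xi>))\<^sup>2)"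
  proof (rule Bochner_Integration.integrable_bound[OF integrable_mult_right[OF f', of B]])
    show "AE \<xi> in lebesgue. norm ((cmod (b \<xi> * f \<xi>))\<^sup>2) \<le> norm (B * (cmod (f \<xi>))\<^sup>2)"
      using bound
    proof eventually_elim
      case (elim \<xi>)
      from mult_right_mono[OF this zero_le_power2[of "cmod (f \<xi>)"]]
      show ?case by (simp add: norm_mult power_mult_distrib)
    qed
  qed measurable
  then show ?thesis by (simp add: square_integrable_def)
qed

text \<open>Each product is split by the factor \<open>\<delta> j / sqrt (\<theta> j)\<close> and
  its inverse. The first sum is the quantity restricted in the theorem; the second integrates to at
  most the sum of the weights when each \<open>z j\<close> has norm at most
  \<open>\<delta> j\<close>.\<close>

lemma weighted_Cauchy_Schwarz:
  fixes b z :: "'i \<Rightarrow> complex"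
  assumes "\<And>j. j \<in> J \<Longrightarrow> 0 < \<theta> j" "\<And>j. j \<in> J \<Longrightarrow> 0 < \<delta> j"
  shows "(cmod (\<Sum>j\<in>J. b j * z j))\<^sup>2 \<le>
    (\<Sum>j\<in>J. (\<delta> j)\<^sup>2 * (cmod (b j))\<^sup>2 / \<theta> j) * (\<Sum>j\<in>J. \<theta> j / (\<delta> j)\<^sup>2 * (cmod (z j))\<^sup>2)"
proof -
  have "cmod (\<Sum>j\<in>J. b j * z j) \<le> (\<Sum>j\<in>J. (\<delta> j * cmod (b j) / sqrt (\<theta> j)) * (sqrt (\<theta> j) / \<delta> j * cmod (z j)))"
    by (rule order_trans[OF norm_sum], rule sum_mono)
       (use assms in \<open>auto simp: norm_mult less_imp_neq[symmetric]\<close>)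
  then have "(cmod (\<Sum>j\<in>J. b j * z j))\<^sup>2 \<le>
      (\<Sum>j\<in>J. (\<delta> j * cmod (b j) / sqrt (\<theta> j)) * (sqrt (\<theta> j) / \<delta> j * cmod (z j)))\<^sup>2"
    by (intro power_mono) auto
  also have "\<dots> \<le> (\<Sum>j\<in>J. (\<delta> j * cmod (b j) / sqrt (\<theta> j))\<^sup>2) * (\<Sum>j\<in>J. (sqrt (\<theta> j) / \<delta> j * cmod (z j))\<^sup>2)"
    by (rule Cauchy_Schwarz_ineq_sum)
  also have "\<dots> = (\<Sum>j\<in>J. (\<delta> j)\<^sup>2 * (cmod (b j))\<^sup>2 / \<theta> j) * (\<Sum>j\<in>J. \<theta> j / (\<delta> j)\<^sup>2 * (cmod (z j))\<^sup>2)"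
    using assms by (intro arg_cong2[of _ _ _ _ "(*)"] sum.cong) (auto simp: power_mult_distrib power_divide less_imp_le)
  finally show ?thesis .
qed

text \<open>The error bounds \<open>\<delta>\<close> are not fixed here, so that the norms of an
  element \<open>x0\<close> can take their place in the exactness claims.\<close>

locale fourier_multipliers =
  fixes \<phi> :: "'k::finite \<Rightarrow> 'a::euclidean_space \<Rightarrow> complex"
    and arg :: "'k \<Rightarrow> 'a \<Rightarrow> real"
    and \<alpha> :: "nat \<Rightarrow> real ^ 'k"
    and N :: nat
  assumes continuous: "\<And>i. continuous_on UNIV (\<phi> i)"
    and moduli: "\<And>r :: 'k \<Rightarrow> real. (\<forall>i. 0 < r i) \<Longrightarrow> \<exists>\<xi>. \<forall>i. cmod (\<phi> i \<xi>) = r i"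
    and branch: "is_branch \<phi> arg"
    and nonneg: "\<And>j i. j \<in> {1..N} \<Longrightarrow> 0 \<le> \<alpha> j $ i"
    and hull: "\<alpha> 0 \<in> convex hull (\<alpha> ` {1..N})"
begin

abbreviation "pw j \<equiv> multi_power \<phi> arg (\<alpha> j)"
abbreviation "X \<equiv> multiplier_space \<phi> arg \<alpha> N"
abbreviation "\<Lambda> \<equiv> multiplier_op \<phi> arg \<alpha>"

definition symbol :: "nat \<Rightarrow> 'a L2 \<Rightarrow> 'a \<Rightarrow> complex" where
  "symbol j x \<xi> = pw j \<xi> * rep_L2 (fourier x) \<xi>"

text \<open>Independent of \<open>\<delta>\<close> and of any hyperplane: the upper bounds hold for
  every such representation of \<open>\<alpha> 0\<close>, and a hyperplane only decides which
  representation yields \<open>S\<close>.\<close>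

definition convex_weights :: "nat set \<Rightarrow> (nat \<Rightarrow> real) \<Rightarrow> bool" where
  "convex_weights J \<theta> \<longleftrightarrow> J \<subseteq> {1..N} \<and> (\<forall>j\<in>J. 0 < \<theta> j) \<and> sum \<theta> J = 1 \<and> \<alpha> 0 = (\<Sum>j\<in>J. \<theta> j *\<^sub>R \<alpha> j)"

lemma convex_weightsD:
  assumes "convex_weights J \<theta>"
  shows "J \<subseteq> {1..N}" "finite J" "\<And>j. j \<in> J \<Longrightarrow> 0 < \<theta> j" "sum \<theta> J = 1" "J \<noteq> {}"
    "\<alpha> 0 = (\<Sum>j\<in>J. \<theta> j *\<^sub>R \<alpha> j)"
  using assms by (auto simp: convex_weights_def intro: finite_subset)

lemma obtain_convex_weights:
  obtains J \<theta> where "convex_weights J \<theta>"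
  using convex_hull_image_representation[OF finite_atLeastAtMost hull] unfolding convex_weights_def by auto

lemma mem_multiplier_space_iff: "x \<in> X \<longleftrightarrow> (\<forall>j\<in>{1..N}. square_integrable (symbol j x))"
  by (simp add: multiplier_space_def symbol_def[abs_def])

lemma measurable_pw [measurable]: "pw j \<in> borel_measurable lebesgue"
  by (rule borel_measurable_multi_power[OF continuous branch])

lemma measurable_symbol [measurable]: "symbol j x \<in> borel_measurable lebesgue"
proof -
  have [measurable]: "rep_L2 y \<in> borel_measurable lebesgue" for y :: "'a L2"
    using square_integrable_rep_L2[of y] by (simp add: square_integrable_def)
  show ?thesis unfolding symbol_def[abs_def] by measurable
qed

lemma nonneg_0: "0 \<le> \<alpha> 0 $ i"
proof -
  obtain J \<theta> where J: "convex_weights J \<theta>" by (rule obtain_convex_weights)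
  note c = convex_weightsD[OF J]
  have "\<alpha> 0 $ i = (\<Sum>j\<in>J. \<theta> j * \<alpha> j $ i)" by (subst c(6)) (simp add: sum_component)
  also have "\<dots> \<ge> 0"
    using c(1,3) nonneg by (intro sum_nonneg mult_nonneg_nonneg) (auto simp: less_imp_le)
  finally show ?thesis .
qed

lemma norm_pw_0:
  assumes "convex_weights J \<theta>"
  shows "cmod (pw 0 \<xi>) = (\<Prod>j\<in>J. cmod (pw j \<xi>) powr \<theta> j)"
proof -
  note c = convex_weightsD[OF assms]
  show ?thesis unfolding c(6)
    by (rule norm_multi_power_convex_combination) (use c(1-3) nonneg in auto)
qed

text \<open>The weighted inequality of means for the squared ratios
  \<open>cmod (pw j \<xi>) / \<delta> j\<close>. It turns a product of powers into a sum, which can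
  be integrated.\<close>

lemma norm_pw_0_le:
  assumes J: "convex_weights J \<theta>" and \<delta>: "\<And>j. j \<in> J \<Longrightarrow> 0 < \<delta> j"
  shows "(cmod (pw 0 \<xi>))\<^sup>2 \<le>
    (\<Prod>j\<in>J. \<delta> j powr \<theta> j)\<^sup>2 * (\<Sum>j\<in>J. \<theta> j * ((cmod (pw j \<xi>))\<^sup>2 / (\<delta> j)\<^sup>2))"
proof -
  note c = convex_weightsD[OF J]
  have eq: "(cmod (pw j \<xi>) powr \<theta> j)\<^sup>2 = (\<delta> j powr \<theta> j)\<^sup>2 * ((cmod (pw j \<xi>))\<^sup>2 / (\<delta> j)\<^sup>2) powr \<theta> j"
    if "j \<in> J" for j
  proof -
    have "((cmod (pw j \<xi>))\<^sup>2 / (\<delta> j)\<^sup>2) powr \<theta> j = (cmod (pw j \<xi>) / \<delta> j * (cmod (pw j \<xi>) / \<delta> j)) powr \<theta> j"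
      by (simp add: power2_eq_square)
    also have "\<dots> = ((cmod (pw j \<xi>) / \<delta> j) powr \<theta> j)\<^sup>2"
      unfolding power2_eq_square using \<delta>[OF that] by (intro powr_mult)
    also have "\<dots> = (cmod (pw j \<xi>) powr \<theta> j / \<delta> j powr \<theta> j)\<^sup>2"
      using \<delta>[OF that] by (simp add: powr_divide)
    finally show ?thesis using \<delta>[OF that] by (simp add: power_divide)
  qed
  have "(cmod (pw 0 \<xi>))\<^sup>2 = (\<Prod>j\<in>J. (cmod (pw j \<xi>) powr \<theta> j)\<^sup>2)"
    by (simp add: norm_pw_0[OF J] prod_power_distrib)
  also have "\<dots> = (\<Prod>j\<in>J. \<delta> j powr \<theta> j)\<^sup>2 * (\<Prod>j\<in>J. ((cmod (pw j \<xi>))\<^sup>2 / (\<delta> j)\<^sup>2) powr \<theta> j)"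
    by (simp add: eq prod.distrib prod_power_distrib)
  also have "(\<Prod>j\<in>J. ((cmod (pw j \<xi>))\<^sup>2 / (\<delta> j)\<^sup>2) powr \<theta> j) \<le> (\<Sum>j\<in>J. \<theta> j * ((cmod (pw j \<xi>))\<^sup>2 / (\<delta> j)\<^sup>2))"
    using c by (intro weighted_arith_geo_mean) (auto intro: less_imp_le)
  finally show ?thesis by (simp add: mult_left_mono)
qed

text \<open>For index 0 nothing is demanded in the definition of the space. There the pointwise
  bound with all levels equal to 1 dominates the symbol, so \<open>\<Lambda> 0\<close> is meaningful
  on \<open>X\<close>.\<close>

lemma square_integrable_symbol:
  assumes x: "x \<in> X" and j: "j \<in> {0..N}"
  shows "square_integrable (symbol j x)"
proof (cases "j = 0")
  case False
  then have "j \<in> {1..N}" using j by auto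
  then show ?thesis using x by (simp add: multiplier_space_def symbol_def[abs_def])
next
  case True
  obtain J \<theta> where J: "convex_weights J \<theta>" by (rule obtain_convex_weights)
  note c = convex_weightsD[OF J]
  have "integrable lebesgue (\<lambda>\<xi>. (cmod (symbol i x \<xi>))\<^sup>2)" if "i \<in> J" for i
    using x c(1) that unfolding multiplier_space_def symbol_def square_integrable_def by blast
  then have "integrable lebesgue (\<lambda>\<xi>. \<Sum>i\<in>J. \<theta> i * (cmod (symbol i x \<xi>))\<^sup>2)"
    by (intro Bochner_Integration.integrable_sum integrable_mult_right) auto
  then have "integrable lebesgue (\<lambda>\<xi>. (cmod (symbol 0 x \<xi>))\<^sup>2)"
  proof (rule Bochner_Integration.integrable_bound)
    show "AE \<xi> in lebesgue. norm ((cmod (symbol 0 x \<xi>))\<^sup>2) \<le> norm (\<Sum>i\<in>J. \<theta> i * (cmod (symbol i x \<xi>))\<^sup>2)"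
    proof (rule AE_I2)
      fix \<xi>
      have "(cmod (pw 0 \<xi>))\<^sup>2 \<le> (\<Sum>j\<in>J. \<theta> j * (cmod (pw j \<xi>))\<^sup>2)"
        using norm_pw_0_le[OF J, of "\<lambda>_. 1" \<xi>] by simp
      from mult_right_mono[OF this zero_le_power2[of "cmod (rep_L2 (fourier x) \<xi>)"]]
      have "(cmod (symbol 0 x \<xi>))\<^sup>2 \<le> (\<Sum>i\<in>J. \<theta> i * (cmod (symbol i x \<xi>))\<^sup>2)"
        by (simp add: symbol_def norm_mult power_mult_distrib sum_distrib_right mult.assoc)
      then show "norm ((cmod (symbol 0 x \<xi>))\<^sup>2) \<le> norm (\<Sum>i\<in>J. \<theta> i * (cmod (symbol i x \<xi>))\<^sup>2)"
        by simp
    qed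
  qed measurable
  then show ?thesis using True by (simp add: square_integrable_def)
qed

lemma fourier_multiplier_op: "fourier (\<Lambda> j x) = abs_L2 (symbol j x)"
  by (simp add: multiplier_op_def symbol_def[abs_def])

lemma norm_multiplier_op:
  assumes "x \<in> X" "j \<in> {0..N}"
  shows "(norm (\<Lambda> j x))\<^sup>2 = (\<integral>\<xi>. (cmod (symbol j x \<xi>))\<^sup>2 \<partial>lebesgue)"
proof -
  have "norm (\<Lambda> j x) = sqrt (\<integral>\<xi>. (cmod (symbol j x \<xi>))\<^sup>2 \<partial>lebesgue)"
    unfolding norm_fourier[of "\<Lambda> j x", symmetric] fourier_multiplier_op
    by (rule norm_abs_L2[OF square_integrable_symbol[OF assms]])
  then show ?thesis by simp
qed

text \<open>Integrating the pointwise bound leaves a weighted mean of the squared ratios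
  \<open>norm (\<Lambda> j x) / \<delta> j\<close>, which is at most 1.\<close>

lemma norm_multiplier_op_0_le:
  assumes x: "x \<in> X" and J: "convex_weights J \<theta>" and \<delta>: "\<And>j. j \<in> J \<Longrightarrow> 0 < \<delta> j"
    and le: "\<And>j. j \<in> J \<Longrightarrow> norm (\<Lambda> j x) \<le> \<delta> j"
  shows "norm (\<Lambda> 0 x) \<le> (\<Prod>j\<in>J. \<delta> j powr \<theta> j)"
proof -
  note c = convex_weightsD[OF J]
  let ?P = "\<Prod>j\<in>J. \<delta> j powr \<theta> j"
  have int: "integrable lebesgue (\<lambda>\<xi>. (cmod (symbol i x \<xi>))\<^sup>2)" if "i \<in> {0..N}" for i
    using square_integrable_symbol[OF x that] by (simp add: square_integrable_def)
  have intJ: "integrable lebesgue (\<lambda>\<xi>. (cmod (symbol i x \<xi>))\<^sup>2)" if "i \<in> J" for i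
    using c(1) that by (intro int) auto
  have "(norm (\<Lambda> 0 x))\<^sup>2 = (\<integral>\<xi>. (cmod (symbol 0 x \<xi>))\<^sup>2 \<partial>lebesgue)"
    by (rule norm_multiplier_op[OF x]) simp
  also have "\<dots> \<le> (\<integral>\<xi>. ?P\<^sup>2 * (\<Sum>j\<in>J. (\<theta> j / (\<delta> j)\<^sup>2) * (cmod (symbol j x \<xi>))\<^sup>2) \<partial>lebesgue)"
  proof (rule integral_mono)
    show "integrable lebesgue (\<lambda>\<xi>. ?P\<^sup>2 * (\<Sum>j\<in>J. (\<theta> j / (\<delta> j)\<^sup>2) * (cmod (symbol j x \<xi>))\<^sup>2))"
      using intJ by (intro integrable_mult_right Bochner_Integration.integrable_sum) auto
    fix \<xi>
    have "(cmod (pw 0 \<xi>))\<^sup>2 \<le> ?P\<^sup>2 * (\<Sum>j\<in>J. \<theta> j * ((cmod (pw j \<xi>))\<^sup>2 / (\<delta> j)\<^sup>2))"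
      by (rule norm_pw_0_le[OF J \<delta>])
    from mult_right_mono[OF this zero_le_power2[of "cmod (rep_L2 (fourier x) \<xi>)"]]
    show "(cmod (symbol 0 x \<xi>))\<^sup>2 \<le> ?P\<^sup>2 * (\<Sum>j\<in>J. (\<theta> j / (\<delta> j)\<^sup>2) * (cmod (symbol j x \<xi>))\<^sup>2)"
      by (simp add: symbol_def norm_mult power_mult_distrib sum_distrib_right mult.assoc)
  qed (simp add: int)
  also have "\<dots> = ?P\<^sup>2 * (\<Sum>j\<in>J. (\<theta> j / (\<delta> j)\<^sup>2) * (norm (\<Lambda> j x))\<^sup>2)"
    using c(1) by (subst integral_mult_right_zero, subst Bochner_Integration.integral_sum)
      (auto simp: intJ norm_multiplier_op[OF x] subset_iff intro!: sum.cong)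
  also have "\<dots> \<le> ?P\<^sup>2 * (\<Sum>j\<in>J. \<theta> j)"
  proof (intro mult_left_mono sum_mono)
    fix j assume j: "j \<in> J"
    have "(norm (\<Lambda> j x))\<^sup>2 \<le> (\<delta> j)\<^sup>2" using le[OF j] by (intro power_mono) auto
    then have "(norm (\<Lambda> j x))\<^sup>2 / (\<delta> j)\<^sup>2 \<le> 1" using \<delta>[OF j] by (simp add: divide_le_eq)
    then show "\<theta> j / (\<delta> j)\<^sup>2 * (norm (\<Lambda> j x))\<^sup>2 \<le> \<theta> j"
      using mult_left_mono[of _ 1 "\<theta> j"] c(3)[OF j] by fastforce
  qed auto
  finally have "(norm (\<Lambda> 0 x))\<^sup>2 \<le> ?P\<^sup>2" by (simp add: c(4))
  then show ?thesis by (rule power2_le_imp_le) (auto intro: prod_nonneg)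
qed

text \<open>The bound for given levels needs positive ones, so \<open>norm (\<Lambda> j x)\<close>
  is raised by a null sequence. Positivity of \<open>\<theta> j\<close> makes the powers continuous
  at 0 in the limit.\<close>

lemma multiplicative_inequality:
  assumes x: "x \<in> X" and J: "convex_weights J \<theta>"
  shows "norm (\<Lambda> 0 x) \<le> (\<Prod>j\<in>J. norm (\<Lambda> j x) powr \<theta> j)"
proof (rule LIMSEQ_le_const)
  note c = convex_weightsD[OF J]
  let ?e = "\<lambda>n. 1 / real (Suc n)"
  have e: "?e \<longlonglongrightarrow> 0" by (rule LIMSEQ_Suc) (rule lim_1_over_n)
  show "(\<lambda>n. \<Prod>j\<in>J. (norm (\<Lambda> j x) + ?e n) powr \<theta> j) \<longlonglongrightarrow> (\<Prod>j\<in>J. norm (\<Lambda> j x) powr \<theta> j)"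
  proof (rule tendsto_prod)
    fix j assume "j \<in> J"
    have "(\<lambda>n. norm (\<Lambda> j x) + ?e n) \<longlonglongrightarrow> norm (\<Lambda> j x) + 0" by (intro tendsto_intros e)
    then show "(\<lambda>n. (norm (\<Lambda> j x) + ?e n) powr \<theta> j) \<longlonglongrightarrow> norm (\<Lambda> j x) powr \<theta> j"
      using c(3)[OF \<open>j \<in> J\<close>] by (intro tendsto_powr') (auto intro!: always_eventually)
  qed
  show "\<exists>n0. \<forall>n\<ge>n0. norm (\<Lambda> 0 x) \<le> (\<Prod>j\<in>J. (norm (\<Lambda> j x) + ?e n) powr \<theta> j)"
    by (intro exI allI impI norm_multiplier_op_0_le[OF x J]) (auto intro: add_nonneg_pos)
qed

text \<open>Let \<open>z j\<close> be the data error for indices in \<open>M\<close> and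
  \<open>\<Lambda> j x\<close> itself otherwise; all have norm at most \<open>\<delta> j\<close>.
  The first condition on \<open>b\<close> makes the transform of the recovery error equal to the sum
  of the \<open>b j\<close> times the transforms of the \<open>z j\<close>; the second makes the
  Cauchy-Schwarz inequality yield \<open>C\<close>.\<close>

lemma recovery_bound:
  assumes J: "convex_weights J \<theta>" and \<delta>: "\<And>j. j \<in> J \<Longrightarrow> 0 < \<delta> j" and "0 \<le> C"
    and b: "\<And>j. j \<in> J \<Longrightarrow> b j \<in> borel_measurable lebesgue"
    and AE: "AE \<xi> in lebesgue. (\<Sum>j\<in>J. pw j \<xi> * b j \<xi>) = pw 0 \<xi> \<and>
      (\<Sum>j\<in>J. (\<delta> j)\<^sup>2 * (cmod (b j \<xi>))\<^sup>2 / \<theta> j) \<le> C\<^sup>2"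
    and x: "x \<in> X" and "M \<subseteq> J"
    and in_M: "\<And>j. j \<in> M \<Longrightarrow> norm (\<Lambda> j x - y j) \<le> \<delta> j"
    and out_M: "\<And>j. j \<in> J - M \<Longrightarrow> norm (\<Lambda> j x) \<le> \<delta> j"
  shows "norm (\<Lambda> 0 x - inverse_fourier (abs_L2 (\<lambda>\<xi>. \<Sum>j\<in>M. b j \<xi> * rep_L2 (fourier (y j)) \<xi>))) \<le> C"
proof -
  note c = convex_weightsD[OF J]
  define z where "z j = (if j \<in> M then \<Lambda> j x - y j else \<Lambda> j x)" for j
  define Z where "Z j = rep_L2 (fourier (z j))" for j
  define h where "h \<xi> = (\<Sum>j\<in>M. b j \<xi> * rep_L2 (fourier (y j)) \<xi>)" for \<xi>
  have finM: "finite M" using \<open>M \<subseteq> J\<close> c(2) by (rule finite_subset)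
  have z_le: "norm (z j) \<le> \<delta> j" if "j \<in> J" for j
    using that in_M out_M by (auto simp: z_def)
  \<comment> \<open>A single summand of the second condition already bounds \<open>b j\<close>, so
    its product with a square-integrable function stays square-integrable and \<open>abs_L2\<close>
    is meaningful.\<close>
  have b_bound: "AE \<xi> in lebesgue. (cmod (b j \<xi>))\<^sup>2 \<le> C\<^sup>2 * \<theta> j / (\<delta> j)\<^sup>2" if j: "j \<in> J" for j
    using AE
  proof eventually_elim
    case (elim \<xi>)
    have "(\<delta> j)\<^sup>2 * (cmod (b j \<xi>))\<^sup>2 / \<theta> j \<le> (\<Sum>j\<in>J. (\<delta> j)\<^sup>2 * (cmod (b j \<xi>))\<^sup>2 / \<theta> j)"
      using c j by (intro member_le_sum) (auto intro!: divide_nonneg_nonneg simp: less_imp_le)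
    also have "\<dots> \<le> C\<^sup>2" using elim by simp
    finally show ?case using c(3)[OF j] \<delta>[OF j] by (simp add: field_simps)
  qed
  have sq_bf: "square_integrable (\<lambda>\<xi>. b j \<xi> * f \<xi>)" if "j \<in> J" "square_integrable f" for j f
    by (rule square_integrable_bounded_mult[OF b[OF that(1)] b_bound[OF that(1)] that(2)])
  have sq_sum: "square_integrable (\<lambda>\<xi>. \<Sum>j\<in>K. b j \<xi> * g j \<xi>)"
    if "K \<subseteq> J" "\<And>j. square_integrable (g j)" for K and g :: "nat \<Rightarrow> 'a \<Rightarrow> complex"
  proof -
    have "finite K" using that(1) c(2) by (rule finite_subset)
    then show ?thesis using that
      by (induction K) (auto intro!: square_integrable_add sq_bf)
  qed
  have sq_h: "square_integrable h"
    unfolding h_def[abs_def] using \<open>M \<subseteq> J\<close> by (intro sq_sum) auto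
  have sq_Z: "square_integrable (Z j)" for j by (simp add: Z_def)
  have AE_Z: "AE \<xi> in lebesgue. Z j \<xi> = symbol j x \<xi> - (if j \<in> M then rep_L2 (fourier (y j)) \<xi> else 0)"
    if "j \<in> J" for j
  proof -
    have j: "j \<in> {0..N}" using that c(1) by auto
    have "AE \<xi> in lebesgue. rep_L2 (fourier (\<Lambda> j x)) \<xi> = symbol j x \<xi>"
      unfolding fourier_multiplier_op by (rule rep_abs_L2[OF square_integrable_symbol[OF x j]])
    moreover have "AE \<xi> in lebesgue. rep_L2 (fourier (\<Lambda> j x - y j)) \<xi> =
        rep_L2 (fourier (\<Lambda> j x)) \<xi> - rep_L2 (fourier (y j)) \<xi>"
      unfolding fourier_diff by (rule rep_diff_L2)
    ultimately show ?thesis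
      by eventually_elim (auto simp: Z_def z_def)
  qed
  have "AE \<xi> in lebesgue. \<forall>j\<in>J. Z j \<xi> = symbol j x \<xi> - (if j \<in> M then rep_L2 (fourier (y j)) \<xi> else 0)"
    using c(2) AE_Z by (simp add: AE_finite_all)
  with AE have "AE \<xi> in lebesgue. symbol 0 x \<xi> - h \<xi> = (\<Sum>j\<in>J. b j \<xi> * Z j \<xi>)"
  proof eventually_elim
    case (elim \<xi>)
    have "(\<Sum>j\<in>J. b j \<xi> * Z j \<xi>) = (\<Sum>j\<in>J. b j \<xi> * symbol j x \<xi>) -
        (\<Sum>j\<in>J. if j \<in> M then b j \<xi> * rep_L2 (fourier (y j)) \<xi> else 0)"
      using elim by (subst sum_subtractf[symmetric]) (auto intro!: sum.cong simp: right_diff_distrib)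
    also have "(\<Sum>j\<in>J. b j \<xi> * symbol j x \<xi>) = (\<Sum>j\<in>J. pw j \<xi> * b j \<xi>) * rep_L2 (fourier x) \<xi>"
      by (simp add: symbol_def sum_distrib_left mult_ac)
    also have "\<dots> = symbol 0 x \<xi>" using elim by (simp add: symbol_def)
    also have "(\<Sum>j\<in>J. if j \<in> M then b j \<xi> * rep_L2 (fourier (y j)) \<xi> else 0) = h \<xi>"
      unfolding h_def using \<open>M \<subseteq> J\<close> c(2) by (simp add: sum.If_cases Int_absorb1)
    finally show ?case by simp
  qed
  then have "abs_L2 (\<lambda>\<xi>. symbol 0 x \<xi> - h \<xi>) = abs_L2 (\<lambda>\<xi>. \<Sum>j\<in>J. b j \<xi> * Z j \<xi>)"
    using square_integrable_symbol[OF x, of 0] sq_h sq_Z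
    by (intro abs_L2_eqI square_integrable_diff sq_sum) auto
  moreover have "fourier (\<Lambda> 0 x - inverse_fourier (abs_L2 h)) = abs_L2 (\<lambda>\<xi>. symbol 0 x \<xi> - h \<xi>)"
    using square_integrable_symbol[OF x, of 0] sq_h
    by (simp add: fourier_diff fourier_multiplier_op diff_abs_L2)
  ultimately have "(norm (\<Lambda> 0 x - inverse_fourier (abs_L2 h)))\<^sup>2 = (norm (abs_L2 (\<lambda>\<xi>. \<Sum>j\<in>J. b j \<xi> * Z j \<xi>)))\<^sup>2"
    using norm_fourier[of "\<Lambda> 0 x - inverse_fourier (abs_L2 h)"] by (simp only:)
  also have "\<dots> = (\<integral>\<xi>. (cmod (\<Sum>j\<in>J. b j \<xi> * Z j \<xi>))\<^sup>2 \<partial>lebesgue)"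
    using sq_sum[of J Z] sq_Z by (simp add: norm_abs_L2)
  also have "\<dots> \<le> (\<integral>\<xi>. C\<^sup>2 * (\<Sum>j\<in>J. \<theta> j / (\<delta> j)\<^sup>2 * (cmod (Z j \<xi>))\<^sup>2) \<partial>lebesgue)"
  proof (rule integral_mono_AE)
    show "integrable lebesgue (\<lambda>\<xi>. (cmod (\<Sum>j\<in>J. b j \<xi> * Z j \<xi>))\<^sup>2)"
      using sq_sum[of J Z] sq_Z by (simp add: square_integrable_def)
    show "integrable lebesgue (\<lambda>\<xi>. C\<^sup>2 * (\<Sum>j\<in>J. \<theta> j / (\<delta> j)\<^sup>2 * (cmod (Z j \<xi>))\<^sup>2))"
      using sq_Z by (intro integrable_mult_right Bochner_Integration.integrable_sum) (simp add: square_integrable_def)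
    show "AE \<xi> in lebesgue. (cmod (\<Sum>j\<in>J. b j \<xi> * Z j \<xi>))\<^sup>2 \<le> C\<^sup>2 * (\<Sum>j\<in>J. \<theta> j / (\<delta> j)\<^sup>2 * (cmod (Z j \<xi>))\<^sup>2)"
      using AE
    proof eventually_elim
      case (elim \<xi>)
      have "(cmod (\<Sum>j\<in>J. b j \<xi> * Z j \<xi>))\<^sup>2 \<le>
          (\<Sum>j\<in>J. (\<delta> j)\<^sup>2 * (cmod (b j \<xi>))\<^sup>2 / \<theta> j) * (\<Sum>j\<in>J. \<theta> j / (\<delta> j)\<^sup>2 * (cmod (Z j \<xi>))\<^sup>2)"
        using c(3) \<delta> by (intro weighted_Cauchy_Schwarz)
      also have "\<dots> \<le> C\<^sup>2 * (\<Sum>j\<in>J. \<theta> j / (\<delta> j)\<^sup>2 * (cmod (Z j \<xi>))\<^sup>2)"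
        using elim c(3) by (intro mult_right_mono sum_nonneg) (auto intro!: mult_nonneg_nonneg divide_nonneg_nonneg simp: less_imp_le)
      finally show ?case .
    qed
  qed
  also have "\<dots> = C\<^sup>2 * (\<Sum>j\<in>J. \<theta> j / (\<delta> j)\<^sup>2 * (norm (z j))\<^sup>2)"
  proof -
    have "(\<integral>\<xi>. (cmod (Z j \<xi>))\<^sup>2 \<partial>lebesgue) = (norm (z j))\<^sup>2" for j
      using norm_abs_L2[OF sq_Z, of j] by (simp add: Z_def)
    then show ?thesis
      using sq_Z by (subst integral_mult_right_zero, subst Bochner_Integration.integral_sum)
        (auto simp: square_integrable_def)
  qed
  also have "\<dots> \<le> C\<^sup>2 * (\<Sum>j\<in>J. \<theta> j)"
  proof (intro mult_left_mono sum_mono)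
    fix j assume j: "j \<in> J"
    have "(norm (z j))\<^sup>2 \<le> (\<delta> j)\<^sup>2" using z_le[OF j] by (intro power_mono) auto
    then have "(norm (z j))\<^sup>2 / (\<delta> j)\<^sup>2 \<le> 1" using \<delta>[OF j] by (simp add: divide_le_eq)
    then show "\<theta> j / (\<delta> j)\<^sup>2 * (norm (z j))\<^sup>2 \<le> \<theta> j"
      using mult_left_mono[of _ 1 "\<theta> j"] c(3)[OF j] by fastforce
  qed auto
  finally have "(norm (\<Lambda> 0 x - inverse_fourier (abs_L2 h)))\<^sup>2 \<le> C\<^sup>2" by (simp add: c(4))
  then show ?thesis unfolding h_def by (rule power2_le_imp_le[OF _ \<open>0 \<le> C\<close>])
qed

text \<open>These coefficients give equality in the Cauchy-Schwarz inequality. Where the denominator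
  vanishes, all the \<open>pw j\<close> and hence \<open>pw 0\<close> vanish, and the junk value \<open>0\<close> of the quotient is
  the right one.\<close>

lemma optimal_coefficients:
  assumes J: "convex_weights J \<theta>" and \<delta>: "\<And>j. j \<in> J \<Longrightarrow> 0 < \<delta> j"
  obtains b where "\<And>j. b j \<in> borel_measurable lebesgue"
    "\<And>\<xi>. (\<Sum>j\<in>J. pw j \<xi> * b j \<xi>) = pw 0 \<xi>"
    "\<And>\<xi>. (\<Sum>j\<in>J. (\<delta> j)\<^sup>2 * (cmod (b j \<xi>))\<^sup>2 / \<theta> j) \<le> (\<Prod>j\<in>J. \<delta> j powr \<theta> j)\<^sup>2"
proof -
  note c = convex_weightsD[OF J]
  let ?P = "\<Prod>j\<in>J. \<delta> j powr \<theta> j"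
  define D where "D \<xi> = (\<Sum>j\<in>J. \<theta> j * ((cmod (pw j \<xi>))\<^sup>2 / (\<delta> j)\<^sup>2))" for \<xi>
  have D_nn: "0 \<le> D \<xi>" for \<xi>
    unfolding D_def using c(3) by (intro sum_nonneg mult_nonneg_nonneg) (auto simp: less_imp_le)
  have le: "(cmod (pw 0 \<xi>))\<^sup>2 \<le> ?P\<^sup>2 * D \<xi>" for \<xi>
    unfolding D_def by (rule norm_pw_0_le[OF J \<delta>])
  define b where "b j \<xi> = of_real (\<theta> j / (\<delta> j)\<^sup>2 / D \<xi>) * cnj (pw j \<xi>) * pw 0 \<xi>" for j \<xi>
  show ?thesis
  proof (rule that[of b])
    show "b j \<in> borel_measurable lebesgue" for j
      unfolding b_def[abs_def] D_def by measurable
  next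
    fix \<xi>
    have "(\<Sum>j\<in>J. pw j \<xi> * b j \<xi>) = (\<Sum>j\<in>J. of_real (\<theta> j * ((cmod (pw j \<xi>))\<^sup>2 / (\<delta> j)\<^sup>2)) * (pw 0 \<xi> / of_real (D \<xi>)))"
    proof (rule sum.cong[OF refl])
      fix j
      have "pw j \<xi> * b j \<xi> = of_real (\<theta> j / (\<delta> j)\<^sup>2 / D \<xi>) * (pw j \<xi> * cnj (pw j \<xi>)) * pw 0 \<xi>"
        by (simp add: b_def)
      also have "\<dots> = of_real (\<theta> j * ((cmod (pw j \<xi>))\<^sup>2 / (\<delta> j)\<^sup>2)) * (pw 0 \<xi> / of_real (D \<xi>))"
        unfolding complex_norm_square[symmetric] by simp
      finally show "pw j \<xi> * b j \<xi> = of_real (\<theta> j * ((cmod (pw j \<xi>))\<^sup>2 / (\<delta> j)\<^sup>2)) * (pw 0 \<xi> / of_real (D \<xi>))" .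
    qed
    also have "\<dots> = of_real (D \<xi>) * (pw 0 \<xi> / of_real (D \<xi>))"
      by (simp only: D_def of_real_sum sum_distrib_right)
    also have "\<dots> = pw 0 \<xi>"
      using le[of \<xi>] by (cases "D \<xi> = 0") auto
    finally show "(\<Sum>j\<in>J. pw j \<xi> * b j \<xi>) = pw 0 \<xi>" .
    have "(\<Sum>j\<in>J. (\<delta> j)\<^sup>2 * (cmod (b j \<xi>))\<^sup>2 / \<theta> j) =
        (\<Sum>j\<in>J. \<theta> j * ((cmod (pw j \<xi>))\<^sup>2 / (\<delta> j)\<^sup>2) * ((cmod (pw 0 \<xi>))\<^sup>2 / (D \<xi>)\<^sup>2))"
    proof (rule sum.cong[OF refl])
      fix j assume "j \<in> J"
      then have pos: "0 < \<theta> j" "0 < \<delta> j" using c(3) \<delta> by auto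
      have cb: "cmod (b j \<xi>) = \<theta> j / (\<delta> j)\<^sup>2 / D \<xi> * cmod (pw j \<xi>) * cmod (pw 0 \<xi>)"
        using \<open>0 < \<theta> j\<close> D_nn[of \<xi>] by (simp add: b_def norm_mult norm_divide norm_power)
      show "(\<delta> j)\<^sup>2 * (cmod (b j \<xi>))\<^sup>2 / \<theta> j =
          \<theta> j * ((cmod (pw j \<xi>))\<^sup>2 / (\<delta> j)\<^sup>2) * ((cmod (pw 0 \<xi>))\<^sup>2 / (D \<xi>)\<^sup>2)"
        unfolding cb using pos by (cases "D \<xi> = 0") (auto simp: divide_simps power2_eq_square)
    qed
    also have "\<dots> = D \<xi> * ((cmod (pw 0 \<xi>))\<^sup>2 / (D \<xi>)\<^sup>2)"
      by (simp only: D_def sum_distrib_right)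
    also have "\<dots> \<le> ?P\<^sup>2"
    proof (cases "D \<xi> = 0")
      case False
      then have "0 < D \<xi>" using D_nn[of \<xi>] by simp
      then show ?thesis using le[of \<xi>] by (simp add: power2_eq_square field_simps)
    qed simp
    finally show "(\<Sum>j\<in>J. (\<delta> j)\<^sup>2 * (cmod (b j \<xi>))\<^sup>2 / \<theta> j) \<le> ?P\<^sup>2" .
  qed
qed

end

section \<open>Extremal functions\<close>

lemma optimal_error_le: "optimal_error \<Psi> W m \<delta> \<le> recovery_error \<Psi> W m \<delta> \<Phi>"
  unfolding optimal_error_def by (rule INF_lower) simp

context fourier_multipliers
begin

text \<open>A point has no mass, so the transform is a multiple of the indicator of a small ball
  around the point with the prescribed moduli. Continuity of the moduli on that ball costs the
  factor \<open>\<tau>\<close>.\<close>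

lemma concentrated_element:
  assumes \<tau>: "0 < \<tau>" "\<tau> < 1" and "I \<subseteq> {1..N}" and t: "\<And>i. i \<in> I \<Longrightarrow> exp (- (\<alpha> i \<bullet> \<eta> + a)) \<le> t i"
  obtains x where "x \<in> X" "\<And>i. i \<in> I \<Longrightarrow> norm (\<Lambda> i x) \<le> t i" "\<tau> * exp (- (\<alpha> 0 \<bullet> \<eta> + a)) \<le> norm (\<Lambda> 0 x)"
proof -
  obtain \<xi>0 where \<xi>0: "\<And>i. cmod (\<phi> i \<xi>0) = exp (- (\<eta> $ i))"
    using moduli[of "\<lambda>i. exp (- (\<eta> $ i))"] by auto
  define v where "v j = exp (- (\<alpha> j \<bullet> \<eta>))" for j
  have v: "cmod (pw j \<xi>0) = v j" "0 < v j" for j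
    using norm_multi_power_exp[where \<phi>=\<phi> and \<xi>=\<xi>0 and \<eta>=\<eta>, OF \<xi>0] by (simp_all add: v_def)
  \<comment> \<open>Continuity is paid for twice, in the upper bounds for the constraints and in the
    lower bound for \<open>pw 0\<close>, each time by \<open>\<sigma>\<close>.\<close>
  define \<sigma> where "\<sigma> = sqrt \<tau>"
  have \<sigma>: "0 < \<sigma>" "\<sigma> < 1" "\<sigma> * \<sigma> = \<tau>" using \<tau> by (auto simp: \<sigma>_def)
  have cont: "((\<lambda>\<xi>. cmod (pw j \<xi>)) \<longlongrightarrow> v j) (nhds \<xi>0)" if "j \<in> {0..N}" for j
  proof -
    have "\<And>i. 0 \<le> \<alpha> j $ i" using that nonneg nonneg_0 by (cases "j = 0") auto
    then have "isCont (\<lambda>\<xi>. cmod (pw j \<xi>)) \<xi>0"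
      using continuous_on_norm_multi_power[where \<phi>=\<phi>, OF continuous] by (simp add: continuous_on_eq_continuous_at)
    then have "((\<lambda>\<xi>. cmod (pw j \<xi>)) \<longlongrightarrow> cmod (pw j \<xi>0)) (nhds \<xi>0)"
      unfolding isCont_def by (simp only: tendsto_at_iff_tendsto_nhds[of "\<lambda>\<xi>. cmod (pw j \<xi>)"])
    then show ?thesis by (simp only: v(1))
  qed
  have "\<forall>\<^sub>F \<xi> in nhds \<xi>0. \<forall>j\<in>{1..N}. cmod (pw j \<xi>) < v j / \<sigma>"
  proof (rule eventually_ball_finite)
    show "\<forall>j\<in>{1..N}. \<forall>\<^sub>F \<xi> in nhds \<xi>0. cmod (pw j \<xi>) < v j / \<sigma>"
      using \<sigma> v(2) by (intro ballI order_tendstoD(2)[OF cont]) (auto simp: less_divide_eq)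
  qed simp
  moreover have "\<forall>\<^sub>F \<xi> in nhds \<xi>0. \<sigma> * v 0 < cmod (pw 0 \<xi>)"
    using \<sigma> v(2) by (intro order_tendstoD(1)[OF cont]) auto
  ultimately have "\<forall>\<^sub>F \<xi> in nhds \<xi>0. (\<forall>j\<in>{1..N}. cmod (pw j \<xi>) < v j / \<sigma>) \<and> \<sigma> * v 0 < cmod (pw 0 \<xi>)"
    by eventually_elim auto
  then obtain r where r: "0 < r" "\<And>\<xi>. \<xi> \<in> ball \<xi>0 r \<Longrightarrow> (\<forall>j\<in>{1..N}. cmod (pw j \<xi>) < v j / \<sigma>) \<and> \<sigma> * v 0 < cmod (pw 0 \<xi>)"
    unfolding eventually_nhds_metric by (auto simp: dist_commute)
  define V where "V = measure lebesgue (ball \<xi>0 r)"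
  have "0 < V" using content_ball_pos[OF r(1), of \<xi>0] by (simp add: V_def)
  \<comment> \<open>\<open>K\<close> is the norm of \<open>h\<close>: the factor
    \<open>\<sigma>\<close> compensates the bounds \<open>v j / \<sigma>\<close>, and
    \<open>exp (- a)\<close> is the constant term of the hyperplane.\<close>
  define K where "K = \<sigma> * exp (- a)"
  have "0 < K" using \<sigma> by (simp add: K_def)
  define h :: "'a \<Rightarrow> complex" where "h \<xi> = of_real (K / sqrt V) * indicator (ball \<xi>0 r) \<xi>" for \<xi>
  have [measurable]: "h \<in> borel_measurable lebesgue"
    unfolding h_def[abs_def] by (intro borel_measurable_times borel_measurable_indicator) auto
  have h2: "(cmod (h \<xi>))\<^sup>2 = K\<^sup>2 / V * indicat_real (ball \<xi>0 r) \<xi>" for \<xi>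
    using \<open>0 < V\<close> by (auto simp: h_def norm_mult norm_divide power_divide indicator_def)
  have int_h: "integrable lebesgue (\<lambda>\<xi>. (cmod (h \<xi>))\<^sup>2)"
    unfolding h2 by (intro integrable_mult_right integrable_real_indicator)
      (use emeasure_lborel_ball_finite[of \<xi>0 r] in auto)
  have norm_h: "(\<integral>\<xi>. (cmod (h \<xi>))\<^sup>2 \<partial>lebesgue) = K\<^sup>2"
    unfolding h2 using \<open>0 < V\<close> by (simp add: V_def)
  have sq_h: "square_integrable h" using int_h by (simp add: square_integrable_def)
  define x where "x = inverse_fourier (abs_L2 h)"
  have rep: "AE \<xi> in lebesgue. rep_L2 (fourier x) \<xi> = h \<xi>"
    using rep_abs_L2[OF sq_h] by (simp add: x_def)
  \<comment> \<open>Needed for all indices up to \<open>N\<close>, not only for those in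
    \<open>I\<close>, since \<open>x\<close> has to lie in \<open>X\<close>.\<close>
  have le: "AE \<xi> in lebesgue. (cmod (symbol j x \<xi>))\<^sup>2 \<le> (v j / \<sigma>)\<^sup>2 * (cmod (h \<xi>))\<^sup>2" if "j \<in> {1..N}" for j
    using rep
  proof eventually_elim
    case (elim \<xi>)
    show ?case
    proof (cases "\<xi> \<in> ball \<xi>0 r")
      case True
      then have "(cmod (pw j \<xi>))\<^sup>2 \<le> (v j / \<sigma>)\<^sup>2"
        using r(2)[OF True] that by (intro power_mono) (auto intro: less_imp_le)
      then show ?thesis by (simp add: symbol_def elim norm_mult power_mult_distrib mult_right_mono)
    next
      case False
      then show ?thesis by (simp add: symbol_def elim h_def)
    qed
  qed
  have int_j: "integrable lebesgue (\<lambda>\<xi>. (cmod (symbol j x \<xi>))\<^sup>2)" if "j \<in> {1..N}" for j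
    by (rule Bochner_Integration.integrable_bound[OF integrable_mult_right[OF int_h, of "(v j / \<sigma>)\<^sup>2"]])
      (use le[OF that] in auto)
  have "x \<in> X"
    using int_j by (simp add: mem_multiplier_space_iff square_integrable_def)
  show ?thesis
  proof (rule that[OF \<open>x \<in> X\<close>])
    fix i assume "i \<in> I"
    then have i: "i \<in> {1..N}" using \<open>I \<subseteq> {1..N}\<close> by auto
    have "(norm (\<Lambda> i x))\<^sup>2 = (\<integral>\<xi>. (cmod (symbol i x \<xi>))\<^sup>2 \<partial>lebesgue)"
      using i by (intro norm_multiplier_op[OF \<open>x \<in> X\<close>]) auto
    also have "\<dots> \<le> (\<integral>\<xi>. (v i / \<sigma>)\<^sup>2 * (cmod (h \<xi>))\<^sup>2 \<partial>lebesgue)"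
      using int_j[OF i] int_h le[OF i] by (intro integral_mono_AE) auto
    also have "\<dots> = (v i / \<sigma> * K)\<^sup>2" by (simp add: norm_h power_mult_distrib power_divide)
    also have "v i / \<sigma> * K = exp (- (\<alpha> i \<bullet> \<eta> + a))"
      using \<sigma> by (simp add: v_def K_def exp_add[symmetric])
    finally have "norm (\<Lambda> i x) \<le> exp (- (\<alpha> i \<bullet> \<eta> + a))" by (rule power2_le_imp_le) simp
    then show "norm (\<Lambda> i x) \<le> t i" using t[OF \<open>i \<in> I\<close>] by simp
  next
    have "\<tau> * exp (- (\<alpha> 0 \<bullet> \<eta> + a)) = \<sigma> * v 0 * K"
      using \<sigma>(3) by (simp add: v_def K_def exp_add[symmetric] mult_ac flip: \<sigma>(3))
    have "(\<sigma> * v 0 * K)\<^sup>2 = (\<integral>\<xi>. (\<sigma> * v 0)\<^sup>2 * (cmod (h \<xi>))\<^sup>2 \<partial>lebesgue)"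
      by (simp add: norm_h power_mult_distrib)
    also have "\<dots> \<le> (\<integral>\<xi>. (cmod (symbol 0 x \<xi>))\<^sup>2 \<partial>lebesgue)"
    proof (rule integral_mono_AE)
      show "integrable lebesgue (\<lambda>\<xi>. (\<sigma> * v 0)\<^sup>2 * (cmod (h \<xi>))\<^sup>2)" using int_h by auto
      show "integrable lebesgue (\<lambda>\<xi>. (cmod (symbol 0 x \<xi>))\<^sup>2)"
        using square_integrable_symbol[OF \<open>x \<in> X\<close>, of 0] by (simp add: square_integrable_def)
      show "AE \<xi> in lebesgue. (\<sigma> * v 0)\<^sup>2 * (cmod (h \<xi>))\<^sup>2 \<le> (cmod (symbol 0 x \<xi>))\<^sup>2"
        using rep
      proof eventually_elim
        case (elim \<xi>)
        show ?case
        proof (cases "\<xi> \<in> ball \<xi>0 r")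
          case True
          then have "(\<sigma> * v 0)\<^sup>2 \<le> (cmod (pw 0 \<xi>))\<^sup>2"
            using r(2)[OF True] \<sigma>(1) v(2)[of 0] by (intro power_mono) (auto intro: less_imp_le)
          then show ?thesis by (simp add: symbol_def elim norm_mult power_mult_distrib[of "cmod _"] mult_right_mono)
        next
          case False
          then show ?thesis by (simp add: symbol_def elim h_def)
        qed
      qed
    qed
    also have "\<dots> = (norm (\<Lambda> 0 x))\<^sup>2"
      by (rule norm_multiplier_op[OF \<open>x \<in> X\<close>, symmetric]) simp
    finally have "\<sigma> * v 0 * K \<le> norm (\<Lambda> 0 x)" by (rule power2_le_imp_le) simp
    then show "\<tau> * exp (- (\<alpha> 0 \<bullet> \<eta> + a)) \<le> norm (\<Lambda> 0 x)"
      by (simp only: \<open>\<tau> * exp (- (\<alpha> 0 \<bullet> \<eta> + a)) = \<sigma> * v 0 * K\<close>)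
  qed
qed

text \<open>The index set and the levels are free: it serves \<open>{1..N}\<close> with
  \<open>\<delta>\<close>, \<open>{1..N}\<close> with the norms of an element, and only the indices
  of the weights in the affinely independent case.\<close>

lemma SUP_norm_multiplier_op_0_ge:
  assumes "I \<subseteq> {1..N}" and t: "\<And>i. i \<in> I \<Longrightarrow> 0 < t i"
    and above: "\<And>i. i \<in> I \<Longrightarrow> ln (1 / t i) \<le> \<alpha> i \<bullet> \<eta> + a"
  shows "ereal (exp (- (\<alpha> 0 \<bullet> \<eta> + a))) \<le> (SUP x\<in>{x\<in>X. \<forall>i\<in>I. norm (\<Lambda> i x) \<le> t i}. ereal (norm (\<Lambda> 0 x)))"
    (is "ereal ?c \<le> ?S")
proof (rule ccontr)
  assume "\<not> ereal ?c \<le> ?S"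
  then have "?S < ereal ?c" by simp
  then obtain s where s: "?S < ereal s" "ereal s < ereal ?c" using ereal_dense2 by blast
  \<comment> \<open>The \<open>1 / 2\<close> merely keeps \<open>\<tau>\<close> positive, since the
    sign of \<open>s\<close> is not known.\<close>
  define \<tau> where "\<tau> = max (1 / 2) (s / ?c)"
  have \<tau>: "0 < \<tau>" "\<tau> < 1" "s \<le> \<tau> * ?c"
  proof -
    have "s / ?c < 1" using s(2) by simp
    then show "\<tau> < 1" by (simp add: \<tau>_def)
    show "0 < \<tau>" by (simp add: \<tau>_def)
    have "s = s / ?c * ?c" by simp
    also have "\<dots> \<le> \<tau> * ?c" by (intro mult_right_mono) (auto simp: \<tau>_def)
    finally show "s \<le> \<tau> * ?c" .
  qed
  have "exp (- (\<alpha> i \<bullet> \<eta> + a)) \<le> t i" if "i \<in> I" for i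
  proof -
    have "- (\<alpha> i \<bullet> \<eta> + a) \<le> ln (t i)" using above[OF that] t[OF that] by (simp add: ln_div)
    then have "exp (- (\<alpha> i \<bullet> \<eta> + a)) \<le> exp (ln (t i))" by (subst exp_le_cancel_iff)
    then show ?thesis using t[OF that] by simp
  qed
  from concentrated_element[OF \<tau>(1,2) \<open>I \<subseteq> {1..N}\<close> this] obtain x
    where "x \<in> X" "\<And>i. i \<in> I \<Longrightarrow> norm (\<Lambda> i x) \<le> t i" "\<tau> * ?c \<le> norm (\<Lambda> 0 x)"
    by blast
  then have "ereal (\<tau> * ?c) \<le> ?S"
    by (intro SUP_upper2[of x]) auto
  moreover have "ereal s \<le> ereal (\<tau> * ?c)" using \<tau>(3) by simp
  ultimately have "ereal s \<le> ?S" by (rule order_trans[rotated])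
  with s(1) show False by simp
qed

text \<open>Supplies the symmetry for the lower bound: \<open>x\<close> and \<open>- x\<close>
  satisfy the same constraints and have opposite images.\<close>

lemma multiplier_op_uminus:
  assumes "x \<in> X"
  shows "- x \<in> X" "j \<in> {0..N} \<Longrightarrow> \<Lambda> j (- x) = - \<Lambda> j x"
proof -
  have F: "fourier (- y) = - fourier y" for y :: "'a L2"
    using fourier_diff[of 0 y] by simp
  have "AE \<xi> in lebesgue. rep_L2 (0 - fourier x) \<xi> = rep_L2 0 \<xi> - rep_L2 (fourier x) \<xi>"
    by (rule rep_diff_L2)
  moreover have "AE \<xi> in lebesgue. rep_L2 (0 :: 'a L2) \<xi> = 0"
    unfolding zero_L2_def by (rule rep_abs_L2) simp
  ultimately have AE: "AE \<xi> in lebesgue. - symbol j x \<xi> = symbol j (- x) \<xi>" for j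
    by eventually_elim (simp add: symbol_def F)
  have sq: "square_integrable (symbol j (- x))" if "j \<in> {0..N}" for j
    by (rule square_integrable_cong_AE[OF square_integrable_uminus[OF square_integrable_symbol[OF assms that]] _ AE]) simp
  have "square_integrable (symbol j (- x))" if "j \<in> {1..N}" for j
    using that by (intro sq) auto
  then show "- x \<in> X"
    by (simp add: mem_multiplier_space_iff)
  show "\<Lambda> j (- x) = - \<Lambda> j x" if j: "j \<in> {0..N}"
  proof -
    have "abs_L2 (symbol j (- x)) = abs_L2 (\<lambda>\<xi>. - symbol j x \<xi>)"
    proof (intro abs_L2_eqI sq square_integrable_uminus square_integrable_symbol assms j)
      show "AE \<xi> in lebesgue. symbol j (- x) \<xi> = - symbol j x \<xi>"
        using AE[of j] by eventually_elim simp
    qed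
    also have "\<dots> = 0 - abs_L2 (symbol j x)"
      unfolding zero_L2_def by (subst diff_abs_L2) (simp_all add: square_integrable_symbol[OF assms j])
    finally have "fourier (\<Lambda> j (- x)) = fourier (- \<Lambda> j x)"
      by (simp add: fourier_multiplier_op F)
    then show ?thesis using bij_fourier by (auto dest: bij_is_inj injD)
  qed
qed

text \<open>Zero data fit both \<open>x\<close> and \<open>- x\<close>, so a method gives the same
  answer for two elements whose images lie \<open>2 * norm (\<Lambda> 0 x)\<close> apart and is
  wrong by at least half of that for one of them.\<close>

lemma recovery_error_ge:
  assumes \<delta>: "\<And>j. j \<in> {1..N} \<Longrightarrow> 0 < \<delta> j" and "m \<le> N"
    and S: "(\<alpha> 0, s) \<in> exponent_hull \<alpha> \<delta> N" "\<And>z. (\<alpha> 0, z) \<in> exponent_hull \<alpha> \<delta> N \<Longrightarrow> z \<le> s"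
  shows "ereal (exp (- s)) \<le> recovery_error \<Lambda> (multiplier_class \<phi> arg \<alpha> \<delta> m N) m \<delta> \<Phi>"
    (is "_ \<le> ?E")
proof -
  let ?S = "SUP x\<in>{x\<in>X. \<forall>i\<in>{1..N}. norm (\<Lambda> i x) \<le> \<delta> i}. ereal (norm (\<Lambda> 0 x))"
  have "?S \<le> ?E"
  proof (rule SUP_least)
    fix x assume x: "x \<in> {x\<in>X. \<forall>i\<in>{1..N}. norm (\<Lambda> i x) \<le> \<delta> i}"
    \<comment> \<open>Restricted because data tuples are extensional functions on
      \<open>{1..m}\<close>.\<close>
    let ?y = "restrict (\<lambda>_. 0) {1..m} :: nat \<Rightarrow> 'a L2"
    have err: "ereal (norm (\<Lambda> 0 u - \<Phi> ?y)) \<le> ?E"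
      if "u \<in> X" "\<forall>i\<in>{1..N}. norm (\<Lambda> i u) \<le> \<delta> i" for u
      unfolding recovery_error_def using that \<open>m \<le> N\<close>
      by (intro SUP_upper2[of "(u, ?y)"]) (auto simp: multiplier_class_def)
    have "ereal (norm (- \<Lambda> 0 x - \<Phi> ?y)) \<le> ?E"
      using err[of "- x"] x multiplier_op_uminus[of x] by simp
    moreover have "ereal (norm (\<Lambda> 0 x - \<Phi> ?y)) \<le> ?E" using err[of x] x by simp
    moreover have "norm (\<Lambda> 0 x) \<le> max (norm (- \<Lambda> 0 x - \<Phi> ?y)) (norm (\<Lambda> 0 x - \<Phi> ?y))"
    proof -
      have "2 * norm (\<Lambda> 0 x) = norm ((\<Lambda> 0 x - \<Phi> ?y) - (- \<Lambda> 0 x - \<Phi> ?y))"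
        by (simp flip: scaleR_2)
      also have "\<dots> \<le> norm (\<Lambda> 0 x - \<Phi> ?y) + norm (- \<Lambda> 0 x - \<Phi> ?y)" by (rule norm_triangle_ineq4)
      finally show ?thesis by linarith
    qed
    ultimately show "ereal (norm (\<Lambda> 0 x)) \<le> ?E"
      unfolding le_max_iff_disj by (meson ereal_less_eq(3) order.trans)
  qed
  \<comment> \<open>Hyperplanes passing within \<open>1 / Suc n\<close> above the point of the graph
    are enough; strict separation provides them, and the gap disappears in the limit.\<close>
  moreover have "ereal (exp (- s)) \<le> ?S"
  proof (rule tendsto_upperbound)
    let ?e = "\<lambda>n. 1 / real (Suc n)"
    have "?e \<longlonglongrightarrow> 0" by (rule LIMSEQ_Suc) (rule lim_1_over_n)
    then have "(\<lambda>n. exp (- (s + ?e n))) \<longlonglongrightarrow> exp (- (s + 0))" by (intro tendsto_intros)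
    then show "(\<lambda>n. ereal (exp (- (s + ?e n)))) \<longlonglongrightarrow> ereal (exp (- s))" by simp
    show "\<forall>\<^sub>F n in sequentially. ereal (exp (- (s + ?e n))) \<le> ?S"
    proof (intro always_eventually allI)
      fix n
      have "0 < ?e n" by simp
      from approximate_support_hyperplane[OF S this] obtain \<eta> a
        where ha: "\<And>j. j \<in> {1..N} \<Longrightarrow> ln (1 / \<delta> j) \<le> \<alpha> j \<bullet> \<eta> + a" "\<alpha> 0 \<bullet> \<eta> + a \<le> s + ?e n"
        by blast
      have "ereal (exp (- (s + ?e n))) \<le> ereal (exp (- (\<alpha> 0 \<bullet> \<eta> + a)))" using ha(2) by simp
      also have "\<dots> \<le> ?S" using \<delta> ha(1) by (intro SUP_norm_multiplier_op_0_ge) auto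
      finally show "ereal (exp (- (s + ?e n))) \<le> ?S" .
    qed
  qed simp
  ultimately show ?thesis by (rule order_trans[rotated])
qed

text \<open>For indices of \<open>J\<close> beyond \<open>m\<close> there are no data, but the class
  itself bounds \<open>\<Lambda> j x\<close>, as if the datum were 0.\<close>

lemma recovery_error_le:
  assumes J: "convex_weights J \<theta>" and \<delta>: "\<And>j. j \<in> J \<Longrightarrow> 0 < \<delta> j" and "0 \<le> C"
    and b: "\<And>j. j \<in> J \<Longrightarrow> b j \<in> borel_measurable lebesgue"
    and AE: "AE \<xi> in lebesgue. (\<Sum>j\<in>J. pw j \<xi> * b j \<xi>) = pw 0 \<xi> \<and>
      (\<Sum>j\<in>J. (\<delta> j)\<^sup>2 * (cmod (b j \<xi>))\<^sup>2 / \<theta> j) \<le> C\<^sup>2"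
  shows "recovery_error \<Lambda> (multiplier_class \<phi> arg \<alpha> \<delta> m N) m \<delta>
    (\<lambda>y. inverse_fourier (abs_L2 (\<lambda>\<xi>. \<Sum>j\<in>J \<inter> {1..m}. b j \<xi> * rep_L2 (fourier (y j)) \<xi>))) \<le> ereal C"
  unfolding recovery_error_def
proof (rule SUP_least, clarify)
  fix x y
  assume x: "x \<in> multiplier_class \<phi> arg \<alpha> \<delta> m N" and y: "\<forall>j\<in>{1..m}. norm (\<Lambda> j x - y j) \<le> \<delta> j"
  have "norm (\<Lambda> 0 x - inverse_fourier (abs_L2 (\<lambda>\<xi>. \<Sum>j\<in>J \<inter> {1..m}. b j \<xi> * rep_L2 (fourier (y j)) \<xi>))) \<le> C"
  proof (rule recovery_bound[OF J \<delta> \<open>0 \<le> C\<close> b AE])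
    show "norm (\<Lambda> j x) \<le> \<delta> j" if "j \<in> J - J \<inter> {1..m}" for j
      using x that convex_weightsD(1)[OF J] by (auto simp: multiplier_class_def)
  qed (use x y in \<open>auto simp: multiplier_class_def\<close>)
  then show "ereal (norm (\<Lambda> 0 x - inverse_fourier (abs_L2 (\<lambda>\<xi>. \<Sum>j\<in>J \<inter> {1..m}. b j \<xi> * rep_L2 (fourier (y j)) \<xi>)))) \<le> ereal C"
    by simp
qed

section \<open>The value of the optimal error\<close>

lemma convex_weights_affine:
  assumes J: "convex_weights J \<theta>" and f: "\<And>i. i \<in> J \<Longrightarrow> f i = \<alpha> i \<bullet> \<eta> + a"
  shows "(\<Sum>i\<in>J. \<theta> i * f i) = \<alpha> 0 \<bullet> \<eta> + a"
proof -
  note c = convex_weightsD[OF J]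
  have "(\<Sum>i\<in>J. \<theta> i * f i) = (\<Sum>i\<in>J. \<theta> i * (\<alpha> i \<bullet> \<eta>) + \<theta> i * a)"
    using f by (intro sum.cong) (auto simp: distrib_left)
  also have "\<dots> = \<alpha> 0 \<bullet> \<eta> + a"
    by (subst c(6)) (simp add: sum.distrib inner_sum_left c(4) flip: sum_distrib_right)
  finally show ?thesis .
qed

lemma prod_powr_eq_exp:
  assumes J: "convex_weights J \<theta>" and \<delta>: "\<And>j. j \<in> J \<Longrightarrow> 0 < \<delta> j"
  shows "(\<Prod>j\<in>J. \<delta> j powr \<theta> j) = exp (- (\<Sum>j\<in>J. \<theta> j * ln (1 / \<delta> j)))"
proof -
  have "(\<Prod>j\<in>J. \<delta> j powr \<theta> j) = (\<Prod>j\<in>J. exp (- (\<theta> j * ln (1 / \<delta> j))))"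
    using \<delta> by (intro prod.cong) (auto simp: powr_def ln_div less_imp_neq[symmetric])
  then show ?thesis using convex_weightsD(2)[OF J] by (simp add: exp_sum flip: sum_negf)
qed

lemma obtain_method:
  assumes J: "convex_weights J \<theta>" and \<delta>: "\<And>j. j \<in> J \<Longrightarrow> 0 < \<delta> j"
    and s: "s = (\<Sum>j\<in>J. \<theta> j * ln (1 / \<delta> j))"
  obtains b where "recovery_error \<Lambda> (multiplier_class \<phi> arg \<alpha> \<delta> m N) m \<delta>
    (\<lambda>y. inverse_fourier (abs_L2 (\<lambda>\<xi>. \<Sum>j\<in>J \<inter> {1..m}. b j \<xi> * rep_L2 (fourier (y j)) \<xi>))) \<le> ereal (exp (- s))"
proof -
  obtain b where b: "\<And>j. b j \<in> borel_measurable lebesgue"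
    "\<And>\<xi>. (\<Sum>j\<in>J. pw j \<xi> * b j \<xi>) = pw 0 \<xi>"
    "\<And>\<xi>. (\<Sum>j\<in>J. (\<delta> j)\<^sup>2 * (cmod (b j \<xi>))\<^sup>2 / \<theta> j) \<le> (\<Prod>j\<in>J. \<delta> j powr \<theta> j)\<^sup>2"
    using optimal_coefficients[OF J, of \<delta>] \<delta> by blast
  have "(\<Prod>j\<in>J. \<delta> j powr \<theta> j) = exp (- s)"
    unfolding s by (rule prod_powr_eq_exp[OF J \<delta>])
  with b(3) show ?thesis
    by (intro that[of b] recovery_error_le[OF J \<delta>]) (auto simp: b)
qed

text \<open>No support data are presupposed. The highest point of the hull above
  \<open>\<alpha> 0\<close> is itself a convex combination of the given points; its weights give a
  method with error at most \<open>exp (- s)\<close>, which meets the lower bound.\<close>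

lemma optimal_error_eq:
  assumes \<delta>: "\<And>j. j \<in> {1..N} \<Longrightarrow> 0 < \<delta> j" and "m \<le> N"
  shows "optimal_error \<Lambda> (multiplier_class \<phi> arg \<alpha> \<delta> m N) m \<delta> =
    ereal (exp (- real_of_ereal (S_fun \<alpha> \<delta> N (\<alpha> 0))))"
proof -
  \<comment> \<open>These weights only show that the hull has a point above
    \<open>\<alpha> 0\<close>, so that \<open>S_fun\<close> is finite there and
    \<open>real_of_ereal\<close> loses nothing.\<close>
  obtain J0 \<theta>0 where J0: "convex_weights J0 \<theta>0" by (rule obtain_convex_weights)
  note c = convex_weightsD[OF J0]
  have "(\<alpha> 0, \<Sum>j\<in>J0. \<theta>0 j * ln (1 / \<delta> j)) = (\<Sum>j\<in>J0. \<theta>0 j *\<^sub>R (\<alpha> j, ln (1 / \<delta> j)))"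
    using c(6) by (simp add: prod_eq_iff fst_sum snd_sum)
  also have "\<dots> \<in> exponent_hull \<alpha> \<delta> N"
  proof (rule convex_sum)
    show "convex (exponent_hull \<alpha> \<delta> N)" unfolding exponent_hull_def by (rule convex_convex_hull)
    show "(\<alpha> j, ln (1 / \<delta> j)) \<in> exponent_hull \<alpha> \<delta> N" if "j \<in> J0" for j
      using c(1) that by (intro point_in_exponent_hull) auto
  qed (use c in \<open>auto simp: less_imp_le\<close>)
  finally obtain s where s: "S_fun \<alpha> \<delta> N (\<alpha> 0) = ereal s" "(\<alpha> 0, s) \<in> exponent_hull \<alpha> \<delta> N"
    "\<And>z. (\<alpha> 0, z) \<in> exponent_hull \<alpha> \<delta> N \<Longrightarrow> z \<le> s"
    by (rule S_fun_maximum) blast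
  obtain J \<theta> where J: "J \<subseteq> {1..N}" "\<And>j. j \<in> J \<Longrightarrow> 0 < \<theta> j" "sum \<theta> J = 1"
    "(\<alpha> 0, s) = (\<Sum>j\<in>J. \<theta> j *\<^sub>R (\<alpha> j, ln (1 / \<delta> j)))"
    using convex_hull_image_representation[OF finite_atLeastAtMost s(2)[unfolded exponent_hull_def]] by auto
  have J': "convex_weights J \<theta>" "s = (\<Sum>j\<in>J. \<theta> j * ln (1 / \<delta> j))"
    using J by (simp_all add: convex_weights_def prod_eq_iff fst_sum snd_sum)
  have \<delta>J: "0 < \<delta> j" if "j \<in> J" for j using \<delta> J(1) that by auto
  obtain b where "recovery_error \<Lambda> (multiplier_class \<phi> arg \<alpha> \<delta> m N) m \<delta>
    (\<lambda>y. inverse_fourier (abs_L2 (\<lambda>\<xi>. \<Sum>j\<in>J \<inter> {1..m}. b j \<xi> * rep_L2 (fourier (y j)) \<xi>))) \<le> ereal (exp (- s))"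
    by (rule obtain_method[OF J'(1) \<delta>J J'(2)])
  from order_trans[OF optimal_error_le this]
  have "optimal_error \<Lambda> (multiplier_class \<phi> arg \<alpha> \<delta> m N) m \<delta> \<le> ereal (exp (- s))" .
  moreover have "ereal (exp (- s)) \<le> optimal_error \<Lambda> (multiplier_class \<phi> arg \<alpha> \<delta> m N) m \<delta>"
    unfolding optimal_error_def by (intro INF_greatest recovery_error_ge[OF \<delta> \<open>m \<le> N\<close> s(2,3)])
  ultimately show ?thesis by (simp add: s(1))
qed

text \<open>As the chosen points lie on the hyperplane, averaging them gives its height at
  \<open>\<alpha> 0\<close>, which is the value of \<open>S\<close>. So \<open>exp (- S)\<close> is
  the product of the \<open>\<delta> i powr \<theta> i\<close>.\<close>

lemma support_data_convex_weights:
  assumes "support_data \<alpha> \<delta> N \<eta> a l j \<theta>"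
  shows "convex_weights (j ` {1..l}) \<theta>"
    and "real_of_ereal (S_fun \<alpha> \<delta> N (\<alpha> 0)) = (\<Sum>i\<in>j ` {1..l}. \<theta> i * ln (1 / \<delta> i))"
    and "\<alpha> 0 \<bullet> \<eta> + a = (\<Sum>i\<in>j ` {1..l}. \<theta> i * ln (1 / \<delta> i))"
    and "support_hyperplane \<alpha> \<delta> N \<eta> a" and "inj_on j {1..l}"
proof -
  from assms have inj: "inj_on j {1..l}" and hyp: "support_hyperplane \<alpha> \<delta> N \<eta> a"
    and on: "\<And>i. i \<in> j ` {1..l} \<Longrightarrow> ln (1 / \<delta> i) = \<alpha> i \<bullet> \<eta> + a"
    by (auto simp: support_data_def)
  show J: "convex_weights (j ` {1..l}) \<theta>"
    using assms inj by (auto simp: support_data_def convex_weights_def sum.reindex)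
  note c = convex_weightsD[OF J]
  show eq: "\<alpha> 0 \<bullet> \<eta> + a = (\<Sum>i\<in>j ` {1..l}. \<theta> i * ln (1 / \<delta> i))"
    by (rule convex_weights_affine[OF J on, symmetric])
  show "real_of_ereal (S_fun \<alpha> \<delta> N (\<alpha> 0)) = (\<Sum>i\<in>j ` {1..l}. \<theta> i * ln (1 / \<delta> i))"
    using hyp eq by (simp add: support_hyperplane_def)
  show "support_hyperplane \<alpha> \<delta> N \<eta> a" "inj_on j {1..l}" by fact+
qed

text \<open>Affine independence lets a hyperplane pass through all the points
  \<open>(\<alpha> i, ln (1 / norm (\<Lambda> i x0)))\<close> with \<open>i\<close> in
  \<open>J\<close>, whatever \<open>x0\<close> is. As only these indices are constrained, its
  position relative to the other points is irrelevant.\<close>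

lemma SUP_ge_prod_affine_independent:
  assumes J: "convex_weights J \<theta>" and ind: "\<not> affine_dependent (\<alpha> ` J)" and "x0 \<in> X"
  shows "ereal (\<Prod>i\<in>J. norm (\<Lambda> i x0) powr \<theta> i) \<le>
    (SUP x\<in>{x\<in>X. \<forall>i\<in>J. norm (\<Lambda> i x) \<le> norm (\<Lambda> i x0)}. ereal (norm (\<Lambda> 0 x)))"
proof (cases "\<forall>i\<in>J. 0 < norm (\<Lambda> i x0)")
  case False
  note c = convex_weightsD[OF J]
  from False have "(\<Prod>i\<in>J. norm (\<Lambda> i x0) powr \<theta> i) = 0"
    using c(2) by (auto intro!: prod_zero)
  moreover have "ereal 0 \<le> (SUP x\<in>{x\<in>X. \<forall>i\<in>J. norm (\<Lambda> i x) \<le> norm (\<Lambda> i x0)}. ereal (norm (\<Lambda> 0 x)))"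
    using \<open>x0 \<in> X\<close> by (intro SUP_upper2[of x0]) auto
  ultimately show ?thesis by simp
next
  case True
  note c = convex_weightsD[OF J]
  define t where "t i = norm (\<Lambda> i x0)" for i
  \<comment> \<open>The interpolation assigns values to exponents, and \<open>\<alpha>\<close> may
    repeat on \<open>J\<close>. The norms are therefore written as a function of the exponent, on
    which alone the operator depends.\<close>
  define T where "T p = norm (inverse_fourier (abs_L2 (\<lambda>\<xi>. multi_power \<phi> arg p \<xi> * rep_L2 (fourier x0) \<xi>)))" for p
  have T: "t i = T (\<alpha> i)" for i
    by (simp add: t_def T_def multiplier_op_def)
  obtain \<eta> a where ha: "\<And>p. p \<in> \<alpha> ` J \<Longrightarrow> ln (1 / T p) = p \<bullet> \<eta> + a"
    using affine_interpolation[OF ind, of "\<lambda>p. ln (1 / T p)"] by blast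
  have on: "ln (1 / t i) = \<alpha> i \<bullet> \<eta> + a" if "i \<in> J" for i
    using ha[of "\<alpha> i"] that by (simp add: T)
  have pos: "0 < t i" if "i \<in> J" for i using True that by (simp add: t_def)
  have "(\<Sum>i\<in>J. \<theta> i * ln (1 / t i)) = \<alpha> 0 \<bullet> \<eta> + a"
    by (rule convex_weights_affine[OF J on])
  then have "(\<Prod>i\<in>J. t i powr \<theta> i) = exp (- (\<alpha> 0 \<bullet> \<eta> + a))"
    by (simp only: prod_powr_eq_exp[OF J pos])
  moreover have "ereal (exp (- (\<alpha> 0 \<bullet> \<eta> + a))) \<le>
      (SUP x\<in>{x\<in>X. \<forall>i\<in>J. norm (\<Lambda> i x) \<le> t i}. ereal (norm (\<Lambda> 0 x)))"
    using c(1) pos on by (intro SUP_norm_multiplier_op_0_ge) auto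
  ultimately show ?thesis by (simp add: t_def)
qed

end

text \<open>Indices and weights are tied to \<open>\<delta>\<close>. For an \<open>x0\<close> whose
  norms favour another combination of the operators, the supremum under all \<open>N\<close>
  constraints can be strictly below the product. Sharpness is therefore claimed where the norms of
  \<open>x0\<close> admit the same indices and weights and, for affinely independent exponents, for
  every \<open>x0\<close> with only the operators in \<open>J\<close> constrained. Positivity of the
  norms ensures that \<open>ln (1 / norm (\<Lambda> i x0))\<close> is a genuine height.\<close>

theorem theorem2:
  fixes \<phi> :: "'k::finite \<Rightarrow> real ^ 'd::finite \<Rightarrow> complex"
    and arg :: "'k \<Rightarrow> real ^ 'd \<Rightarrow> real"
    and \<alpha> :: "nat \<Rightarrow> real ^ 'k"
    and \<delta> :: "nat \<Rightarrow> real"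
    and m N :: nat
  assumes mN: "1 \<le> m" "m \<le> N"
    and continuous: "\<And>i. continuous_on UNIV (\<phi> i)"
    and moduli: "\<And>r :: 'k \<Rightarrow> real. (\<forall>i. 0 < r i) \<Longrightarrow> \<exists>\<xi>. \<forall>i. cmod (\<phi> i \<xi>) = r i"
    and branch: "is_branch \<phi> arg"
    and nonneg: "\<And>j i. j \<in> {1..N} \<Longrightarrow> 0 \<le> \<alpha> j $ i"
    and hull: "\<alpha> 0 \<in> convex hull (\<alpha> ` {1..N})"
    and delta: "\<And>j. j \<in> {1..N} \<Longrightarrow> 0 < \<delta> j"
  defines "X \<equiv> multiplier_space \<phi> arg \<alpha> N"
    and "W \<equiv> multiplier_class \<phi> arg \<alpha> \<delta> m N"
    and "\<Lambda> \<equiv> multiplier_op \<phi> arg \<alpha>"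
    and "S0 \<equiv> real_of_ereal (S_fun \<alpha> \<delta> N (\<alpha> 0))"
  shows
    "optimal_error \<Lambda> W m \<delta> = ereal (exp (- S0)) \<and>
     (\<forall>\<eta> a l j \<theta>. support_data \<alpha> \<delta> N \<eta> a l j \<theta> \<longrightarrow>
        (let J = j ` {1..l}; M = J \<inter> {1..m} in
         (M \<noteq> {} \<longrightarrow>
            (\<forall>b :: nat \<Rightarrow> real ^ 'd \<Rightarrow> complex.
               (\<forall>i\<in>J. b i \<in> borel_measurable lebesgue) \<and>
               (AE \<xi> in lebesgue.
                  (\<Sum>s=1..l. multi_power \<phi> arg (\<alpha> (j s)) \<xi> * b (j s) \<xi>)
                    = multi_power \<phi> arg (\<alpha> 0) \<xi> \<and>
                  (\<Sum>s=1..l. (\<delta> (j s))\<^sup>2 * (cmod (b (j s) \<xi>))\<^sup>2 / \<theta> (j s))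
                    \<le> exp (- 2 * S0)) \<longrightarrow>
               optimal_method \<Lambda> W m \<delta>
                 (\<lambda>y. inverse_fourier
                        (abs_L2 (\<lambda>\<xi>. \<Sum>i\<in>M. b i \<xi> * rep_L2 (fourier (y i)) \<xi>))))) \<and>
         (M = {} \<longrightarrow> optimal_method \<Lambda> W m \<delta> (\<lambda>y. 0)) \<and>
         (\<forall>x\<in>X. norm (\<Lambda> 0 x) \<le> (\<Prod>s=1..l. norm (\<Lambda> (j s) x) powr \<theta> (j s))) \<and>
         \<not> (\<exists>x0\<in>X.
               (\<forall>i\<in>{1..N}. 0 < norm (\<Lambda> i x0)) \<and>
               (\<exists>\<eta>' a'. support_data \<alpha> (\<lambda>i. norm (\<Lambda> i x0)) N \<eta>' a' l j \<theta>) \<and>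
               (SUP x\<in>{x\<in>X. \<forall>i\<in>{1..N}. norm (\<Lambda> i x) \<le> norm (\<Lambda> i x0)}. ereal (norm (\<Lambda> 0 x)))
                 < ereal (\<Prod>s=1..l. norm (\<Lambda> (j s) x0) powr \<theta> (j s))) \<and>
         (\<not> affine_dependent (\<alpha> ` J) \<longrightarrow>
            exact_inequality X \<Lambda> J (\<lambda>t. \<Prod>s=1..l. t (j s) powr \<theta> (j s)))))"
proof -
  interpret fm: fourier_multipliers \<phi> arg \<alpha> N
    by standard (fact continuous moduli branch nonneg hull)+
  have E: "optimal_error \<Lambda> W m \<delta> = ereal (exp (- S0))"
    unfolding \<Lambda>_def W_def S0_def by (rule fm.optimal_error_eq[OF delta mN(2)])
  have optimal: "optimal_method \<Lambda> W m \<delta> \<Phi>" if "recovery_error \<Lambda> W m \<delta> \<Phi> \<le> ereal (exp (- S0))" for \<Phi>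
    unfolding optimal_method_def using that optimal_error_le[of \<Lambda> W m \<delta> \<Phi>] E by (intro antisym) simp_all
  show ?thesis
  proof (rule conjI[OF E], intro allI impI, goal_cases)
    case sd: (1 \<eta> a l j \<theta>)
    define J where "J = j ` {1..l}"
    define M where "M = J \<inter> {1..m}"
    note sd' = fm.support_data_convex_weights[OF sd, folded J_def]
    have J: "fm.convex_weights J \<theta>" by (rule sd'(1))
    have S0: "S0 = (\<Sum>i\<in>J. \<theta> i * ln (1 / \<delta> i))" unfolding S0_def by (rule sd'(2))
    have \<delta>J: "0 < \<delta> i" if "i \<in> J" for i using delta fm.convex_weightsD(1)[OF J] that by auto
    have sum_J: "sum f J = (\<Sum>s=1..l. f (j s))" "sum g J = (\<Sum>s=1..l. g (j s))"
      for f :: "nat \<Rightarrow> complex" and g :: "nat \<Rightarrow> real"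
      unfolding J_def using sd'(5) by (simp_all add: sum.reindex)
    have prod_J: "prod f J = (\<Prod>s=1..l. f (j s))" for f :: "nat \<Rightarrow> real"
      unfolding J_def using sd'(5) by (simp add: prod.reindex)
    have coefficients: "optimal_method \<Lambda> W m \<delta>
        (\<lambda>y. inverse_fourier (abs_L2 (\<lambda>\<xi>. \<Sum>i\<in>M. b i \<xi> * rep_L2 (fourier (y i)) \<xi>)))"
      if "\<forall>i\<in>J. b i \<in> borel_measurable lebesgue"
        and AE: "AE \<xi> in lebesgue. (\<Sum>s=1..l. multi_power \<phi> arg (\<alpha> (j s)) \<xi> * b (j s) \<xi>) = multi_power \<phi> arg (\<alpha> 0) \<xi> \<and>
          (\<Sum>s=1..l. (\<delta> (j s))\<^sup>2 * (cmod (b (j s) \<xi>))\<^sup>2 / \<theta> (j s)) \<le> exp (- 2 * S0)"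
      for b :: "nat \<Rightarrow> real ^ 'd \<Rightarrow> complex"
    proof (rule optimal, unfold \<Lambda>_def W_def M_def, rule fm.recovery_error_le[OF J \<delta>J])
      have "exp (- 2 * S0) = (exp (- S0))\<^sup>2" by (simp flip: exp_double)
      with AE show "AE \<xi> in lebesgue. (\<Sum>i\<in>J. multi_power \<phi> arg (\<alpha> i) \<xi> * b i \<xi>) = multi_power \<phi> arg (\<alpha> 0) \<xi> \<and>
          (\<Sum>i\<in>J. (\<delta> i)\<^sup>2 * (cmod (b i \<xi>))\<^sup>2 / \<theta> i) \<le> (exp (- S0))\<^sup>2"
        by (simp only: sum_J)
    qed (use that(1) in auto)
    have zero: "optimal_method \<Lambda> W m \<delta> (\<lambda>y. 0)" if "M = {}"
    proof (rule optimal)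
      \<comment> \<open>For empty \<open>M\<close> the sum in this method is empty, so the method is
        the zero method whatever \<open>b\<close> is.\<close>
      obtain b where "recovery_error \<Lambda> W m \<delta>
          (\<lambda>y. inverse_fourier (abs_L2 (\<lambda>\<xi>. \<Sum>j\<in>M. b j \<xi> * rep_L2 (fourier (y j)) \<xi>))) \<le> ereal (exp (- S0))"
        unfolding \<Lambda>_def W_def M_def by (rule fm.obtain_method[OF J \<delta>J S0])
      then show "recovery_error \<Lambda> W m \<delta> (\<lambda>y. 0) \<le> ereal (exp (- S0))"
        using that by (simp flip: zero_L2_def)
    qed
    have inequality: "norm (\<Lambda> 0 x) \<le> (\<Prod>i\<in>J. norm (\<Lambda> i x) powr \<theta> i)" if "x \<in> X" for x
      using that unfolding X_def \<Lambda>_def by (rule fm.multiplicative_inequality[OF _ J])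
    have sharp: "ereal (\<Prod>i\<in>J. norm (\<Lambda> i x0) powr \<theta> i) \<le>
        (SUP x\<in>{x\<in>X. \<forall>i\<in>{1..N}. norm (\<Lambda> i x) \<le> norm (\<Lambda> i x0)}. ereal (norm (\<Lambda> 0 x)))"
      if "\<forall>i\<in>{1..N}. 0 < norm (\<Lambda> i x0)" "support_data \<alpha> (\<lambda>i. norm (\<Lambda> i x0)) N \<eta>' a' l j \<theta>" for x0 \<eta>' a'
    proof -
      note sd2 = fm.support_data_convex_weights[OF that(2), folded J_def]
      have pos: "0 < norm (\<Lambda> i x0)" if "i \<in> J" for i
        using \<open>\<forall>i\<in>{1..N}. 0 < norm (\<Lambda> i x0)\<close> fm.convex_weightsD(1)[OF J] that by auto
      have "(\<Prod>i\<in>J. norm (\<Lambda> i x0) powr \<theta> i) = exp (- (\<alpha> 0 \<bullet> \<eta>' + a'))"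
        unfolding sd2(3) by (rule fm.prod_powr_eq_exp[OF J pos])
      moreover have "ereal (exp (- (\<alpha> 0 \<bullet> \<eta>' + a'))) \<le>
          (SUP x\<in>{x\<in>X. \<forall>i\<in>{1..N}. norm (\<Lambda> i x) \<le> norm (\<Lambda> i x0)}. ereal (norm (\<Lambda> 0 x)))"
        unfolding X_def using that(1) support_hyperplane_above[OF sd2(4)] unfolding \<Lambda>_def
        by (intro fm.SUP_norm_multiplier_op_0_ge) auto
      ultimately show ?thesis by simp
    qed
    have sharp_J: "ereal (\<Prod>i\<in>J. norm (\<Lambda> i x0) powr \<theta> i) \<le>
        (SUP x\<in>{x\<in>X. \<forall>i\<in>J. norm (\<Lambda> i x) \<le> norm (\<Lambda> i x0)}. ereal (norm (\<Lambda> 0 x)))"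
      if "\<not> affine_dependent (\<alpha> ` J)" "x0 \<in> X" for x0
      using that unfolding X_def \<Lambda>_def by (intro fm.SUP_ge_prod_affine_independent J)
    show ?case
      unfolding Let_def J_def[symmetric] M_def[symmetric]
    proof (intro conjI impI, goal_cases)
      case 1
      show ?case by (intro allI impI) (elim conjE, rule coefficients)
    next
      case 2
      then show ?case by (rule zero)
    next
      case 3
      show ?case using inequality unfolding prod_J by blast
    next
      case 4
      show ?case
      proof (intro notI, elim bexE conjE exE)
        fix x0 \<eta>' a'
        assume "\<forall>i\<in>{1..N}. 0 < norm (\<Lambda> i x0)" "support_data \<alpha> (\<lambda>i. norm (\<Lambda> i x0)) N \<eta>' a' l j \<theta>"
        from sharp[OF this]
        show "(SUP x\<in>{x\<in>X. \<forall>i\<in>{1..N}. norm (\<Lambda> i x) \<le> norm (\<Lambda> i x0)}. ereal (norm (\<Lambda> 0 x)))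
            < ereal (\<Prod>s=1..l. norm (\<Lambda> (j s) x0) powr \<theta> (j s)) \<Longrightarrow> False"
          by (simp only: prod_J not_less[symmetric] simp_thms)
      qed
    next
      case 5
      show ?case
        unfolding exact_inequality_def
      proof (intro conjI ballI notI; (elim bexE)?)
        show "norm (\<Lambda> 0 x) \<le> (\<Prod>s=1..l. norm (\<Lambda> (j s) x) powr \<theta> (j s))" if "x \<in> X" for x
          using inequality[OF that] by (simp only: prod_J)
        fix x0 assume "x0 \<in> X"
        from sharp_J[OF 5 this]
        show "(SUP x\<in>{x\<in>X. \<forall>i\<in>J. norm (\<Lambda> i x) \<le> norm (\<Lambda> i x0)}. ereal (norm (\<Lambda> 0 x)))
            < ereal (\<Prod>s=1..l. norm (\<Lambda> (j s) x0) powr \<theta> (j s)) \<Longrightarrow> False"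
          by (simp only: prod_J not_less[symmetric] simp_thms)
      qed
    qed
  qed
qed

end
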